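(* Let $u\in L^{1}(\Omega;L^{1}(S))$ and $t\in[0,\infty)$. Then $$\mathbb{P}\left(\left\{\omega\in\Omega:\ (T(t)u)(\omega)=T(t,g(\omega))u(\omega)\right\}\right)=1.$$
   Context: Setting. $n\in\mathbb{N}$, $n\ge 2$; $p\in(1,\infty)\setminus\{2\}$; $S\subseteq\mathbb{R}^{n}$ is a nonempty open, bounded, connected set of class $C^{1}$; $\lambda$ is Lebesgue measure; $0<g_{1}\le g_{2}<\infty$ are constants. $(\Omega,\mathcal{F},\mathbb{P})$ is a complete probability space. For a Banach space $X$, $L^{1}(\Omega;X)$ is the space of $\mathcal{F}$-$\mathfrak{B}(X)$-measurable $f:\Omega\to X$ with $\int_{\Omega}\|f\|_{X}\,d\mathbb{P}<\infty$ (with its usual norm). $L^{1}_{g_{1},g_{2}}(S):=\{\gamma\in L^{1}(S): g_{1}\le\gamma\le g_{2}\text{ a.e. on }S\}$, and $g\in L^{1}(\Omega;L^{1}(S))$ is fixed with $\mathbb{P}(g\in L^{1}_{g_{1},g_{2}}(S))=1$. Convention: $|x|^{p-2}x:=0$ if $x=0$. Operators. $A$ is the operator on $L^{1}(\Omega;L^{1}(S))$ with $(f,\hat f)\in A$ if and only if $f,\hat f\in L^{1}(\Omega;L^{1}(S))$, $\mathbb{P}(f\in W^{1,p}(S)\cap L^{\infty}(S))=1$, and with probability one $\int_{S}g|\nabla f|^{p-2}\nabla f\cdot\nabla\varphi\,d\lambda=\int_{S}\hat f\varphi\,d\lambda$ for all $\varphi\in W^{1,p}(S)\cap L^{\infty}(S)$.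 $\mathcal{A}$ is the closure of $A$ in $L^{1}(\Omega;L^{1}(S))^{2}$. For $\gamma\in L^{1}_{g_{1},g_{2}}(S)$, $a(\gamma)$ is the operator on $L^{1}(S)$ with $(f,\hat f)\in a(\gamma)$ if and only if $f\in W^{1,p}(S)\cap L^{\infty}(S)$, $\hat f\in L^{1}(S)$ and $\int_{S}\gamma|\nabla f|^{p-2}\nabla f\cdot\nabla\varphi\,d\lambda=\int_{S}\hat f\varphi\,d\lambda$ for all $\varphi\in W^{1,p}(S)\cap L^{\infty}(S)$; $\mathfrak{a}(\gamma)$ is its closure in $L^{1}(S)^{2}$. Semigroups. $\mathcal{A}$ and $\mathfrak{a}(\gamma)$ are m-accretive (accretive with $R(\mathrm{Id}+\cdot)$ the whole space) and densely defined. $T(\cdot)u\in C([0,\infty);L^{1}(\Omega;L^{1}(S)))$ denotes the unique mild solution of $0\in U'(t)+\mathcal{A}U(t)$, $U(0)=u$, and $T(\cdot,\gamma)v\in C([0,\infty);L^{1}(S))$ the unique mild solution of $0\in V'(t)+\mathfrak{a}(\gamma)V(t)$, $V(0)=v\in L^{1}(S)$. Equivalently (exponential formula) $T(t)u=\lim_{m\to\infty}(\mathrm{Id}+\frac{t}{m}\mathcal{A})^{-m}u$ in $L^{1}(\Omega;L^{1}(S))$ and $T(t,\gamma)v=\lim_{m\to\infty}(\mathrm{Id}+\frac{t}{m}\mathfrak{a}(\gamma))^{-m}v$ in $L^{1}(S)$. *)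

theory Defs
  imports "HOL-Probability.Probability" "HOL-Library.Function_Algebras"
begin

section \<open>The Banach space of classes of Lebesgue integrable functions\<close>

text \<open>
  Elements of \<open>'a L1\<close> are integrable functions modulo equality almost everywhere;
  \<open>rep_L1\<close> chooses a representative. Borel representatives suffice, because every Lebesgue
  measurable function agrees almost everywhere with a Borel measurable one. All notions below that
  mention \<open>rep_L1\<close> are invariant under changes on null sets.
\<close>

quotient_type (overloaded) 'a L1 = "'a::euclidean_space \<Rightarrow> real" / partial:
  "\<lambda>f h. integrable lborel f \<and> integrable lborel h \<and> (AE x in lborel. f x = h x)"
proof (rule part_equivpI)
  show "\<exists>f::'a \<Rightarrow> real. integrable lborel f \<and> integrable lborel f \<and> (AE x in lborel. f x = f x)"
    by (rule exI[of _ "\<lambda>_. 0"]) simp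
  show "symp (\<lambda>f h :: 'a \<Rightarrow> real.
      integrable lborel f \<and> integrable lborel h \<and> (AE x in lborel. f x = h x))"
    by (rule sympI) (auto elim: eventually_mono)
  show "transp (\<lambda>f h :: 'a \<Rightarrow> real.
      integrable lborel f \<and> integrable lborel h \<and> (AE x in lborel. f x = h x))"
    by (rule transpI) (auto elim: eventually_elim2)
qed

instantiation L1 :: (euclidean_space) real_vector
begin

lift_definition zero_L1 :: "'a L1" is "\<lambda>_. 0"
  by simp

lift_definition plus_L1 :: "'a L1 \<Rightarrow> 'a L1 \<Rightarrow> 'a L1" is "\<lambda>f h x. f x + h x"
  by auto

lift_definition minus_L1 :: "'a L1 \<Rightarrow> 'a L1 \<Rightarrow> 'a L1" is "\<lambda>f h x. f x - h x"
  by auto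

lift_definition uminus_L1 :: "'a L1 \<Rightarrow> 'a L1" is "\<lambda>f x. - f x"
  by auto

lift_definition scaleR_L1 :: "real \<Rightarrow> 'a L1 \<Rightarrow> 'a L1" is "\<lambda>c f x. c * f x"
  by auto

instance
proof
  fix f h k :: "'a L1" and c d :: real
  show "f + h + k = f + (h + k)" by transfer (auto simp: add.assoc)
  show "f + h = h + f" by transfer (auto simp: add.commute)
  show "0 + f = f" by transfer auto
  show "- f + f = 0" by transfer auto
  show "f - h = f + - h" by transfer auto
  show "c *\<^sub>R (f + h) = c *\<^sub>R f + c *\<^sub>R h" by transfer (auto simp: algebra_simps)
  show "(c + d) *\<^sub>R f = c *\<^sub>R f + d *\<^sub>R f" by transfer (auto simp: algebra_simps)
  show "c *\<^sub>R d *\<^sub>R f = (c * d) *\<^sub>R f" by transfer (auto simp: algebra_simps)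
  show "1 *\<^sub>R f = f" by transfer auto
qed

end

instantiation L1 :: (euclidean_space) real_normed_vector
begin

lift_definition norm_L1 :: "'a L1 \<Rightarrow> real" is "\<lambda>f. LINT x|lborel. \<bar>f x\<bar>"
  by (rule integral_cong_AE) auto

definition sgn_L1 :: "'a L1 \<Rightarrow> 'a L1" where
  "sgn_L1 f = f /\<^sub>R norm f"

definition dist_L1 :: "'a L1 \<Rightarrow> 'a L1 \<Rightarrow> real" where
  "dist_L1 f h = norm (f - h)"

definition uniformity_L1 :: "('a L1 \<times> 'a L1) filter" where
  "uniformity_L1 = (INF e\<in>{0<..}. principal {(f, h). dist f h < e})"

definition open_L1 :: "'a L1 set \<Rightarrow> bool" where
  "open_L1 U = (\<forall>f\<in>U. eventually (\<lambda>(f', h). f' = f \<longrightarrow> h \<in> U) uniformity)"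

instance
proof
  fix f h :: "'a L1" and c :: real and U :: "'a L1 set"
  show "dist f h = norm (f - h)" by (rule dist_L1_def)
  show "sgn f = f /\<^sub>R norm f" by (rule sgn_L1_def)
  show "(uniformity :: ('a L1 \<times> 'a L1) filter) = (INF e\<in>{0<..}. principal {(f, h). dist f h < e})"
    by (rule uniformity_L1_def)
  show "open U \<longleftrightarrow> (\<forall>f\<in>U. eventually (\<lambda>(f', h). f' = f \<longrightarrow> h \<in> U) uniformity)"
    by (rule open_L1_def)
  show "norm f = 0 \<longleftrightarrow> f = 0"
  proof transfer
    fix f :: "'a \<Rightarrow> real"
    assume "integrable lborel f \<and> integrable lborel f \<and> (AE x in lborel. f x = f x)"
    then show "(LINT x|lborel. \<bar>f x\<bar>) = 0 \<longleftrightarrow>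
        integrable lborel f \<and> integrable lborel (\<lambda>_::'a. 0::real) \<and> (AE x in lborel. f x = 0)"
      using integral_nonneg_eq_0_iff_AE[of lborel "\<lambda>x. \<bar>f x\<bar>"] by simp
  qed
  show "norm (f + h) \<le> norm f + norm h"
  proof transfer
    fix f h :: "'a \<Rightarrow> real"
    assume "integrable lborel f \<and> integrable lborel f \<and> (AE x in lborel. f x = f x)"
      and "integrable lborel h \<and> integrable lborel h \<and> (AE x in lborel. h x = h x)"
    then have fh: "integrable lborel f" "integrable lborel h" by auto
    then have "(LINT x|lborel. \<bar>f x + h x\<bar>) \<le> (LINT x|lborel. \<bar>f x\<bar> + \<bar>h x\<bar>)"
      by (intro integral_mono) auto
    also have "\<dots> = (LINT x|lborel. \<bar>f x\<bar>) + (LINT x|lborel. \<bar>h x\<bar>)"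
      using fh by (intro Bochner_Integration.integral_add) auto
    finally show "(LINT x|lborel. \<bar>f x + h x\<bar>) \<le> (LINT x|lborel. \<bar>f x\<bar>) + (LINT x|lborel. \<bar>h x\<bar>)" .
  qed
  show "norm (c *\<^sub>R f) = \<bar>c\<bar> * norm f"
    by transfer (simp add: abs_mult)
qed

end

text \<open>
  \<open>L\<^sup>1(S)\<close>: a class on \<open>S\<close> is identified with its extension by zero.
\<close>

definition L1_on :: "'a::euclidean_space set \<Rightarrow> 'a L1 set" where
  "L1_on S = {f. AE x in lborel. x \<notin> S \<longrightarrow> rep_L1 f x = 0}"

definition L1_between :: "real \<Rightarrow> real \<Rightarrow> 'a::euclidean_space set \<Rightarrow> 'a L1 set" where
  "L1_between g1 g2 S =
     {\<gamma>\<in>L1_on S. AE x in lborel. x \<in> S \<longrightarrow> g1 \<le> rep_L1 \<gamma> x \<and> rep_L1 \<gamma> x \<le> g2}"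

section \<open>Bochner integrable random elements\<close>

text \<open>
  \<open>L\<^sup>1(\<Omega>; L\<^sup>1(S))\<close> is represented by functions on \<open>\<Omega>\<close> together with the seminorm
  \<open>L1_Omega_norm\<close>; two representatives are the same element iff their difference has seminorm 0,
  i.e. iff they agree almost surely.
\<close>

definition L1_Omega :: "'w measure \<Rightarrow> 'a::euclidean_space set \<Rightarrow> ('w \<Rightarrow> 'a L1) set" where
  "L1_Omega P S = {u. (\<forall>\<omega>\<in>space P. u \<omega> \<in> L1_on S) \<and> u \<in> borel_measurable P \<and>
     (\<integral>\<^sup>+\<omega>. ennreal (norm (u \<omega>)) \<partial>P) < \<infinity>}"

definition L1_Omega_norm :: "'w measure \<Rightarrow> ('w \<Rightarrow> 'a::euclidean_space L1) \<Rightarrow> real" where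
  "L1_Omega_norm P u = (LINT \<omega>|P. norm (u \<omega>))"

text \<open>Pointwise scaling makes functions into a vector space a vector space.\<close>

instantiation "fun" :: (type, real_vector) real_vector
begin

definition scaleR_fun :: "real \<Rightarrow> ('a \<Rightarrow> 'b) \<Rightarrow> 'a \<Rightarrow> 'b" where
  "scaleR_fun c f = (\<lambda>x. c *\<^sub>R f x)"

instance
  by standard (auto simp: scaleR_fun_def plus_fun_def fun_eq_iff algebra_simps)

end

section \<open>Closures of operators and mild solutions\<close>

text \<open>
  A possibly multivalued operator on a seminormed space \<open>X\<close> with seminorm \<open>N\<close> is a
  subset of \<open>X \<times> X\<close>.
\<close>

definition operator_closure :: "'x::real_vector set \<Rightarrow> ('x \<Rightarrow> real) \<Rightarrow> ('x \<times> 'x) set \<Rightarrow> ('x \<times> 'x) set"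
  where "operator_closure X N A = {(f, fh). f \<in> X \<and> fh \<in> X \<and>
     (\<forall>\<epsilon>>0. \<exists>(h, hh)\<in>A. N (f - h) < \<epsilon> \<and> N (fh - hh) < \<epsilon>)}"

text \<open>
  An \<open>\<epsilon>\<close>-approximate solution of \<open>0 \<in> U' + A U\<close> on \<open>[0, \<tau>]\<close> in the sense of Benilan, Crandall
  and Pazy: a partition \<open>s 0 < \<dots> < s n\<close> of mesh at most \<open>\<epsilon>\<close>, covering \<open>[0, \<tau>]\<close> up to pieces of
  length at most \<open>\<epsilon>\<close> at both ends, right-hand sides \<open>y\<close> with total size at most \<open>\<epsilon>\<close>, and values
  \<open>v\<close> solving the implicit Euler scheme
  \<open>(v i - v (i - 1)) / (s i - s (i - 1)) + A (v i) \<ni> y i\<close> for \<open>1 \<le> i \<le> n\<close>.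
\<close>

definition eps_approx_solution ::
    "'x::real_vector set \<Rightarrow> ('x \<Rightarrow> real) \<Rightarrow> ('x \<times> 'x) set \<Rightarrow> real \<Rightarrow> real \<Rightarrow>
     nat \<Rightarrow> (nat \<Rightarrow> real) \<Rightarrow> (nat \<Rightarrow> 'x) \<Rightarrow> (nat \<Rightarrow> 'x) \<Rightarrow> bool" where
  "eps_approx_solution X N A \<tau> \<epsilon> n s y v \<longleftrightarrow>
     0 \<le> s 0 \<and> s 0 \<le> \<epsilon> \<and> s n \<le> \<tau> \<and> \<tau> - s n \<le> \<epsilon> \<and>
     (\<forall>i<n. s i < s (Suc i) \<and> s (Suc i) - s i \<le> \<epsilon>) \<and>
     v 0 \<in> X \<and> (\<forall>i<n. v (Suc i) \<in> X \<and> y (Suc i) \<in> X) \<and>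
     (\<Sum>i<n. (s (Suc i) - s i) * N (y (Suc i))) \<le> \<epsilon> \<and>
     (\<forall>i<n. (v (Suc i), y (Suc i) - (1 / (s (Suc i) - s i)) *\<^sub>R (v (Suc i) - v i)) \<in> A)"

text \<open>
  \<open>U\<close>, of which only the values on \<open>[0, \<infinity>)\<close> matter, is a mild solution of
  \<open>0 \<in> U' + A U\<close>, \<open>U 0 = u\<close>: it is continuous, and on each \<open>[0, \<tau>]\<close> it is uniformly within \<open>\<epsilon>\<close> of
  the step function of some \<open>\<epsilon>\<close>-approximate solution, for each \<open>\<epsilon> > 0\<close>.
\<close>

definition mild_solution ::
    "'x::real_vector set \<Rightarrow> ('x \<Rightarrow> real) \<Rightarrow> ('x \<times> 'x) set \<Rightarrow> 'x \<Rightarrow> (real \<Rightarrow> 'x) \<Rightarrow> bool" where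
  "mild_solution X N A u U \<longleftrightarrow>
     (\<forall>t\<ge>0. U t \<in> X) \<and>
     (\<forall>t\<ge>0. ((\<lambda>r. N (U r - U t)) \<longlongrightarrow> 0) (at t within {0..})) \<and>
     N (U 0 - u) = 0 \<and>
     (\<forall>\<tau>>0. \<forall>\<epsilon>>0. \<exists>n s y v. eps_approx_solution X N A \<tau> \<epsilon> n s y v \<and>
        N (U (s 0) - v 0) \<le> \<epsilon> \<and>
        (\<forall>i<n. \<forall>t. s i < t \<and> t \<le> s (Suc i) \<longrightarrow> N (U t - v (Suc i)) \<le> \<epsilon>))"

section \<open>Sobolev spaces and domains of class C1\<close>

text \<open>
  A function is smooth iff it has iterated partial derivatives of all orders, all of them
  (Frechet) differentiable; \<open>D is\<close> is the derivative along the list \<open>is\<close> of coordinates.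
\<close>

definition smooth :: "(real^'n \<Rightarrow> real) \<Rightarrow> bool" where
  "smooth \<phi> \<longleftrightarrow> (\<exists>D :: 'n list \<Rightarrow> real^'n \<Rightarrow> real. D [] = \<phi> \<and>
     (\<forall>is x. GDERIV (D is) x :> (\<chi> i. D (i # is) x)))"

definition test_function :: "(real^'n) set \<Rightarrow> (real^'n \<Rightarrow> real) \<Rightarrow> bool" where
  "test_function S \<phi> \<longleftrightarrow>
     smooth \<phi> \<and> compact (closure {x. \<phi> x \<noteq> 0}) \<and> closure {x. \<phi> x \<noteq> 0} \<subseteq> S"

definition Lp_on :: "real \<Rightarrow> (real^'n) set \<Rightarrow> (real^'n \<Rightarrow> 'b::euclidean_space) \<Rightarrow> bool" where
  "Lp_on p S f \<longleftrightarrow> set_borel_measurable lborel S f \<and>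
     set_integrable lborel S (\<lambda>x. norm (f x) powr p)"

definition Linfty_on :: "(real^'n) set \<Rightarrow> (real^'n \<Rightarrow> real) \<Rightarrow> bool" where
  "Linfty_on S f \<longleftrightarrow> set_borel_measurable lborel S f \<and>
     (\<exists>C. AE x in lborel. x \<in> S \<longrightarrow> \<bar>f x\<bar> \<le> C)"

text \<open>
  \<open>sobolev_gradient p S f F\<close>: \<open>f \<in> W\<^sup>1\<^sup>,\<^sup>p(S)\<close> and \<open>F\<close> is (a representative of) its weak
  gradient \<open>\<nabla>f\<close>.
\<close>

definition sobolev_gradient ::
    "real \<Rightarrow> (real^'n) set \<Rightarrow> (real^'n \<Rightarrow> real) \<Rightarrow> (real^'n \<Rightarrow> real^'n) \<Rightarrow> bool" where
  "sobolev_gradient p S f F \<longleftrightarrow> Lp_on p S f \<and> Lp_on p S F \<and>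
     (\<forall>\<phi> \<Phi>. test_function S \<phi> \<and> (\<forall>x. GDERIV \<phi> x :> \<Phi> x) \<longrightarrow>
        (LINT x:S|lborel. f x *\<^sub>R \<Phi> x) = - (LINT x:S|lborel. \<phi> x *\<^sub>R F x))"

definition W1p_Linfty :: "real \<Rightarrow> (real^'n) set \<Rightarrow> (real^'n \<Rightarrow> real) set" where
  "W1p_Linfty p S = {f. (\<exists>F. sobolev_gradient p S f F) \<and> Linfty_on S f}"

text \<open>
  In a neighbourhood of each boundary point, \<open>S\<close> is the part above the graph of a \<open>C\<^sup>1\<close> function
  in the direction of some unit vector \<open>e\<close>. A function on the hyperplane orthogonal to \<open>e\<close> is
  encoded as a function on the whole space that is constant in direction \<open>e\<close>.
\<close>

definition C1_domain :: "(real^'n) set \<Rightarrow> bool" where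
  "C1_domain S \<longleftrightarrow> (\<forall>z\<in>frontier S. \<exists>r>0. \<exists>e \<psi> \<Psi>. norm e = 1 \<and>
     (\<forall>x. GDERIV \<psi> x :> \<Psi> x) \<and> continuous_on UNIV \<Psi> \<and>
     (\<forall>x c. \<psi> (x + c *\<^sub>R e) = \<psi> x) \<and>
     S \<inter> ball z r = {x \<in> ball z r. \<psi> x < x \<bullet> e})"

section \<open>The weighted p-Laplace operators\<close>

text \<open>
  The weak formulation, for \<open>f \<in> W\<^sup>1\<^sup>,\<^sup>p(S)\<close>. Since \<open>0 powr a = 0\<close>, and since the vector factor
  vanishes there anyway, the integrand follows the convention \<open>|x|\<^sup>p\<^sup>-\<^sup>2 x = 0\<close> at \<open>x = 0\<close>. The
  quantification over \<open>F\<close> and \<open>\<Phi>\<close> only names the weak gradients, which are unique almost everywhere.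
\<close>

definition weak_p_Laplace ::
    "real \<Rightarrow> (real^'n) set \<Rightarrow> (real^'n) L1 \<Rightarrow> (real^'n) L1 \<Rightarrow> (real^'n) L1 \<Rightarrow> bool" where
  "weak_p_Laplace p S \<gamma> f fh \<longleftrightarrow>
     (\<forall>F \<phi> \<Phi>. sobolev_gradient p S (rep_L1 f) F \<and> \<phi> \<in> W1p_Linfty p S \<and> sobolev_gradient p S \<phi> \<Phi> \<longrightarrow>
        (LINT x:S|lborel. rep_L1 \<gamma> x * norm (F x) powr (p - 2) * (F x \<bullet> \<Phi> x)) =
        (LINT x:S|lborel. rep_L1 fh x * \<phi> x))"

definition a_core :: "real \<Rightarrow> (real^'n) set \<Rightarrow> (real^'n) L1 \<Rightarrow> ((real^'n) L1 \<times> (real^'n) L1) set" where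
  "a_core p S \<gamma> = {(f, fh). f \<in> L1_on S \<and> fh \<in> L1_on S \<and>
     rep_L1 f \<in> W1p_Linfty p S \<and> weak_p_Laplace p S \<gamma> f fh}"

definition a_closed :: "real \<Rightarrow> (real^'n) set \<Rightarrow> (real^'n) L1 \<Rightarrow> ((real^'n) L1 \<times> (real^'n) L1) set" where
  "a_closed p S \<gamma> = operator_closure (L1_on S) norm (a_core p S \<gamma>)"

definition A_core ::
    "'w measure \<Rightarrow> real \<Rightarrow> (real^'n) set \<Rightarrow> ('w \<Rightarrow> (real^'n) L1) \<Rightarrow>
     (('w \<Rightarrow> (real^'n) L1) \<times> ('w \<Rightarrow> (real^'n) L1)) set" where
  "A_core P p S g = {(f, fh). f \<in> L1_Omega P S \<and> fh \<in> L1_Omega P S \<and>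
     measure P {\<omega>\<in>space P. rep_L1 (f \<omega>) \<in> W1p_Linfty p S} = 1 \<and>
     (AE \<omega> in P. weak_p_Laplace p S (g \<omega>) (f \<omega>) (fh \<omega>))}"

definition A_closed ::
    "'w measure \<Rightarrow> real \<Rightarrow> (real^'n) set \<Rightarrow> ('w \<Rightarrow> (real^'n) L1) \<Rightarrow>
     (('w \<Rightarrow> (real^'n) L1) \<times> ('w \<Rightarrow> (real^'n) L1)) set" where
  "A_closed P p S g = operator_closure (L1_Omega P S) (L1_Omega_norm P) (A_core P p S g)"

end

theory Submission
  imports Defs
begin

text \<open>
  Both sides of the claimed equality are limits of implicit Euler schemes, and the proof compares the
  schemes. Fix schemes for the random problem whose errors tend to zero. The operator \<open>A_closed\<close> acts
  pointwise: if \<open>(v, w)\<close> belongs to it, then \<open>(v \<omega>, w \<omega>)\<close> belongs to \<open>a_closed p S (g \<omega>)\<close> for almost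
  every \<open>\<omega>\<close> (\<open>A_closed_pointwise\<close>), because convergence in \<open>L\<^sup>1(\<Omega>; L\<^sup>1(S))\<close> implies almost sure
  convergence of a subsequence. Hence almost every \<open>\<omega>\<close> turns each random scheme into a scheme for the
  deterministic problem with coefficient \<open>g \<omega>\<close>. The errors of the schemes are small in expectation,
  so along a subsequence they tend to zero almost surely. For almost every \<open>\<omega>\<close>, therefore, \<open>T t u \<omega>\<close>
  is a limit of values at time \<open>t\<close> of schemes for \<open>a_closed p S (g \<omega>)\<close> that start near \<open>u \<omega>\<close>
  (\<open>random_mild_solution_pointwise\<close>). The deterministic mild solution has the same property, and it
  remains to see that such limits are unique.

  Uniqueness holds for every accretive operator whose domain is dense enough to approximate the
  initial value (\<open>euler_limit_unique\<close>). It rests on Kobayashi's estimate for the distance of two Euler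
  schemes with different partitions (\<open>kobayashi_estimate\<close>). The density follows from the
  existence of mild solutions, which start in the closure of the domain.

  Accretivity of the weighted \<open>p\<close>-Laplace operator in \<open>L\<^sup>1(S)\<close> (\<open>accretive_a_core\<close>) is obtained by
  testing the difference of two equations with \<open>arctan (n (f - h))\<close>, a smooth approximation of a
  multiple of the sign of \<open>f - h\<close>, and by the monotonicity of \<open>x \<mapsto> \<bar>x\<bar>\<^bsup>p-2\<^esup> x\<close>. That this test function
  is admissible is the chain rule for weak gradients (\<open>chain_rule_weak\<close>), proved by mollification; the
  ingredients are a smooth bump function and the continuity of translations in \<open>L\<^sup>1\<close>.

  Finally, the seminorm of \<open>L\<^sup>1(\<Omega>; L\<^sup>1(S))\<close> measures differences of random elements correctly only if
  these differences are measurable, which follows from the separability of \<open>L\<^sup>1\<close>.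
\<close>

section \<open>Accretive operators and implicit Euler schemes\<close>

definition accretive :: "('x::real_normed_vector \<times> 'x) set \<Rightarrow> bool" where
  "accretive A \<longleftrightarrow> (\<forall>(x, x')\<in>A. \<forall>(y, y')\<in>A. \<forall>c>0. norm (x - y) \<le> norm (x - y + c *\<^sub>R (x' - y')))"

lemma accretiveD:
  assumes "accretive A" "(x, x') \<in> A" "(y, y') \<in> A" "c > 0"
  shows "norm (x - y) \<le> norm (x - y + c *\<^sub>R (x' - y'))"
  using assms unfolding accretive_def by blast

text \<open>
  The defining inequality involves only norms of differences of graph points, so it survives limits.
\<close>

lemma accretive_operator_closure:
  assumes A: "accretive A"
  shows "accretive (operator_closure X norm A)"
  unfolding accretive_def
proof (safe)
  fix x x' y y' :: 'a and c :: real
  assume x: "(x, x') \<in> operator_closure X norm A" and y: "(y, y') \<in> operator_closure X norm A" and c: "c > 0"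
  show "norm (x - y) \<le> norm (x - y + c *\<^sub>R (x' - y'))"
  proof (rule field_le_epsilon)
    fix e :: real assume e: "e > 0"
    define d where "d = e / (4 + 2 * c)"
    have d: "d > 0" using e c by (simp add: d_def)
    obtain a a' where a: "(a, a') \<in> A" "norm (x - a) < d" "norm (x' - a') < d"
      using x d unfolding operator_closure_def by auto
    obtain b b' where b: "(b, b') \<in> A" "norm (y - b) < d" "norm (y' - b') < d"
      using y d unfolding operator_closure_def by auto
    have "norm (x - y) \<le> norm (a - b) + norm (x - a) + norm (y - b)"
      by (rule order_trans[OF _ norm_triangle_le_diff[of "a - b + (x - a)" "y - b"]])
         (use norm_triangle_ineq[of "a - b" "x - a"] in \<open>auto simp: algebra_simps\<close>)
    also have "norm (a - b) \<le> norm (a - b + c *\<^sub>R (a' - b'))"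
      by (rule accretiveD[OF A a(1) b(1) c])
    also have "a - b + c *\<^sub>R (a' - b') =
        (x - y + c *\<^sub>R (x' - y')) + ((y - b) - (x - a) + c *\<^sub>R ((y' - b') - (x' - a')))"
      by (simp add: algebra_simps)
    also have "norm \<dots> \<le> norm (x - y + c *\<^sub>R (x' - y')) + (d + d + c * (d + d))"
    proof -
      have "norm ((y - b) - (x - a)) \<le> d + d"
        using norm_triangle_ineq4[of "y - b" "x - a"] a b by linarith
      moreover have "norm (c *\<^sub>R ((y' - b') - (x' - a'))) \<le> c * (d + d)"
        using norm_triangle_ineq4[of "y' - b'" "x' - a'"] a b c
        by (simp add: mult_left_mono)
      ultimately show ?thesis
        by (smt (verit) norm_triangle_ineq)
    qed
    finally have "norm (x - y) \<le> norm (x - y + c *\<^sub>R (x' - y')) + (d * (4 + 2 * c))"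
      using a(2) b(2) by (simp add: algebra_simps)
    then show "norm (x - y) \<le> norm (x - y + c *\<^sub>R (x' - y')) + e"
      using c by (simp add: d_def)
  qed
qed

text \<open>
  The square root in Kobayashi's estimate is compatible with one grid step. The weights are convex, so
  the square of the left hand side is at most the convex combination of the squares. In that
  combination the terms linear in \<open>d\<close> cancel, and what remains in excess of \<open>d\<^sup>2 + q\<close> is
  \<open>h * k * (h + k - (e1 + e2)) / (h + k)\<close>, which is nonpositive because the steps do not exceed the
  mesh bounds.
\<close>

lemma kobayashi_step:
  fixes d h k :: real
  assumes "0 < h" "0 < k" "h \<le> e1" "k \<le> e2" "0 \<le> q - e1 * h" "0 \<le> q - e2 * k"
  shows "h / (h + k) * sqrt ((d + k)\<^sup>2 + (q - e2 * k)) + k / (h + k) * sqrt ((d - h)\<^sup>2 + (q - e1 * h))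
    \<le> sqrt (d\<^sup>2 + q)"
proof -
  define \<alpha> \<beta> a b where "\<alpha> = h / (h + k)" "\<beta> = k / (h + k)"
    "a = sqrt ((d + k)\<^sup>2 + (q - e2 * k))" "b = sqrt ((d - h)\<^sup>2 + (q - e1 * h))"
  have pos: "\<alpha> \<ge> 0" "\<beta> \<ge> 0" and sum: "\<alpha> + \<beta> = 1"
    using assms by (auto simp: \<alpha>_\<beta>_a_b_def add_divide_distrib[symmetric])
  have a2: "a\<^sup>2 = (d + k)\<^sup>2 + (q - e2 * k)" and b2: "b\<^sup>2 = (d - h)\<^sup>2 + (q - e1 * h)"
    using assms by (auto simp: \<alpha>_\<beta>_a_b_def)
  have "(\<alpha> * a + \<beta> * b)\<^sup>2 = (\<alpha> + \<beta>) * (\<alpha> * a\<^sup>2 + \<beta> * b\<^sup>2) - \<alpha> * \<beta> * (a - b)\<^sup>2"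
    by (simp add: power2_eq_square algebra_simps)
  also have "\<dots> \<le> \<alpha> * a\<^sup>2 + \<beta> * b\<^sup>2"
    using pos by (simp add: sum)
  also have "\<dots> = (h * a\<^sup>2 + k * b\<^sup>2) / (h + k)"
    by (simp add: \<alpha>_\<beta>_a_b_def add_divide_distrib)
  also have "\<dots> = ((h + k) * (d\<^sup>2 + q) + h * k * (h + k - (e1 + e2))) / (h + k)"
    unfolding a2 b2 by (simp add: power2_eq_square algebra_simps)
  also have "\<dots> \<le> ((h + k) * (d\<^sup>2 + q)) / (h + k)"
    using assms by (intro divide_right_mono) (auto simp: mult_nonneg_nonpos)
  also have "\<dots> = d\<^sup>2 + q" using assms by simp
  finally have "\<alpha> * a + \<beta> * b \<le> sqrt (d\<^sup>2 + q)"
    by (rule real_le_rsqrt)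
  then show ?thesis by (simp add: \<alpha>_\<beta>_a_b_def)
qed

text \<open>
  The inclusions of \<open>eps_approx_solution\<close>, separated from its smallness conditions: the former can
  be evaluated at a single \<open>\<omega>\<close>, the latter are statements about expectations.
\<close>

definition euler_scheme :: "('x::real_normed_vector \<times> 'x) set \<Rightarrow> nat \<Rightarrow> (nat \<Rightarrow> real) \<Rightarrow> (nat \<Rightarrow> 'x) \<Rightarrow> (nat \<Rightarrow> 'x) \<Rightarrow> bool"
  where "euler_scheme A n s y v \<longleftrightarrow>
    (\<forall>i<n. s i < s (Suc i) \<and> (v (Suc i), y (Suc i) - (1 / (s (Suc i) - s i)) *\<^sub>R (v (Suc i) - v i)) \<in> A)"

definition scheme_error :: "(nat \<Rightarrow> real) \<Rightarrow> (nat \<Rightarrow> 'x::real_normed_vector) \<Rightarrow> nat \<Rightarrow> real" where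
  "scheme_error s y i = (\<Sum>l<i. (s (Suc l) - s l) * norm (y (Suc l)))"

lemma euler_scheme_mono:
  assumes "euler_scheme A n s y v" "i \<le> j" "j \<le> n"
  shows "s i \<le> s j"
  using assms(2,3)
proof (induction j rule: dec_induct)
  case (step l)
  then have "s l < s (Suc l)" using assms(1) by (auto simp: euler_scheme_def)
  with step show ?case by simp
qed simp

lemma scheme_error_mono:
  assumes "euler_scheme A n s y v" "i \<le> j" "j \<le> n"
  shows "scheme_error s y i \<le> scheme_error s y j"
  unfolding scheme_error_def
proof (rule sum_mono2)
  fix l assume "l \<in> {..<j} - {..<i}"
  then have "s l \<le> s (Suc l)" using euler_scheme_mono[OF assms(1), of l "Suc l"] assms by auto
  then show "0 \<le> (s (Suc l) - s l) * norm (y (Suc l))" by simp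
qed (use assms in auto)

text \<open>
  A scheme is compared with a fixed graph point. Accretivity with \<open>c\<close> equal to the step length
  cancels the new value against the difference quotient and leaves the old value.
\<close>

lemma euler_scheme_distance_growth:
  assumes A: "accretive A" and v: "euler_scheme A n s y v" and x: "(x, x') \<in> A" and "i \<le> n"
  shows "norm (v i - x) \<le> norm (v 0 - x) + scheme_error s y i + (s i - s 0) * norm x'"
  using \<open>i \<le> n\<close>
proof (induction i)
  case 0 then show ?case by (simp add: scheme_error_def)
next
  case (Suc i)
  define h where "h = s (Suc i) - s i"
  have h: "h > 0" and vA: "(v (Suc i), y (Suc i) - (1 / h) *\<^sub>R (v (Suc i) - v i)) \<in> A"
    using v Suc.prems by (auto simp: euler_scheme_def h_def)
  have "norm (v (Suc i) - x) \<le> norm (v (Suc i) - x + h *\<^sub>R (y (Suc i) - (1 / h) *\<^sub>R (v (Suc i) - v i) - x'))"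
    by (rule accretiveD[OF A vA x h])
  also have "v (Suc i) - x + h *\<^sub>R (y (Suc i) - (1 / h) *\<^sub>R (v (Suc i) - v i) - x') =
      (v i - x) + h *\<^sub>R (y (Suc i) - x')"
    using h by (simp add: algebra_simps)
  also have "norm \<dots> \<le> norm (v i - x) + h * (norm (y (Suc i)) + norm x')"
    using h norm_triangle_ineq4[of "y (Suc i)" x']
    by (intro order_trans[OF norm_triangle_ineq]) (auto simp: mult_left_mono)
  finally show ?case
    using Suc by (simp add: scheme_error_def h_def algebra_simps)
qed

text \<open>
  The constant \<open>c = h * k / (h + k)\<close> in the accretivity inequality is the one for which the new values
  recombine with the two difference quotients into a convex combination of the mixed differences.
\<close>

lemma euler_schemes_one_step:
  assumes A: "accretive A" and hk: "0 < h" "0 < k"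
    and v: "(v1, y - (1 / h) *\<^sub>R (v1 - v0)) \<in> A" and w: "(w1, z - (1 / k) *\<^sub>R (w1 - w0)) \<in> A"
  shows "norm (v1 - w1) \<le> h / (h + k) * norm (v1 - w0) + k / (h + k) * norm (v0 - w1)
     + h * k / (h + k) * (norm y + norm z)"
proof -
  define \<alpha> \<beta> \<mu> where "\<alpha> = h / (h + k)" "\<beta> = k / (h + k)" "\<mu> = h * k / (h + k)"
  have \<mu>: "\<mu> > 0" "\<mu> * (1 / h) = \<beta>" "\<mu> * (1 / k) = \<alpha>" and \<alpha>: "\<alpha> = 1 - \<beta>" "\<alpha> \<ge> 0" "\<beta> \<ge> 0"
    using hk by (auto simp: \<alpha>_\<beta>_\<mu>_def field_simps)
  have "norm (v1 - w1) \<le> norm (v1 - w1 + \<mu> *\<^sub>R ((y - (1 / h) *\<^sub>R (v1 - v0)) - (z - (1 / k) *\<^sub>R (w1 - w0))))"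
    by (rule accretiveD[OF A v w \<mu>(1)])
  also have "v1 - w1 + \<mu> *\<^sub>R ((y - (1 / h) *\<^sub>R (v1 - v0)) - (z - (1 / k) *\<^sub>R (w1 - w0))) =
      (v1 - w1) + \<mu> *\<^sub>R (y - z) - (\<mu> * (1 / h)) *\<^sub>R (v1 - v0) + (\<mu> * (1 / k)) *\<^sub>R (w1 - w0)"
    by (simp add: scaleR_diff_right)
  also have "\<dots> = \<alpha> *\<^sub>R (v1 - w0) + \<beta> *\<^sub>R (v0 - w1) + \<mu> *\<^sub>R (y - z)"
    unfolding \<mu> \<alpha>(1) by (simp add: algebra_simps)
  also have "norm \<dots> \<le> \<alpha> * norm (v1 - w0) + \<beta> * norm (v0 - w1) + \<mu> * (norm y + norm z)"
    using \<mu>(1) \<alpha> norm_triangle_ineq4[of y z]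
    by (intro order_trans[OF norm_triangle_ineq] add_mono) (auto simp: mult_left_mono)
  finally show ?thesis by (simp add: \<alpha>_\<beta>_\<mu>_def)
qed

text \<open>
  Induction over the grid of index pairs. The one-step inequality bounds the value at \<open>(i, j)\<close> by the
  values at \<open>(i, j - 1)\<close> and \<open>(i - 1, j)\<close>, and the right hand side satisfies the reverse inequality:
  the error sums by direct computation, the square root by \<open>kobayashi_step\<close>. On the two boundary
  lines the square root is at least the elapsed time, so the distance to the graph point \<open>(x, x')\<close>
  controls the difference there. The point \<open>x\<close> is a parameter so that it can approach initial values
  outside the domain of the operator.
\<close>

lemma kobayashi_estimate:
  assumes A: "accretive A" and v: "euler_scheme A n s y v" and w: "euler_scheme A m r z w"
    and e1: "\<And>i. i < n \<Longrightarrow> s (Suc i) - s i \<le> e1" and e2: "\<And>i. i < m \<Longrightarrow> r (Suc i) - r i \<le> e2"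
    and e: "0 \<le> e1" "0 \<le> e2"
    and x: "(x, x') \<in> A"
    and "i \<le> n" "j \<le> m"
  shows "norm (v i - w j) \<le> norm (v 0 - x) + norm (w 0 - x) + scheme_error s y i + scheme_error r z j
    + sqrt ((s i - s 0 - (r j - r 0))\<^sup>2 + (e1 * (s i - s 0) + e2 * (r j - r 0))) * norm x'"
  (is "_ \<le> ?C + _ + _ + ?D i j * _")
  using \<open>i \<le> n\<close> \<open>j \<le> m\<close>
proof (induction "i + j" arbitrary: i j rule: less_induct)
  case less
  have s0: "s 0 \<le> s i" if "i \<le> n" for i using euler_scheme_mono[OF v _ that, of 0] by simp
  have r0: "r 0 \<le> r i" if "i \<le> m" for i using euler_scheme_mono[OF w _ that, of 0] by simp
  have err: "0 \<le> scheme_error s y i" "0 \<le> scheme_error r z j"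
    using scheme_error_mono[OF v, of 0 i] scheme_error_mono[OF w, of 0 j] less.prems
    by (simp_all add: scheme_error_def)
  have D1: "s i - s 0 \<le> ?D i 0" and D2: "r j - r 0 \<le> ?D 0 j"
    using s0[of i] r0[of j] less.prems e by (auto intro!: real_le_rsqrt simp: power2_commute[of "r 0" "r j"])
  consider "j = 0" | "i = 0" | i' j' where "i = Suc i'" "j = Suc j'"
    by (cases i; cases j) auto
  then show ?case
  proof cases
    case 1
    have "norm (v i - w 0) \<le> norm (v i - x) + norm (w 0 - x)"
      using norm_triangle_ineq4[of "v i - x" "w 0 - x"] by simp
    also have "norm (v i - x) \<le> norm (v 0 - x) + scheme_error s y i + (s i - s 0) * norm x'"
      by (rule euler_scheme_distance_growth[OF A v x]) (use less in auto)
    also have "(s i - s 0) * norm x' \<le> ?D i 0 * norm x'"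
      by (intro mult_right_mono D1) auto
    finally show ?thesis using 1 err by (simp add: scheme_error_def)
  next
    case 2
    have "norm (v 0 - w j) \<le> norm (w j - x) + norm (v 0 - x)"
      using norm_triangle_ineq4[of "v 0 - x" "w j - x"] by simp
    also have "norm (w j - x) \<le> norm (w 0 - x) + scheme_error r z j + (r j - r 0) * norm x'"
      by (rule euler_scheme_distance_growth[OF A w x]) (use less in auto)
    also have "(r j - r 0) * norm x' \<le> ?D 0 j * norm x'"
      by (intro mult_right_mono D2) auto
    finally show ?thesis using 2 err by (simp add: scheme_error_def)
  next
    case (3 a b)
    define h k where "h = s i - s a" "k = r j - r b"
    have h: "0 < h" "h \<le> e1" and k: "0 < k" "k \<le> e2"
      using v w e1[of a] e2[of b] less.prems 3 by (auto simp: euler_scheme_def h_k_def)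
    have vA: "(v i, y i - (1 / h) *\<^sub>R (v i - v a)) \<in> A"
      using v less.prems 3 by (auto simp: euler_scheme_def h_k_def)
    have wA: "(w j, z j - (1 / k) *\<^sub>R (w j - w b)) \<in> A"
      using w less.prems 3 by (auto simp: euler_scheme_def h_k_def)
    define E where "E = ?C + scheme_error s y i + scheme_error r z j"
    define d q where "d = s i - s 0 - (r j - r 0)" "q = e1 * (s i - s 0) + e2 * (r j - r 0)"
    define \<alpha> \<beta> where "\<alpha> = h / (h + k)" "\<beta> = k / (h + k)"
    have \<alpha>: "\<alpha> = 1 - \<beta>" "\<alpha> \<ge> 0" "\<beta> \<ge> 0"
      using h k by (auto simp: \<alpha>_\<beta>_def field_simps)
    have E1: "norm (v i - w b) \<le> E - k * norm (z j) + sqrt ((d + k)\<^sup>2 + (q - e2 * k)) * norm x'"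
      using less.hyps[of i b] less.prems 3 
      by (simp add: E_def d_q_def h_k_def scheme_error_def algebra_simps)
    have E2: "norm (v a - w j) \<le> E - h * norm (y i) + sqrt ((d - h)\<^sup>2 + (q - e1 * h)) * norm x'"
      using less.hyps[of a j] less.prems 3 
      by (simp add: E_def d_q_def h_k_def scheme_error_def algebra_simps)
    have "norm (v i - w j) \<le> \<alpha> * norm (v i - w b) + \<beta> * norm (v a - w j) + h * k / (h + k) * (norm (y i) + norm (z j))"
      using euler_schemes_one_step[OF A h(1) k(1) vA wA] by (simp add: \<alpha>_\<beta>_def)
    also have "\<dots> \<le> \<alpha> * (E - k * norm (z j) + sqrt ((d + k)\<^sup>2 + (q - e2 * k)) * norm x')
      + \<beta> * (E - h * norm (y i) + sqrt ((d - h)\<^sup>2 + (q - e1 * h)) * norm x') + h * k / (h + k) * (norm (y i) + norm (z j))"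
      by (intro add_mono mult_left_mono E1 E2 \<alpha> order_refl)
    also have "\<dots> = (\<alpha> + \<beta>) * E + (\<alpha> * sqrt ((d + k)\<^sup>2 + (q - e2 * k)) + \<beta> * sqrt ((d - h)\<^sup>2 + (q - e1 * h))) * norm x'
       + (h * k / (h + k) - \<beta> * h) * norm (y i) + (h * k / (h + k) - \<alpha> * k) * norm (z j)"
      by (simp add: algebra_simps add_divide_distrib)
    also have "\<dots> = E + (\<alpha> * sqrt ((d + k)\<^sup>2 + (q - e2 * k)) + \<beta> * sqrt ((d - h)\<^sup>2 + (q - e1 * h))) * norm x'"
    proof -
      have "h * k / (h + k) = \<beta> * h" "h * k / (h + k) = \<alpha> * k" by (simp_all add: \<alpha>_\<beta>_def)
      moreover have "\<alpha> + \<beta> = 1" using \<alpha>(1) by simp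
      ultimately show ?thesis by simp
    qed
    also have "\<dots> \<le> E + sqrt (d\<^sup>2 + q) * norm x'"
    proof -
      have "e1 * h \<le> e1 * (s i - s 0)" "e2 * k \<le> e2 * (r j - r 0)"
        "0 \<le> e1 * (s i - s 0)" "0 \<le> e2 * (r j - r 0)"
        using e s0[of a] r0[of b] s0[of i] r0[of j] less.prems 3 by (auto simp: h_k_def intro!: mult_left_mono)
      then have "0 \<le> q - e1 * h" "0 \<le> q - e2 * k"
        by (auto simp: d_q_def)
      from kobayashi_step[OF h(1) k(1) h(2) k(2) this, of d] show ?thesis
        by (simp add: \<alpha>_\<beta>_def mult_right_mono)
    qed
    finally show ?thesis by (simp add: E_def d_q_def)
  qed
qed

text \<open>
  A solution-free description of the value at time \<open>t\<close> of a mild solution: \<open>z\<close> is a limit of the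
  values at \<open>t\<close> of Euler schemes that start near \<open>v\<close>. For the random problem only this
  information is available at a fixed \<open>\<omega>\<close>, since the exceptional null sets may depend on \<open>t\<close>.
\<close>

definition euler_limit :: "('x::real_normed_vector \<times> 'x) set \<Rightarrow> real \<Rightarrow> 'x \<Rightarrow> 'x \<Rightarrow> bool" where
  "euler_limit A t v z \<longleftrightarrow> (\<forall>\<epsilon>>0. \<exists>n s y w i. euler_scheme A n s y w \<and>
     0 \<le> s 0 \<and> s 0 \<le> \<epsilon> \<and> (\<forall>l<n. s (Suc l) - s l \<le> \<epsilon>) \<and> i < n \<and> s i < t \<and> t \<le> s (Suc i) \<and>
     norm (w 0 - v) \<le> \<epsilon> \<and> scheme_error s y n \<le> \<epsilon> \<and> norm (z - w (Suc i)) \<le> \<epsilon>)"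

text \<open>
  When the mesh tends to zero, Kobayashi's estimate for two schemes leaves only twice the distance of
  \<open>v\<close> to the chosen point \<open>x\<close> of the domain.
\<close>

lemma euler_limit_unique:
  fixes A :: "('x::real_normed_vector \<times> 'x) set"
  assumes A: "accretive A" and v: "v \<in> closure (fst ` A)" and t: "t > 0"
    and z1: "euler_limit A t v z1" and z2: "euler_limit A t v z2"
  shows "z1 = z2"
proof -
  have bound: "norm (z1 - z2) \<le> 2 * norm (v - x)" if x: "(x, x') \<in> A" for x x'
  proof -
    define B where "B \<epsilon> = 6 * \<epsilon> + 2 * norm (v - x) + sqrt ((2 * \<epsilon>)\<^sup>2 + (\<epsilon> * (t + \<epsilon>) + \<epsilon> * (t + \<epsilon>))) * norm x'" for \<epsilon>
    have le: "norm (z1 - z2) \<le> B \<epsilon>" if e: "\<epsilon> > 0" for \<epsilon>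
    proof -
      obtain n s y w i where 1: "euler_scheme A n s y w" "0 \<le> s 0" "s 0 \<le> \<epsilon>"
        "\<And>l. l < n \<Longrightarrow> s (Suc l) - s l \<le> \<epsilon>" "i < n" "s i < t" "t \<le> s (Suc i)"
        "norm (w 0 - v) \<le> \<epsilon>" "scheme_error s y n \<le> \<epsilon>" "norm (z1 - w (Suc i)) \<le> \<epsilon>"
        using z1 e unfolding euler_limit_def by meson
      obtain m r f q j where 2: "euler_scheme A m r f q" "0 \<le> r 0" "r 0 \<le> \<epsilon>"
        "\<And>l. l < m \<Longrightarrow> r (Suc l) - r l \<le> \<epsilon>" "j < m" "r j < t" "t \<le> r (Suc j)"
        "norm (q 0 - v) \<le> \<epsilon>" "scheme_error r f m \<le> \<epsilon>" "norm (z2 - q (Suc j)) \<le> \<epsilon>"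
        using z2 e unfolding euler_limit_def by meson
      let ?\<sigma> = "s (Suc i) - s 0" and ?\<rho> = "r (Suc j) - r 0"
      have \<sigma>: "0 \<le> ?\<sigma>" "?\<sigma> \<le> t + \<epsilon>" "t - \<epsilon> \<le> ?\<sigma>"
        using 1(2,3,6,7) 1(4)[OF 1(5)] euler_scheme_mono[OF 1(1), of 0 "Suc i"] 1(5) by auto
      have \<rho>: "0 \<le> ?\<rho>" "?\<rho> \<le> t + \<epsilon>" "t - \<epsilon> \<le> ?\<rho>"
        using 2(2,3,6,7) 2(4)[OF 2(5)] euler_scheme_mono[OF 2(1), of 0 "Suc j"] 2(5) by auto
      have "(?\<sigma> - ?\<rho>)\<^sup>2 \<le> (2 * \<epsilon>)\<^sup>2"
        by (rule power2_le_iff_abs_le[THEN iffD2]) (use \<sigma> \<rho> e in auto)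
      then have sq: "sqrt ((?\<sigma> - ?\<rho>)\<^sup>2 + (\<epsilon> * ?\<sigma> + \<epsilon> * ?\<rho>)) \<le> sqrt ((2 * \<epsilon>)\<^sup>2 + (\<epsilon> * (t + \<epsilon>) + \<epsilon> * (t + \<epsilon>)))"
        using \<sigma> \<rho> e by (intro real_sqrt_le_mono add_mono mult_left_mono) auto
      have "norm (w (Suc i) - q (Suc j)) \<le> norm (w 0 - x) + norm (q 0 - x)
          + scheme_error s y (Suc i) + scheme_error r f (Suc j)
          + sqrt ((?\<sigma> - ?\<rho>)\<^sup>2 + (\<epsilon> * ?\<sigma> + \<epsilon> * ?\<rho>)) * norm x'"
        by (rule kobayashi_estimate[OF A 1(1) 2(1) 1(4) 2(4) _ _ x]) (use e 1 2 in auto)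
      also have "\<dots> \<le> norm (w 0 - x) + norm (q 0 - x) + \<epsilon> + \<epsilon>
          + sqrt ((2 * \<epsilon>)\<^sup>2 + (\<epsilon> * (t + \<epsilon>) + \<epsilon> * (t + \<epsilon>))) * norm x'"
        using scheme_error_mono[OF 1(1), of "Suc i" n] scheme_error_mono[OF 2(1), of "Suc j" m]
          1(5,9) 2(5,9) sq
        by (intro add_mono mult_right_mono) auto
      also have "norm (w 0 - x) \<le> \<epsilon> + norm (v - x)"
        using norm_triangle_ineq[of "w 0 - v" "v - x"] 1(8) by simp
      also have "norm (q 0 - x) \<le> \<epsilon> + norm (v - x)"
        using norm_triangle_ineq[of "q 0 - v" "v - x"] 2(8) by simp
      finally have "norm (w (Suc i) - q (Suc j)) \<le> B \<epsilon> - 2 * \<epsilon>" by (simp add: B_def)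
      moreover have "norm (z1 - z2) \<le> norm (z1 - w (Suc i)) + norm (w (Suc i) - q (Suc j)) + norm (z2 - q (Suc j))"
        by (metis dist_norm dist_triangle_le dist_commute dist_triangle add_mono order_refl)
      ultimately show ?thesis using 1(10) 2(10) by simp
    qed
    have "(B \<longlongrightarrow> B 0) (at_right 0)"
      unfolding B_def by (intro tendsto_intros)
    then have "norm (z1 - z2) \<le> B 0"
      by (rule tendsto_lowerbound) (auto simp: eventually_at_right_less le eventually_at_right_field intro!: exI[of _ 1])
    then show ?thesis by (simp add: B_def)
  qed
  have "norm (z1 - z2) \<le> 0 + e" if "e > 0" for e
  proof -
    obtain x where "x \<in> fst ` A" "dist x v < e / 2"
      using v \<open>e > 0\<close> by (meson closure_approachable half_gt_zero)
    then show ?thesis using bound[of x] by (force simp: dist_norm norm_minus_commute)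
  qed
  then have "norm (z1 - z2) \<le> 0" by (rule field_le_epsilon)
  then show ?thesis by simp
qed

lemma partition_interval_exists:
  fixes s :: "nat \<Rightarrow> real"
  assumes "s 0 < t" "t \<le> s n"
  shows "\<exists>i<n. s i < t \<and> t \<le> s (Suc i)"
  using assms
proof (induction n)
  case (Suc n)
  then show ?case by (cases "t \<le> s n") (auto intro: less_SucI)
qed simp

text \<open>
  The schemes in the definition of a mild solution start near the value at \<open>s 0\<close> instead of near the
  initial value; continuity at zero bridges the gap.
\<close>

lemma mild_solution_euler_limit:
  fixes A :: "('x::real_normed_vector \<times> 'x) set"
  assumes V: "mild_solution X norm A v V" and t: "t > 0"
  shows "euler_limit A t v (V t)"
  unfolding euler_limit_def
proof (intro allI impI)
  fix \<epsilon> :: real assume e: "\<epsilon> > 0"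
  have "((\<lambda>r. norm (V r - V 0)) \<longlongrightarrow> 0) (at 0 within {0..})" and V0: "V 0 = v"
    using V unfolding mild_solution_def by auto
  then have "eventually (\<lambda>r. norm (V r - V 0) < \<epsilon> / 2) (at 0 within {0..})"
    using e by (intro order_tendstoD(2)[of _ 0]) auto
  then obtain d where d: "d > 0" "\<And>r. 0 < r \<Longrightarrow> r < d \<Longrightarrow> norm (V r - V 0) < \<epsilon> / 2"
    unfolding eventually_at by auto
  have d: "norm (V r - V 0) \<le> \<epsilon> / 2" if "0 \<le> r" "r < d" for r
    using d(2)[of r] that e by (cases "r = 0") auto
  define \<eta> where "\<eta> = min (min (\<epsilon> / 2) (t / 2)) (d / 2)"
  have \<eta>: "\<eta> > 0" "\<eta> \<le> \<epsilon> / 2" "\<eta> \<le> t / 2" "\<eta> < d" using e t \<open>d > 0\<close> by (auto simp: \<eta>_def)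
  \<comment> \<open>The horizon \<open>2 * t\<close> ensures that \<open>t\<close> lies in an interval of the partition.\<close>
  from V t \<eta>(1) obtain n s y w where
    1: "eps_approx_solution X norm A (2 * t) \<eta> n s y w" "norm (V (s 0) - w 0) \<le> \<eta>"
       "\<And>i t. i < n \<Longrightarrow> s i < t \<Longrightarrow> t \<le> s (Suc i) \<Longrightarrow> norm (V t - w (Suc i)) \<le> \<eta>"
    unfolding mild_solution_def
    by (metis mult_pos_pos zero_less_numeral)
  then have 2: "0 \<le> s 0" "s 0 \<le> \<eta>" "2 * t - s n \<le> \<eta>" "\<forall>i<n. s i < s (Suc i) \<and> s (Suc i) - s i \<le> \<eta>"
     "scheme_error s y n \<le> \<eta>" "euler_scheme A n s y w"
    unfolding eps_approx_solution_def scheme_error_def euler_scheme_def by auto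
  have "s 0 < t" "t \<le> s n" using 2 \<eta> t by linarith+
  from partition_interval_exists[of s, OF this] obtain i where i: "i < n" "s i < t" "t \<le> s (Suc i)" by blast
  have "norm (w 0 - v) \<le> norm (V (s 0) - w 0) + norm (V (s 0) - V 0)"
    using norm_triangle_ineq4[of "V (s 0) - V 0" "V (s 0) - w 0"] by (simp add: V0)
  also have "\<dots> \<le> \<epsilon>" using 1(2) d[of "s 0"] 2 \<eta> by linarith
  finally have "norm (w 0 - v) \<le> \<epsilon>" .
  moreover have "norm (V t - w (Suc i)) \<le> \<epsilon>" using 1(3)[OF i] \<eta> e by linarith
  moreover have "\<forall>l<n. s (Suc l) - s l \<le> \<epsilon>" using 2(4) \<eta> e by fastforce
  ultimately show "\<exists>n s y w i. euler_scheme A n s y w \<and>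
     0 \<le> s 0 \<and> s 0 \<le> \<epsilon> \<and> (\<forall>l<n. s (Suc l) - s l \<le> \<epsilon>) \<and> i < n \<and> s i < t \<and> t \<le> s (Suc i) \<and>
     norm (w 0 - v) \<le> \<epsilon> \<and> scheme_error s y n \<le> \<epsilon> \<and> norm (V t - w (Suc i)) \<le> \<epsilon>"
    using 2 i \<eta> e by (intro exI[of _ n] exI[of _ s] exI[of _ y] exI[of _ w] exI[of _ i]) auto
qed

text \<open>
  All values of an Euler scheme after the first lie in the domain of the operator. So every value at a
  positive time is a limit of points of the domain, and by continuity at zero so is the initial value.
  Thus the density required for uniqueness follows from the existence of a mild solution.
\<close>

lemma mild_solution_initial_in_closure:
  fixes A :: "('x::real_normed_vector \<times> 'x) set"
  assumes V: "mild_solution X norm A v V"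
  shows "v \<in> closure (fst ` A)"
  unfolding closure_approachable
proof (intro allI impI)
  fix e :: real assume e: "e > 0"
  have "((\<lambda>r. norm (V r - V 0)) \<longlongrightarrow> 0) (at 0 within {0..})" and V0: "V 0 = v"
    using V unfolding mild_solution_def by auto
  then have "eventually (\<lambda>r. norm (V r - V 0) < e / 2) (at 0 within {0..})"
    using e by (intro order_tendstoD(2)[of _ 0]) auto
  then obtain d where d: "d > 0" "\<And>r. 0 < r \<Longrightarrow> r < d \<Longrightarrow> norm (V r - V 0) < e / 2"
    unfolding eventually_at by auto
  have "euler_limit A (d / 2) v (V (d / 2))"
    by (rule mild_solution_euler_limit[OF V]) (use d in auto)
  then obtain n s y w i where "euler_scheme A n s y w" "i < n" "norm (V (d / 2) - w (Suc i)) \<le> e / 2"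
    unfolding euler_limit_def using e by (metis half_gt_zero)
  then have "w (Suc i) \<in> fst ` A" "norm (V (d / 2) - w (Suc i)) \<le> e / 2"
    by (force simp: euler_scheme_def)+
  moreover have "norm (w (Suc i) - v) \<le> norm (V (d / 2) - V 0) + norm (V (d / 2) - w (Suc i))"
    using norm_triangle_ineq4[of "V (d / 2) - V 0" "V (d / 2) - w (Suc i)"] by (simp add: V0)
  ultimately show "\<exists>y\<in>fst ` A. dist y v < e"
    using d(2)[of "d / 2"] d(1) by (force simp: dist_norm)
qed

section \<open>Density and translations in \<open>L\<^sup>1\<close>\<close>

lemma lborel_distr_translation: "distr lborel borel (\<lambda>x::'a::euclidean_space. z + x) = lborel"
  using lborel_affine[of 1 z] by (simp add: density_1)

lemma lborel_distr_reflection: "distr lborel borel (\<lambda>x::'a::euclidean_space. z - x) = lborel"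
  using lborel_affine[of "-1" z] by (simp add: density_1)

lemma
  fixes f :: "'a::euclidean_space \<Rightarrow> real"
  assumes f: "integrable lborel f"
  shows integrable_translation: "integrable lborel (\<lambda>x. f (z + x))"
    and integral_translation: "(LINT x|lborel. f (z + x)) = (LINT x|lborel. f x)"
proof -
  have [measurable]: "f \<in> borel_measurable borel" using borel_measurable_integrable[OF f] by simp
  have "integrable (distr lborel borel (\<lambda>x. z + x)) f" using f by (simp add: lborel_distr_translation)
  then show "integrable lborel (\<lambda>x. f (z + x))" by (subst (asm) integrable_distr_eq) auto
  have "(LINT x|lborel. f x) = (LINT x|distr lborel borel (\<lambda>x. z + x). f x)" by (simp add: lborel_distr_translation)
  also have "\<dots> = (LINT x|lborel. f (z + x))" by (subst integral_distr) auto
  finally show "(LINT x|lborel. f (z + x)) = (LINT x|lborel. f x)" by simp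
qed

lemma
  fixes f :: "'a::euclidean_space \<Rightarrow> real"
  assumes f: "integrable lborel f"
  shows integrable_reflection: "integrable lborel (\<lambda>x. f (z - x))"
    and integral_reflection: "(LINT x|lborel. f (z - x)) = (LINT x|lborel. f x)"
proof -
  have [measurable]: "f \<in> borel_measurable borel" using borel_measurable_integrable[OF f] by simp
  have "integrable (distr lborel borel (\<lambda>x. z - x)) f" using f by (simp add: lborel_distr_reflection)
  then show "integrable lborel (\<lambda>x. f (z - x))" by (subst (asm) integrable_distr_eq) auto
  have "(LINT x|lborel. f x) = (LINT x|distr lborel borel (\<lambda>x. z - x). f x)" by (simp add: lborel_distr_reflection)
  also have "\<dots> = (LINT x|lborel. f (z - x))" by (subst integral_distr) auto
  finally show "(LINT x|lborel. f (z - x)) = (LINT x|lborel. f x)" by simp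
qed

lemma nn_integral_lborel_reflection:
  fixes f :: "'a::euclidean_space \<Rightarrow> ennreal"
  assumes [measurable]: "f \<in> borel_measurable borel"
  shows "(\<integral>\<^sup>+x. f (z - x) \<partial>lborel) = (\<integral>\<^sup>+x. f x \<partial>lborel)"
  by (subst (2) lborel_distr_reflection[of z, symmetric]) (simp add: nn_integral_distr)

lemma L1_tendsto_dominated:
  fixes f w :: "'b \<Rightarrow> real"
  assumes [measurable]: "f \<in> borel_measurable M" "\<And>i. s i \<in> borel_measurable M" and w: "integrable M w"
    and lim: "\<And>x. x \<in> space M \<Longrightarrow> (\<lambda>i. s i x) \<longlonglongrightarrow> f x" and le: "\<And>i x. x \<in> space M \<Longrightarrow> \<bar>s i x\<bar> \<le> w x"
  shows "(\<lambda>i::nat. LINT x|M. \<bar>s i x - f x\<bar>) \<longlonglongrightarrow> 0"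
proof -
  have lef: "\<bar>f x\<bar> \<le> w x" if "x \<in> space M" for x
    by (rule tendsto_upperbound[OF tendsto_rabs[OF lim[OF that]]]) (auto simp: le that)
  have "(\<lambda>i. LINT x|M. \<bar>s i x - f x\<bar>) \<longlonglongrightarrow> (LINT x|M. 0)"
  proof (rule integral_dominated_convergence)
    show "integrable M (\<lambda>x. w x + w x)" using w by simp
    show "AE x in M. (\<lambda>i. \<bar>s i x - f x\<bar>) \<longlonglongrightarrow> 0"
      using lim by (intro AE_I2 tendsto_rabs_zero) (auto simp: LIM_zero_iff)
    show "AE x in M. norm \<bar>s i x - f x\<bar> \<le> w x + w x" for i
    proof (rule AE_I2)
      fix x assume "x \<in> space M"
      then show "norm \<bar>s i x - f x\<bar> \<le> w x + w x"
        using le[of x i] lef[of x] by simp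
    qed
  qed auto
  then show ?thesis by simp
qed

text \<open>
  Dynkin's lemma yields the indicators of Borel subsets of a ball: the measure of a ball is finite, so
  complements inside the ball are differences of integrable indicators and countable disjoint unions
  are limits in \<open>L\<^sup>1\<close>. Letting the ball grow gives sets of finite measure, and simple functions give
  the rest. The generator is a parameter because a countable one leads to separability, whereas the
  family of all open sets suits the continuity of translations.
\<close>

lemma integrable_lborel_induct [consumes 4, case_names generator add scale lim]:
  fixes f :: "'a::euclidean_space \<Rightarrow> real"
  assumes f: "integrable lborel f"
    and \<G>: "Int_stable \<G>" "sets borel = sigma_sets UNIV \<G>" "UNIV \<in> \<G>"
    and gen: "\<And>A N. A \<in> \<G> \<Longrightarrow> Q (indicat_real (A \<inter> ball 0 (real N)))"
    and add: "\<And>f h. integrable lborel f \<Longrightarrow> integrable lborel h \<Longrightarrow> Q f \<Longrightarrow> Q h \<Longrightarrow> Q (\<lambda>x. f x + h x)"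
    and scale: "\<And>f c. integrable lborel f \<Longrightarrow> Q f \<Longrightarrow> Q (\<lambda>x. c * f x)"
    and lim: "\<And>f s. integrable lborel f \<Longrightarrow> (\<And>i. integrable lborel (s i)) \<Longrightarrow> (\<And>i. Q (s i)) \<Longrightarrow>
      (\<lambda>i::nat. LINT x|lborel. \<bar>s i x - f x\<bar>) \<longlonglongrightarrow> 0 \<Longrightarrow> Q f"
  shows "Q f"
proof -
  have Q_bounded: "Q (indicat_real (A \<inter> ball 0 (real N)))" if "A \<in> sets borel" for A N
  proof -
    define B where "B = ball (0::'a) (real N)"
    have [measurable]: "B \<in> sets borel" by (simp add: B_def)
    have int: "integrable lborel (indicat_real (X \<inter> B))" if "X \<in> sets borel" for X
      using that emeasure_bounded_finite[of B] emeasure_mono[of "X \<inter> B" B lborel]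
      by (auto simp: B_def)
    have sub: "\<G> \<subseteq> Pow UNIV" by simp
    have A: "A \<in> sigma_sets UNIV \<G>" using that \<G> by simp
    have "Q (indicat_real (A \<inter> B))"
      using \<G>(1) sub A
    proof (induction rule: sigma_sets_induct_disjoint)
      case (basic A) then show ?case using gen by (simp add: B_def)
    next
      case empty show ?case using gen[OF \<G>(3), of 0] by (simp only: ball_empty of_nat_0 Int_empty_right Int_empty_left order_refl)
    next
      case (compl A)
      then have [measurable]: "A \<in> sets borel" using \<G> by simp
      have "Q (\<lambda>x. indicat_real (UNIV \<inter> B) x + (-1) * indicat_real (A \<inter> B) x)"
        using gen[OF \<G>(3), of N] compl int[of UNIV] int[of A] by (intro add scale) (auto simp: B_def)
      also have "(\<lambda>x. indicat_real (UNIV \<inter> B) x + (-1) * indicat_real (A \<inter> B) x) = indicat_real ((UNIV - A) \<inter> B)"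
        by (auto simp: indicator_def)
      finally show ?case .
    next
      case (union A)
      then have A[measurable]: "\<And>i. A i \<in> sets borel" using \<G> by auto
      have Qn: "Q (indicat_real ((\<Union>i<n. A i) \<inter> B))" for n
      proof (induction n)
        case 0 show ?case using gen[OF \<G>(3), of 0] by (simp only: ball_empty of_nat_0 Int_empty_right Int_empty_left order_refl lessThan_0 UN_empty)
      next
        case (Suc n)
        have "Q (\<lambda>x. indicat_real ((\<Union>i<n. A i) \<inter> B) x + indicat_real (A n \<inter> B) x)"
          using Suc union int by (intro add) auto
        also have "(\<lambda>x. indicat_real ((\<Union>i<n. A i) \<inter> B) x + indicat_real (A n \<inter> B) x) = indicat_real ((\<Union>i<Suc n. A i) \<inter> B)"
        proof -
          have "A i \<inter> A n = {}" if "i < n" for i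
            using union(1) that unfolding disjoint_family_on_def by simp
          then have "(\<Union>i<n. A i) \<inter> A n = {}" by blast
          then show ?thesis by (intro ext) (auto simp: indicator_def lessThan_Suc)
        qed
        finally show ?case .
      qed
      show ?case
      proof (rule lim[OF int int Qn])
        show "(\<lambda>n. LINT x|lborel. \<bar>indicat_real ((\<Union>i<n. A i) \<inter> B) x - indicat_real (\<Union> (range A) \<inter> B) x\<bar>) \<longlonglongrightarrow> 0"
        proof (rule L1_tendsto_dominated[where w="indicat_real (UNIV \<inter> B)"])
          show "integrable lborel (indicat_real (UNIV \<inter> B))" by (rule int) simp
          show "(\<lambda>n. indicat_real ((\<Union>i<n. A i) \<inter> B) x) \<longlonglongrightarrow> indicat_real (\<Union> (range A) \<inter> B) x" for x
            unfolding indicator_inter_arith by (intro tendsto_mult LIMSEQ_indicator_UN tendsto_const)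
        qed (auto simp: indicator_def)
      qed auto
    qed
    then show ?thesis by (simp add: B_def)
  qed
  have Q_finite: "Q (indicat_real A)" if A: "A \<in> sets borel" "emeasure lborel A < \<infinity>" for A
  proof (rule lim)
    have [measurable]: "A \<inter> ball 0 (real N) \<in> sets borel" for N using A by simp
    show "Q (indicat_real (A \<inter> ball 0 (real N)))" for N by (rule Q_bounded[OF A(1)])
    have int: "integrable lborel (indicat_real A)" using A by simp
    then show "integrable lborel (indicat_real A)" .
    show "integrable lborel (indicat_real (A \<inter> ball 0 (real N)))" for N
      by (rule Bochner_Integration.integrable_bound[OF int]) (use A in \<open>auto simp: indicator_def\<close>)
    show "(\<lambda>N. LINT x|lborel. \<bar>indicat_real (A \<inter> ball 0 (real N)) x - indicat_real A x\<bar>) \<longlonglongrightarrow> 0"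
    proof (rule L1_tendsto_dominated[OF _ _ int])
      fix x :: 'a
      obtain N0 :: nat where "norm x < real N0" using reals_Archimedean2 by blast
      then have "eventually (\<lambda>N. indicat_real (A \<inter> ball 0 (real N)) x = indicat_real A x) sequentially"
        by (intro eventually_sequentiallyI[of N0]) (auto simp: indicator_def)
      then show "(\<lambda>N. indicat_real (A \<inter> ball 0 (real N)) x) \<longlonglongrightarrow> indicat_real A x"
        by (rule tendsto_eventually)
    qed (use A in \<open>auto simp: indicator_def\<close>)
  qed
  from f show ?thesis
  proof (induction rule: integrable_induct)
    case (base A c)
    have "Q (\<lambda>x. c * indicat_real A x)" by (rule scale) (use base Q_finite in auto)
    then show ?case by (simp add: mult.commute)
  next
    case (add f g) then show ?case by (intro assms(6))
  next
    case (lim f s)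
    have "(\<lambda>i. LINT x|lborel. \<bar>s i x - f x\<bar>) \<longlonglongrightarrow> 0"
      by (rule L1_tendsto_dominated[where w="\<lambda>x. 2 * \<bar>f x\<bar>"]) (use lim in auto)
    then show ?case by (rule assms(8)[OF lim.hyps(4) lim.hyps(1) lim.IH])
  qed
qed

text \<open>
  For the indicator of a bounded open set \<open>U\<close> this is Scheffe's argument: a point of \<open>U\<close> stays in \<open>U\<close>
  under small translations, so the positive part of the difference tends to zero; and since
  the indicator and its translate have equal integrals, the \<open>L\<^sup>1\<close> distance is twice the integral of
  that positive part.
\<close>

lemma translation_continuous_L1:
  fixes f :: "'a::euclidean_space \<Rightarrow> real"
  assumes "integrable lborel f"
  shows "((\<lambda>z. LINT x|lborel. \<bar>f (z + x) - f x\<bar>) \<longlongrightarrow> 0) (at 0)"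
proof -
  have Int: "Int_stable {U::'a set. open U}" by (auto simp: Int_stable_def)
  have sig: "sets borel = sigma_sets UNIV {U::'a set. open U}" by (simp add: borel_def)
  have UN: "UNIV \<in> {U::'a set. open U}" by simp
  from assms Int sig UN show ?thesis
  proof (induction f rule: integrable_lborel_induct)
    case (generator A N)
    define U where "U = A \<inter> ball 0 (real N)"
    have U: "open U" "bounded U" using generator by (auto simp: U_def)
    then have [measurable]: "U \<in> sets borel" by simp
    have int: "integrable lborel (indicat_real U)" using U emeasure_bounded_finite[of U] by auto
    show ?case unfolding tendsto_at_iff_sequentially U_def[symmetric]
    proof (intro allI impI)
      fix z :: "nat \<Rightarrow> 'a" assume z: "\<forall>i. z i \<in> UNIV - {0}" "z \<longlonglongrightarrow> 0"
      have "(\<lambda>i. LINT x|lborel. max 0 (indicat_real U x - indicat_real U (z i + x))) \<longlonglongrightarrow> (LINT x::'a|lborel. 0)"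
      proof (rule integral_dominated_convergence[OF _ _ int])
        show "AE x in lborel. (\<lambda>i. max 0 (indicat_real U x - indicat_real U (z i + x))) \<longlonglongrightarrow> 0"
        proof (rule AE_I2, rule tendsto_eventually)
          fix x
          show "eventually (\<lambda>i. max 0 (indicat_real U x - indicat_real U (z i + x)) = 0) sequentially"
          proof (cases "x \<in> U")
            case True
            have "(\<lambda>i. z i + x) \<longlonglongrightarrow> 0 + x" by (intro tendsto_intros z)
            with True U have "eventually (\<lambda>i. z i + x \<in> U) sequentially"
              using topological_tendstoD by fastforce
            then show ?thesis by eventually_elim (auto simp: indicator_def)
          qed (auto simp: indicator_def)
        qed
      qed (auto simp: indicator_def)
      then have "(\<lambda>i. 2 * (LINT x|lborel. max 0 (indicat_real U x - indicat_real U (z i + x)))) \<longlonglongrightarrow> 0"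
        by (simp add: tendsto_mult_right_zero)
      moreover have "(LINT x|lborel. \<bar>indicat_real U (w + x) - indicat_real U x\<bar>) =
         2 * (LINT x|lborel. max 0 (indicat_real U x - indicat_real U (w + x)))" for w
      proof -
        have intw: "integrable lborel (\<lambda>x. indicat_real U (w + x))" by (rule integrable_translation[OF int])
        have im: "integrable lborel (\<lambda>x. max 0 (indicat_real U x - indicat_real U (w + x)))"
          using int intw by auto
        have "(LINT x|lborel. \<bar>indicat_real U (w + x) - indicat_real U x\<bar>) =
           (LINT x|lborel. 2 * max 0 (indicat_real U x - indicat_real U (w + x)) + (indicat_real U (w + x) - indicat_real U x))"
          by (rule Bochner_Integration.integral_cong) (auto simp: indicator_def)
        also have "\<dots> = 2 * (LINT x|lborel. max 0 (indicat_real U x - indicat_real U (w + x)))"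
          using int intw im integral_translation[OF int, of w] by simp
        finally show ?thesis .
      qed
      ultimately show "((\<lambda>z. LINT x|lborel. \<bar>indicat_real U (z + x) - indicat_real U x\<bar>) \<circ> z) \<longlonglongrightarrow> 0"
        by (simp add: o_def)
    qed
  next
    case (add f h)
    have le: "(LINT x|lborel. \<bar>f (z + x) + h (z + x) - (f x + h x)\<bar>) \<le>
       (LINT x|lborel. \<bar>f (z + x) - f x\<bar>) + (LINT x|lborel. \<bar>h (z + x) - h x\<bar>)" for z
    proof -
      note i = add(1,2) integrable_translation[OF add(1), of z] integrable_translation[OF add(2), of z]
      have "(LINT x|lborel. \<bar>f (z + x) + h (z + x) - (f x + h x)\<bar>) \<le> (LINT x|lborel. \<bar>f (z + x) - f x\<bar> + \<bar>h (z + x) - h x\<bar>)"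
        using i by (intro integral_mono) auto
      also have "\<dots> = (LINT x|lborel. \<bar>f (z + x) - f x\<bar>) + (LINT x|lborel. \<bar>h (z + x) - h x\<bar>)"
        using i by (intro Bochner_Integration.integral_add) auto
      finally show ?thesis .
    qed
    have "((\<lambda>z. (LINT x|lborel. \<bar>f (z + x) - f x\<bar>) + (LINT x|lborel. \<bar>h (z + x) - h x\<bar>)) \<longlongrightarrow> 0 + 0) (at 0)"
      by (intro tendsto_add add)
    then have lim: "((\<lambda>z. (LINT x|lborel. \<bar>f (z + x) - f x\<bar>) + (LINT x|lborel. \<bar>h (z + x) - h x\<bar>)) \<longlongrightarrow> 0) (at 0)"
      by simp
    show ?case
    proof (rule tendsto_sandwich[OF _ _ tendsto_const lim])
      show "\<forall>\<^sub>F z in at 0. 0 \<le> (LINT x|lborel. \<bar>f (z + x) + h (z + x) - (f x + h x)\<bar>)"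
        by (intro always_eventually allI Bochner_Integration.integral_nonneg) simp
    qed (intro always_eventually allI le)
  next
    case (scale f c)
    have "((\<lambda>z. \<bar>c\<bar> * (LINT x|lborel. \<bar>f (z + x) - f x\<bar>)) \<longlongrightarrow> \<bar>c\<bar> * 0) (at 0)"
      by (intro tendsto_mult scale tendsto_const)
    then show ?case by (simp flip: right_diff_distrib add: abs_mult)
  next
    case (lim f s)
    show ?case
    proof (rule tendstoI)
      fix e :: real assume e: "e > 0"
      obtain i where i: "(LINT x|lborel. \<bar>s i x - f x\<bar>) < e / 4"
        using order_tendstoD(2)[OF lim.hyps(3), of "e / 4"] e by (auto simp: eventually_sequentially)
      have le: "(LINT x|lborel. \<bar>f (z + x) - f x\<bar>) \<le> (LINT x|lborel. \<bar>s i (z + x) - s i x\<bar>) + 2 * (LINT x|lborel. \<bar>s i x - f x\<bar>)" for z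
      proof -
        have d: "integrable lborel (\<lambda>x. \<bar>s i x - f x\<bar>)" using lim by simp
        note j = lim(1,2) integrable_translation[OF lim(1), of z] integrable_translation[OF lim(2), of i z] integrable_translation[OF d, of z]
        have "(LINT x|lborel. \<bar>f (z + x) - f x\<bar>) \<le> (LINT x|lborel. \<bar>s i (z + x) - s i x\<bar> + (\<bar>s i (z + x) - f (z + x)\<bar> + \<bar>s i x - f x\<bar>))"
          using j by (intro integral_mono) auto
        also have "\<dots> = (LINT x|lborel. \<bar>s i (z + x) - s i x\<bar>) + ((LINT x|lborel. \<bar>s i (z + x) - f (z + x)\<bar>) + (LINT x|lborel. \<bar>s i x - f x\<bar>))"
          using j d by simp
        finally show ?thesis using integral_translation[OF d, of z] by simp
      qed
      have "eventually (\<lambda>z. (LINT x|lborel. \<bar>s i (z + x) - s i x\<bar>) < e / 2) (at 0)"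
        using order_tendstoD(2)[OF lim.IH[of i], of "e / 2"] e by simp
      then show "eventually (\<lambda>z. dist (LINT x|lborel. \<bar>f (z + x) - f x\<bar>) 0 < e) (at 0)"
      proof eventually_elim
        case (elim z)
        then show ?case using le[of z] i by (simp add: dist_norm)
      qed
    qed
  qed
qed

section \<open>Separability of \<open>L\<^sup>1\<close>\<close>

lemma second_countable_if_separable:
  fixes C :: "'b::metric_space set"
  assumes C: "countable C" "closure C = UNIV"
  shows "\<exists>B::'b set set. countable B \<and> open = generate_topology B"
proof -
  define B where "B = (\<lambda>(c, n). ball c (1 / Suc n)) ` (C \<times> (UNIV :: nat set))"
  have "open U = generate_topology B U" for U
  proof
    assume U: "open U"
    have "\<exists>b\<in>B. x \<in> b \<and> b \<subseteq> U" if "x \<in> U" for x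
    proof -
      obtain e where e: "e > 0" "ball x e \<subseteq> U" using U \<open>x \<in> U\<close> by (meson openE)
      obtain n where n: "1 / real (Suc n) < e / 2" using nat_approx_posE[of "e / 2"] e by auto
      have "x \<in> closure C" using C by simp
      then obtain c where c: "c \<in> C" "dist c x < 1 / real (Suc n)"
        by (metis closure_approachable of_nat_0_less_iff zero_less_Suc zero_less_divide_1_iff)
      have "ball c (1 / Suc n) \<subseteq> ball x e"
      proof
        fix y assume "y \<in> ball c (1 / Suc n)"
        then show "y \<in> ball x e" using c n dist_triangle[of x y c] by (simp add: dist_commute)
      qed
      then show ?thesis using c e unfolding B_def by force
    qed
    then have "U = \<Union>{b\<in>B. b \<subseteq> U}" by blast
    moreover have "generate_topology B (\<Union>{b\<in>B. b \<subseteq> U})"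
      by (rule generate_topology.UN) (auto intro: generate_topology.Basis)
    ultimately show "generate_topology B U" by simp
  next
    assume "generate_topology B U"
    then show "open U" by induction (auto simp: B_def)
  qed
  moreover have "countable B" using C unfolding B_def by auto
  ultimately show ?thesis by blast
qed

lemma L1_rep:
  shows integrable_rep_L1: "integrable lborel (rep_L1 f)" and abs_rep_L1: "abs_L1 (rep_L1 f) = f"
  using Quotient_L1 unfolding Quotient_def by blast+

lemma abs_L1_add: "integrable lborel f \<Longrightarrow> integrable lborel h \<Longrightarrow> abs_L1 (\<lambda>x. f x + h x) = abs_L1 f + abs_L1 h"
  by (simp add: plus_L1.abs_eq)

lemma abs_L1_diff: "integrable lborel f \<Longrightarrow> integrable lborel h \<Longrightarrow> abs_L1 (\<lambda>x. f x - h x) = abs_L1 f - abs_L1 h"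
  by (simp add: minus_L1.abs_eq)

lemma abs_L1_scale: "integrable lborel f \<Longrightarrow> abs_L1 (\<lambda>x. c * f x) = c *\<^sub>R abs_L1 f"
  by (simp add: scaleR_L1.abs_eq)

lemma norm_abs_L1: "integrable lborel f \<Longrightarrow> norm (abs_L1 f) = (LINT x|lborel. \<bar>f x\<bar>)"
  by (simp add: norm_L1.abs_eq)

lemma countable_rational_span:
  fixes D :: "'b::real_normed_vector set"
  assumes "countable D"
  obtains C where "countable C" "D \<subseteq> C" "\<And>x y. x \<in> C \<Longrightarrow> y \<in> C \<Longrightarrow> x + y \<in> C"
    "\<And>q x. q \<in> \<rat> \<Longrightarrow> x \<in> C \<Longrightarrow> q *\<^sub>R x \<in> C"
proof -
  define comb where "comb l = sum_list (map (\<lambda>(q, d). q *\<^sub>R d) l)" for l :: "(real \<times> 'b) list"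
  define C where "C = comb ` lists (\<rat> \<times> D)"
  show ?thesis
  proof
    show "countable C" unfolding C_def using assms countable_rat by (intro countable_image countable_lists countable_SIGMA) auto
    show "D \<subseteq> C"
    proof
      fix d assume "d \<in> D"
      then have "comb [(1, d)] \<in> C" unfolding C_def by (intro imageI) auto
      then show "d \<in> C" by (simp add: comb_def)
    qed
    show "x + y \<in> C" if "x \<in> C" "y \<in> C" for x y
    proof -
      obtain l k where lk: "l \<in> lists (\<rat> \<times> D)" "k \<in> lists (\<rat> \<times> D)" "x = comb l" "y = comb k"
        using \<open>x \<in> C\<close> \<open>y \<in> C\<close> unfolding C_def by blast
      then have "comb (l @ k) \<in> C" unfolding C_def by (intro imageI) auto
      then show ?thesis using lk by (simp add: comb_def)
    qed
    show "q *\<^sub>R x \<in> C" if q: "q \<in> \<rat>" and "x \<in> C" for q x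
    proof -
      obtain l where l: "l \<in> lists (\<rat> \<times> D)" "x = comb l" using \<open>x \<in> C\<close> unfolding C_def by blast
      have "q *\<^sub>R comb l = comb (map (\<lambda>(r, d). (q * r, d)) l)" for l
        by (induction l) (auto simp: comb_def algebra_simps)
      moreover have "map (\<lambda>(r, d). (q * r, d)) l \<in> lists (\<rat> \<times> D)"
        using l(1) q by (fastforce simp: in_lists_conv_set)
      ultimately show ?thesis using l unfolding C_def by auto
    qed
  qed
qed

text \<open>
  Finite intersections of a countable base form a countable generator that is stable under
  intersections. The induction principle then shows that the rational combinations of the indicators
  of its members, cut off by balls of integer radius, are dense.
\<close>

lemma L1_separable: "\<exists>C :: 'a::euclidean_space L1 set. countable C \<and> closure C = UNIV"
proof -
  obtain B :: "'a set set" where B: "countable B" "topological_basis B" using ex_countable_basis by blast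
  define \<G> where "\<G> = Inter ` {b. finite b \<and> b \<subseteq> B}"
  have c\<G>: "countable \<G>" unfolding \<G>_def by (intro countable_image countable_Collect_finite_subset B)
  have op: "open A" if "A \<in> \<G>" for A
    using that topological_basis_open[OF B(2)] unfolding \<G>_def by (auto intro!: open_Inter)
  have UN: "UNIV \<in> \<G>" unfolding \<G>_def by (rule image_eqI[of _ _ "{}"]) auto
  have Int: "Int_stable \<G>"
  proof (rule Int_stableI)
    fix a b assume "a \<in> \<G>" "b \<in> \<G>"
    then obtain x y where "finite x" "x \<subseteq> B" "finite y" "y \<subseteq> B" "a = \<Inter>x" "b = \<Inter>y"
      unfolding \<G>_def by auto
    then show "a \<inter> b \<in> \<G>" unfolding \<G>_def by (intro image_eqI[of _ _ "x \<union> y"]) auto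
  qed
  have "B \<subseteq> \<G>" unfolding \<G>_def
  proof
    fix b assume "b \<in> B"
    then show "b \<in> Inter ` {b. finite b \<and> b \<subseteq> B}" by (intro image_eqI[of _ _ "{b}"]) auto
  qed
  then have "topological_basis \<G>"
    using B(2) op unfolding topological_basis_def by (meson order_trans)
  then have "sets borel = sets (sigma UNIV \<G>)"
    using borel_eq_countable_basis[OF c\<G>] by simp
  also have "\<dots> = sigma_sets UNIV \<G>" by (rule sets_measure_of) simp
  finally have sig: "sets borel = sigma_sets UNIV \<G>" .
  define D where "D = (\<lambda>(A, N). abs_L1 (indicat_real (A \<inter> ball 0 (real N)))) ` (\<G> \<times> (UNIV :: nat set))"
  have "countable D" unfolding D_def using c\<G> by auto
  then obtain C where C: "countable C" "D \<subseteq> C" "\<And>x y. x \<in> C \<Longrightarrow> y \<in> C \<Longrightarrow> x + y \<in> C"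
    "\<And>q x. q \<in> \<rat> \<Longrightarrow> x \<in> C \<Longrightarrow> q *\<^sub>R x \<in> C"
    using countable_rational_span by blast
  have "abs_L1 f \<in> closure C" if "integrable lborel f" for f
    using that Int sig UN
  proof (induction f rule: integrable_lborel_induct)
    case (generator A N)
    then have "abs_L1 (indicat_real (A \<inter> ball 0 (real N))) \<in> D" unfolding D_def by force
    then show ?case using C closure_subset by blast
  next
    case (add f h)
    obtain x y where x: "\<And>n. x n \<in> C" "x \<longlonglongrightarrow> abs_L1 f" and y: "\<And>n. y n \<in> C" "y \<longlonglongrightarrow> abs_L1 h"
      using add unfolding closure_sequential by blast
    have "(\<lambda>n. x n + y n) \<longlonglongrightarrow> abs_L1 f + abs_L1 h" by (intro tendsto_intros x y)
    then show ?case unfolding closure_sequential abs_L1_add[OF add(1,2)]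
      by (intro exI[of _ "\<lambda>n. x n + y n"]) (simp add: x y C)
  next
    case (scale f c)
    obtain x where x: "\<And>n. x n \<in> C" "x \<longlonglongrightarrow> abs_L1 f" using scale unfolding closure_sequential by blast
    have "c \<in> closure \<rat>" by (simp add: Rats_closure_real)
    then obtain q where q: "\<And>n. q n \<in> \<rat>" "q \<longlonglongrightarrow> c" unfolding closure_sequential by blast
    have "(\<lambda>n. q n *\<^sub>R x n) \<longlonglongrightarrow> c *\<^sub>R abs_L1 f" by (intro tendsto_intros x q)
    then show ?case unfolding closure_sequential abs_L1_scale[OF scale(1)]
      by (intro exI[of _ "\<lambda>n. q n *\<^sub>R x n"]) (simp add: x q C)
  next
    case (lim f s)
    have "(\<lambda>i. abs_L1 (s i)) \<longlonglongrightarrow> abs_L1 f"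
      unfolding tendsto_dist_iff[of _ "abs_L1 f"] dist_norm
      using lim.hyps by (simp add: abs_L1_diff[symmetric] norm_abs_L1)
    then show ?case by (rule closed_sequentially[OF closed_closure lim.IH])
  qed
  from this[OF integrable_rep_L1] have "closure C = UNIV" by (auto simp: abs_rep_L1)
  with C show ?thesis by blast
qed

text \<open>
  Second countability makes differences of measurable \<open>L\<^sup>1\<close>-valued maps measurable. This is what gives
  \<open>L1_Omega_norm P (u - v)\<close> its meaning: the integral of a nonmeasurable function would be zero by
  convention.
\<close>

instance L1 :: (euclidean_space) second_countable_topology
proof
  show "\<exists>B::'a L1 set set. countable B \<and> open = generate_topology B"
    using second_countable_if_separable L1_separable by blast
qed

section \<open>Smooth bump functions\<close>

text \<open>
  A family of functions that is closed under partial derivatives consists of smooth functions: the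
  iterated derivatives are chosen in the family by recursion.
\<close>

lemma smoothI:
  fixes \<phi> :: "real^'n \<Rightarrow> real"
  assumes "\<phi> \<in> C" and "\<And>f. f \<in> C \<Longrightarrow> \<exists>G. (\<forall>i. G i \<in> C) \<and> (\<forall>x. GDERIV f x :> (\<chi> i. G i x))"
  shows "smooth \<phi>"
proof -
  obtain G where G: "\<And>f i. f \<in> C \<Longrightarrow> G f i \<in> C" "\<And>f x. f \<in> C \<Longrightarrow> GDERIV f x :> (\<chi> i. G f i x)"
    using assms(2) by metis
  define D where "D = rec_list \<phi> (\<lambda>i _ f. G f i)"
  have D: "D [] = \<phi>" "D (i # is) = G (D is) i" for i "is" by (simp_all add: D_def)
  have "D is \<in> C" for "is" by (induction "is") (auto simp: D assms(1) G)
  then show ?thesis unfolding smooth_def using D G(2) by (intro exI[of _ D]) auto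
qed

text \<open>
  For \<open>q = 1\<close> this is the classical function \<open>exp (- 1 / s)\<close> extended by zero. The polynomial factor is
  what its derivatives of higher order produce.
\<close>

definition exp_inv :: "real poly \<Rightarrow> real \<Rightarrow> real" where
  "exp_inv q s = (if s > 0 then poly q (1 / s) * exp (- 1 / s) else 0)"

lemma poly_div_exp_tendsto_0: "((\<lambda>x. poly q x / exp x) \<longlongrightarrow> (0::real)) at_top"
proof -
  have "((\<lambda>x. \<Sum>i\<le>degree q. coeff q i * (x ^ i / exp x)) \<longlongrightarrow> (\<Sum>i\<le>degree q. coeff q i * 0)) at_top"
    by (intro tendsto_sum tendsto_mult tendsto_const tendsto_power_div_exp_0)
  then show ?thesis by (simp add: poly_altdef sum_divide_distrib)
qed

lemma exp_inv_deriv: "(exp_inv q has_real_derivative exp_inv ([:0, 0, 1:] * (q - pderiv q)) s) (at s)"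
proof -
  consider "s > 0" | "s < 0" | "s = 0" by linarith
  then show ?thesis
  proof cases
    case 1
    have d: "((\<lambda>s. poly q (1 / s) * exp (- 1 / s)) has_real_derivative
        exp_inv ([:0, 0, 1:] * (q - pderiv q)) s) (at s)"
      using 1 by (auto intro!: derivative_eq_intros simp: exp_inv_def field_simps power2_eq_square)
    have ev: "eventually (\<lambda>s. poly q (1 / s) * exp (- 1 / s) = exp_inv q s) (nhds s)"
      using eventually_nhds_in_open[of "{0<..}" s] 1 by (auto elim!: eventually_mono simp: exp_inv_def)
    show ?thesis by (rule DERIV_cong_ev[OF refl ev refl, THEN iffD1, OF d])
  next
    case 2
    have d: "((\<lambda>s. 0) has_real_derivative exp_inv ([:0, 0, 1:] * (q - pderiv q)) s) (at s)"
      using 2 by (simp add: exp_inv_def)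
    have ev: "eventually (\<lambda>s. 0 = exp_inv q s) (nhds s)"
      using eventually_nhds_in_open[of "{..<0}" s] 2 by (auto elim!: eventually_mono simp: exp_inv_def)
    show ?thesis by (rule DERIV_cong_ev[OF refl ev refl, THEN iffD1, OF d])
  next
    case 3
    have "((\<lambda>x. poly ([:0, 1:] * q) x / exp x) \<longlongrightarrow> 0) at_top" by (rule poly_div_exp_tendsto_0)
    then have "((\<lambda>s. poly ([:0, 1:] * q) (inverse s) / exp (inverse s)) \<longlongrightarrow> 0) (at_right 0)"
      by (rule filterlim_compose[OF _ filterlim_inverse_at_top_right])
    then have "((\<lambda>s. exp_inv q s / s) \<longlongrightarrow> 0) (at_right 0)"
    proof (rule Lim_transform_eventually)
      show "eventually (\<lambda>s. poly ([:0, 1:] * q) (inverse s) / exp (inverse s) = exp_inv q s / s) (at_right 0)"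
        unfolding eventually_at_right_field
        by (intro exI[of _ 1]) (auto simp: exp_inv_def field_simps exp_minus)
    qed
    moreover have "((\<lambda>s. exp_inv q s / s) \<longlongrightarrow> 0) (at_left 0)"
      by (rule tendsto_eventually) (auto simp: eventually_at_left_field exp_inv_def intro!: exI[of _ "-1"])
    ultimately have "((\<lambda>s. exp_inv q s / s) \<longlongrightarrow> 0) (at 0)" by (intro filterlim_split_at)
    then show ?thesis using 3 by (simp add: has_field_derivative_iff exp_inv_def)
  qed
qed

text \<open>
  An algebra of functions that contains the bump \<open>exp_inv 1 (1 - x \<bullet> x)\<close> and is closed under partial
  derivatives, so that \<open>smoothI\<close> applies to it.
\<close>

inductive_set bump_algebra :: "(real^'n \<Rightarrow> real) set" where
  const: "(\<lambda>x. c) \<in> bump_algebra"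
| coordinate: "(\<lambda>x. x $ i) \<in> bump_algebra"
| bump: "(\<lambda>x. exp_inv q (1 - x \<bullet> x)) \<in> bump_algebra"
| add: "f \<in> bump_algebra \<Longrightarrow> h \<in> bump_algebra \<Longrightarrow> (\<lambda>x. f x + h x) \<in> bump_algebra"
| mult: "f \<in> bump_algebra \<Longrightarrow> h \<in> bump_algebra \<Longrightarrow> (\<lambda>x. f x * h x) \<in> bump_algebra"

lemma bump_algebra_deriv:
  assumes "f \<in> bump_algebra"
  shows "\<exists>G. (\<forall>i. G i \<in> bump_algebra) \<and> (\<forall>x::real^'n. GDERIV f x :> (\<chi> i. G i x))"
  using assms
proof induction
  case (const c)
  show ?case
    by (rule exI[of _ "\<lambda>i x. 0"]) (auto intro: bump_algebra.intros GDERIV_subst[OF GDERIV_const] simp: vec_eq_iff)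
next
  case (coordinate j)
  have "GDERIV (\<lambda>x. x $ j) x :> (\<chi> i. if i = j then 1 else 0)" for x :: "real^'n"
  proof -
    have "(\<lambda>h :: real^'n. h \<bullet> (\<chi> i. if i = j then 1 else 0)) = (\<lambda>h. h $ j)"
      by (auto simp: inner_vec_def if_distrib cong: if_cong)
    then show ?thesis unfolding gderiv_def
      by (simp add: bounded_linear_imp_has_derivative bounded_linear_vec_nth)
  qed
  then show ?case
    by (intro exI[of _ "\<lambda>i x. if i = j then 1 else 0"]) (auto intro: bump_algebra.intros)
next
  case (bump q)
  have "GDERIV (\<lambda>x. exp_inv q (1 - x \<bullet> x)) x :> (\<chi> i. exp_inv ([:0, 0, 1:] * (q - pderiv q)) (1 - x \<bullet> x) * ((-2) * x $ i))" for x :: "real^'n"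
  proof -
    have "GDERIV (\<lambda>x. 1 - x \<bullet> x) x :> (-2) *\<^sub>R x" for x :: "real^'n"
      unfolding gderiv_def by (auto intro!: derivative_eq_intros simp: inner_commute)
    from GDERIV_DERIV_compose[OF this exp_inv_deriv] show ?thesis
      by (rule GDERIV_subst) (simp add: vec_eq_iff)
  qed
  then show ?case
    by (intro exI[of _ "\<lambda>i x. exp_inv ([:0, 0, 1:] * (q - pderiv q)) (1 - x \<bullet> x) * ((-2) * x $ i)"]
       conjI allI bump_algebra.mult bump_algebra.bump bump_algebra.const bump_algebra.coordinate)
next
  case (add f h)
  then obtain F H where "\<forall>i. F i \<in> bump_algebra" "\<And>x. GDERIV f x :> (\<chi> i. F i x)"
    "\<forall>i. H i \<in> bump_algebra" "\<And>x. GDERIV h x :> (\<chi> i. H i x)" by blast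
  then show ?case
    by (intro exI[of _ "\<lambda>i x. F i x + H i x"])
       (auto intro!: bump_algebra.intros GDERIV_subst[OF GDERIV_add] simp: vec_eq_iff)
next
  case (mult f h)
  then obtain F H where "\<forall>i. F i \<in> bump_algebra" "\<And>x. GDERIV f x :> (\<chi> i. F i x)"
    "\<forall>i. H i \<in> bump_algebra" "\<And>x. GDERIV h x :> (\<chi> i. H i x)" by blast
  with mult show ?case
    by (intro exI[of _ "\<lambda>i x. f x * H i x + h x * F i x"])
       (auto intro!: bump_algebra.intros GDERIV_subst[OF GDERIV_mult] simp: vec_eq_iff)
qed

lemma smooth_bump: "smooth (\<lambda>x::real^'n. exp_inv 1 (1 - x \<bullet> x))"
  by (rule smoothI[OF bump_algebra.bump bump_algebra_deriv])

lemma smooth_affine: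
  fixes \<phi> :: "real^'n \<Rightarrow> real"
  assumes "smooth \<phi>"
  shows "smooth (\<lambda>x. c * \<phi> (z + a *\<^sub>R x))"
proof -
  obtain D :: "'n list \<Rightarrow> real^'n \<Rightarrow> real" where D: "D [] = \<phi>" "\<And>is x. GDERIV (D is) x :> (\<chi> i. D (i # is) x)"
    using assms unfolding smooth_def by blast
  show ?thesis
  proof (rule smoothI[where C="{\<lambda>x. c * D is (z + a *\<^sub>R x) |is c. True}"])
    show "(\<lambda>x. c * \<phi> (z + a *\<^sub>R x)) \<in> {\<lambda>x. c * D is (z + a *\<^sub>R x) |is c. True}" using D by blast
    fix f assume "f \<in> {\<lambda>x. c * D is (z + a *\<^sub>R x) |is c. True}"
    then obtain "is" c where f: "f = (\<lambda>x. c * D is (z + a *\<^sub>R x))" by blast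
    have "GDERIV f x :> (\<chi> i. (c * a) * D (i # is) (z + a *\<^sub>R x))" for x
    proof -
      have "((\<lambda>x. D is (z + a *\<^sub>R x)) has_derivative (\<lambda>h. (a *\<^sub>R h) \<bullet> (\<chi> i. D (i # is) (z + a *\<^sub>R x)))) (at x)"
        using D(2)[of "is" "z + a *\<^sub>R x"] unfolding gderiv_def
        by (rule has_derivative_compose[rotated]) (auto intro!: derivative_eq_intros)
      from has_derivative_mult_right[OF this, of c] show ?thesis
        unfolding gderiv_def f
        by (rule has_derivative_eq_rhs) (auto simp: inner_vec_def sum_distrib_left algebra_simps intro!: sum.cong)
    qed
    then show "\<exists>G. (\<forall>i. G i \<in> {\<lambda>x. c * D is (z + a *\<^sub>R x) |is c. True}) \<and> (\<forall>x. GDERIV f x :> (\<chi> i. G i x))"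
      by (intro exI[of _ "\<lambda>i x. (c * a) * D (i # is) (z + a *\<^sub>R x)"]) blast
  qed
qed

lemma smooth_gradient:
  fixes \<phi> :: "real^'n \<Rightarrow> real"
  assumes "smooth \<phi>"
  obtains \<Phi> where "\<And>x. GDERIV \<phi> x :> \<Phi> x" "continuous_on UNIV \<Phi>"
proof -
  obtain D :: "'n list \<Rightarrow> real^'n \<Rightarrow> real" where D: "D [] = \<phi>" "\<And>is x. GDERIV (D is) x :> (\<chi> i. D (i # is) x)"
    using assms unfolding smooth_def by blast
  have "continuous_on UNIV (D is)" for "is"
    using D(2) unfolding gderiv_def
    by (intro continuous_at_imp_continuous_on ballI) (rule has_derivative_continuous)
  then have "continuous_on UNIV (\<lambda>x. \<chi> i. D [i] x)" by (intro continuous_on_vec_lambda)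
  then show ?thesis using D that by metis
qed

lemma GDERIV_unique: "GDERIV f x :> a \<Longrightarrow> GDERIV f x :> b \<Longrightarrow> a = b"
  unfolding gderiv_def using has_derivative_unique[of f "\<lambda>h. h \<bullet> a" x "\<lambda>h. h \<bullet> b"]
  by (simp add: fun_eq_iff vector_eq_ldot)

text \<open>
  The gradient given by smoothness is continuous, and it vanishes off the compact support; hence it is
  bounded, which also gives the Lipschitz bound.
\<close>

lemma test_function_gradient:
  fixes \<phi> :: "real^'n \<Rightarrow> real"
  assumes \<phi>: "test_function S \<phi>" and \<Phi>: "\<And>x. GDERIV \<phi> x :> \<Phi> x"
  defines "K \<equiv> closure {x. \<phi> x \<noteq> 0}"
  obtains L where "continuous_on UNIV \<phi>" "continuous_on UNIV \<Phi>" "\<And>x. x \<notin> K \<Longrightarrow> \<phi> x = 0" "\<And>x. x \<notin> K \<Longrightarrow> \<Phi> x = 0"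
    "\<And>x. \<bar>\<phi> x\<bar> \<le> L" "\<And>x. norm (\<Phi> x) \<le> L" "\<And>x y. \<bar>\<phi> x - \<phi> y\<bar> \<le> L * norm (x - y)" "0 \<le> L"
proof -
  have K: "compact K" and smooth: "smooth \<phi>" using \<phi> by (auto simp: test_function_def K_def)
  have c\<phi>: "continuous_on UNIV \<phi>"
    using \<Phi> unfolding gderiv_def
    by (intro continuous_at_imp_continuous_on ballI) (rule has_derivative_continuous)
  obtain \<Phi>' where \<Phi>': "\<And>x. GDERIV \<phi> x :> \<Phi>' x" "continuous_on UNIV \<Phi>'" using smooth_gradient[OF smooth] by blast
  have "\<Phi>' = \<Phi>" using GDERIV_unique[OF \<Phi>'(1) \<Phi>] by auto
  with \<Phi>' have c\<Phi>: "continuous_on UNIV \<Phi>" by simp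
  have \<phi>0: "\<phi> x = 0" if "x \<notin> K" for x using that closure_subset[of "{x. \<phi> x \<noteq> 0}"] by (auto simp: K_def)
  have \<Phi>0: "\<Phi> x = 0" if "x \<notin> K" for x
  proof (rule GDERIV_unique[OF \<Phi>])
    have "open (- K)" using K by (simp add: compact_imp_closed open_Compl)
    then have "((\<lambda>x. 0) has_derivative (\<lambda>h. h \<bullet> 0)) (at x)" by simp
    then have "(\<phi> has_derivative (\<lambda>h. h \<bullet> 0)) (at x)"
      by (rule has_derivative_transform_within_open[OF _ \<open>open (- K)\<close>]) (use that \<phi>0 in auto)
    then show "GDERIV \<phi> x :> 0" by (simp add: gderiv_def)
  qed
  obtain L1 where L1: "\<And>x. x \<in> K \<Longrightarrow> norm (\<phi> x) \<le> L1"
    using compact_imp_bounded[OF compact_continuous_image[OF continuous_on_subset[OF c\<phi> subset_UNIV] K]]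
    unfolding bounded_iff by auto
  obtain L2 where L2: "\<And>x. x \<in> K \<Longrightarrow> norm (\<Phi> x) \<le> L2"
    using compact_imp_bounded[OF compact_continuous_image[OF continuous_on_subset[OF c\<Phi> subset_UNIV] K]]
    unfolding bounded_iff by auto
  define L where "L = max 0 (max L1 L2)"
  have L: "\<bar>\<phi> x\<bar> \<le> L" "norm (\<Phi> x) \<le> L" for x
    using L1[of x] L2[of x] \<phi>0[of x] \<Phi>0[of x] by (cases "x \<in> K"; simp add: L_def)+
  have "\<bar>\<phi> x - \<phi> y\<bar> \<le> L * norm (x - y)" for x y
  proof -
    have "norm (\<phi> x - \<phi> y) \<le> L * norm (x - y)"
    proof (rule differentiable_bound[of UNIV \<phi> "\<lambda>x h. h \<bullet> \<Phi> x"])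
      show "(\<phi> has_derivative (\<lambda>h. h \<bullet> \<Phi> z)) (at z within UNIV)" for z using \<Phi>[of z] by (simp add: gderiv_def)
      show "onorm (\<lambda>h. h \<bullet> \<Phi> z) \<le> L" for z
        proof (rule onorm_le)
        fix h
        have "norm (h \<bullet> \<Phi> z) \<le> norm h * norm (\<Phi> z)" by (simp add: Cauchy_Schwarz_ineq2)
        also have "\<dots> \<le> norm h * L" by (intro mult_left_mono L) auto
        finally show "norm (h \<bullet> \<Phi> z) \<le> L * norm h" by (simp add: mult.commute)
      qed
    qed auto
    then show ?thesis by simp
  qed
  moreover have "0 \<le> L" by (simp add: L_def)
  ultimately show ?thesis using that[of L] c\<phi> c\<Phi> \<phi>0 \<Phi>0 L by blast
qed

lemma mollifier_exists:
  assumes d: "d > 0"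
  obtains \<psi> :: "real^'n \<Rightarrow> real" where "smooth \<psi>" "\<And>x. 0 \<le> \<psi> x" "\<And>x. norm x > d \<Longrightarrow> \<psi> x = 0"
    "integrable lborel \<psi>" "(LINT x|lborel. \<psi> x) = 1"
proof -
  define \<eta> :: "real^'n \<Rightarrow> real" where "\<eta> x = exp_inv 1 (1 - ((1 / d) *\<^sub>R x) \<bullet> ((1 / d) *\<^sub>R x))" for x
  have smooth: "smooth (\<lambda>x. c * \<eta> x)" for c
    using smooth_affine[OF smooth_bump, of c 0 "1 / d"] by (simp add: \<eta>_def)
  obtain G where G: "\<And>x. GDERIV \<eta> x :> G x" using smooth_gradient[OF smooth[of 1]] by auto
  have cont: "continuous_on UNIV \<eta>"
    using G unfolding gderiv_def
    by (intro continuous_at_imp_continuous_on ballI) (rule has_derivative_continuous)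
  then have [measurable]: "\<eta> \<in> borel_measurable borel" by (rule borel_measurable_continuous_onI)
  have nonneg: "0 \<le> \<eta> x" for x by (simp add: \<eta>_def exp_inv_def)
  have le1: "\<eta> x \<le> 1" for x by (simp add: \<eta>_def exp_inv_def)
  have pos: "0 < \<eta> x \<longleftrightarrow> norm x < d" for x
  proof -
    have "0 < \<eta> x \<longleftrightarrow> (x \<bullet> x) / d\<^sup>2 < 1" by (simp add: \<eta>_def exp_inv_def power2_eq_square)
    also have "\<dots> \<longleftrightarrow> (norm x)\<^sup>2 < d\<^sup>2" using d by (simp add: field_simps power2_norm_eq_inner)
    also have "\<dots> \<longleftrightarrow> norm x < d" using d by (auto intro: power2_less_imp_less power_strict_mono)
    finally show ?thesis .
  qed
  have zero: "\<eta> x = 0" if "norm x \<ge> d" for x using pos[of x] nonneg[of x] that by linarith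
  have int: "integrable lborel \<eta>"
  proof (rule Bochner_Integration.integrable_bound)
    show "integrable lborel (indicat_real (ball (0::real^'n) d))" using emeasure_bounded_finite[of "ball (0::real^'n) d"] by auto
    show "AE x in lborel. norm (\<eta> x) \<le> norm (indicat_real (ball 0 d) x)"
      using nonneg le1 zero by (intro AE_I2) (auto simp: indicator_def)
  qed simp
  have "(LINT x|lborel. \<eta> x) \<noteq> 0"
  proof
    assume "(LINT x|lborel. \<eta> x) = 0"
    then have "AE x in lborel. \<eta> x = 0"
      using integral_nonneg_eq_0_iff_AE[OF int] nonneg by simp
    then have "AE x in lborel. x \<notin> ball (0::real^'n) d" by eventually_elim (use pos in force)
    then have "ball (0::real^'n) d \<in> null_sets lborel" by (subst AE_iff_null_sets) auto
    then have "negligible (ball (0::real^'n) d)"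
      unfolding negligible_iff_null_sets by (rule null_sets_completionI)
    then show False using d open_not_negligible[of "ball (0::real^'n) d"] by simp
  qed
  moreover have "(LINT x|lborel. \<eta> x) \<ge> 0" by (rule Bochner_Integration.integral_nonneg) (rule nonneg)
  ultimately have I: "(LINT x|lborel. \<eta> x) > 0" by simp
  define I where "I = (LINT x|lborel. \<eta> x)"
  show ?thesis
  proof (rule that[of "\<lambda>x. (1 / I) * \<eta> x"])
    show "smooth (\<lambda>x. (1 / I) * \<eta> x)" by (rule smooth)
  qed (use nonneg zero int I in \<open>auto simp: I_def\<close>)
qed

section \<open>Mollification\<close>

definition mollify :: "('a::euclidean_space \<Rightarrow> real) \<Rightarrow> ('a \<Rightarrow> real) \<Rightarrow> 'a \<Rightarrow> real" where
  "mollify \<psi> f x = (LINT y|lborel. f y * \<psi> (x - y))"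

lemma integrable_mult_bounded:
  fixes f h :: "'b \<Rightarrow> real"
  assumes "integrable M f" "h \<in> borel_measurable M" "\<And>x. \<bar>h x\<bar> \<le> B"
  shows "integrable M (\<lambda>x. f x * h x)"
proof (rule Bochner_Integration.integrable_bound)
  show "integrable M (\<lambda>x. B * f x)" using assms by simp
  have "\<bar>f x * h x\<bar> \<le> \<bar>B * f x\<bar>" for x
  proof -
    have "\<bar>f x\<bar> * \<bar>h x\<bar> \<le> \<bar>f x\<bar> * B" by (intro mult_left_mono assms) simp
    moreover have "0 \<le> B" using assms(3)[of x] by linarith
    ultimately show ?thesis by (simp add: abs_mult mult.commute)
  qed
  then show "AE x in M. norm (f x * h x) \<le> norm (B * f x)" by simp
qed (use assms in auto)

text \<open>
  As \<open>\<psi>\<close> is a probability density on the ball of radius \<open>d\<close>, the mollified function is an average of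
  the translates of \<open>f\<close> by vectors of length at most \<open>d\<close>. By Fubini's theorem its \<open>L\<^sup>1\<close> distance to
  \<open>f\<close> is at most the average of the distances of these translates.
\<close>

lemma mollify_L1:
  fixes f \<psi> :: "'a::euclidean_space \<Rightarrow> real"
  assumes f: "integrable lborel f" and \<psi>: "integrable lborel \<psi>" "(LINT x|lborel. \<psi> x) = 1"
    and \<psi>_bounds: "\<And>x. 0 \<le> \<psi> x" "\<And>x. \<psi> x \<le> B" and supp: "\<And>x. norm x > d \<Longrightarrow> \<psi> x = 0"
    and small: "\<And>z. norm z \<le> d \<Longrightarrow> (LINT x|lborel. \<bar>f (z + x) - f x\<bar>) \<le> e" and e: "0 \<le> e"
  shows "integrable lborel (mollify \<psi> f)" "(LINT x|lborel. \<bar>mollify \<psi> f x - f x\<bar>) \<le> e"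
proof -
  have [measurable]: "f \<in> borel_measurable borel" "\<psi> \<in> borel_measurable borel"
    using f \<psi> by (auto dest: borel_measurable_integrable)
  have m[measurable]: "mollify \<psi> f \<in> borel_measurable borel"
    unfolding mollify_def[abs_def] by measurable
  have int\<psi>: "integrable lborel (\<lambda>y. \<psi> (x - y))" for x by (rule integrable_reflection[OF \<psi>(1)])
  have intf: "integrable lborel (\<lambda>y. f y * \<psi> (x - y))" for x
    by (rule integrable_mult_bounded[OF f, of _ B]) (use \<psi>_bounds in auto)
  have pointwise: "ennreal \<bar>mollify \<psi> f x - f x\<bar> \<le> (\<integral>\<^sup>+z. ennreal (\<bar>f (x - z) - f x\<bar> * \<psi> z) \<partial>lborel)" for x
  proof -
    have "mollify \<psi> f x - f x = (LINT y|lborel. f y * \<psi> (x - y)) - f x * (LINT y|lborel. \<psi> (x - y))"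
      using integral_reflection[OF \<psi>(1), of x] \<psi>(2) by (simp add: mollify_def)
    also have "\<dots> = (LINT y|lborel. f y * \<psi> (x - y) - f x * \<psi> (x - y))"
      using intf int\<psi> by simp
    finally have "ennreal \<bar>mollify \<psi> f x - f x\<bar> \<le> (\<integral>\<^sup>+y. ennreal (norm (f y * \<psi> (x - y) - f x * \<psi> (x - y))) \<partial>lborel)"
      using integral_norm_bound_ennreal[of lborel "\<lambda>y. f y * \<psi> (x - y) - f x * \<psi> (x - y)"] intf int\<psi> by simp
    also have "\<dots> = (\<integral>\<^sup>+z. ennreal (norm (f (x - z) * \<psi> (x - (x - z)) - f x * \<psi> (x - (x - z)))) \<partial>lborel)"
      by (rule nn_integral_lborel_reflection[symmetric]) measurable
    also have "\<dots> = (\<integral>\<^sup>+z. ennreal (\<bar>f (x - z) - f x\<bar> * \<psi> z) \<partial>lborel)"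
      using \<psi>_bounds by (intro nn_integral_cong) (simp flip: left_diff_distrib add: abs_mult)
    finally show ?thesis .
  qed
  have "(\<integral>\<^sup>+x. ennreal \<bar>mollify \<psi> f x - f x\<bar> \<partial>lborel) \<le> (\<integral>\<^sup>+x. (\<integral>\<^sup>+z. ennreal (\<bar>f (x - z) - f x\<bar> * \<psi> z) \<partial>lborel) \<partial>lborel)"
    by (intro nn_integral_mono pointwise)
  also have "\<dots> = (\<integral>\<^sup>+z. (\<integral>\<^sup>+x. ennreal (\<bar>f (x - z) - f x\<bar> * \<psi> z) \<partial>lborel) \<partial>lborel)"
    by (rule lborel_pair.Fubini') measurable
  also have "\<dots> \<le> (\<integral>\<^sup>+z. ennreal (e * \<psi> z) \<partial>lborel)"
  proof (intro nn_integral_mono)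
    fix z
    show "(\<integral>\<^sup>+x. ennreal (\<bar>f (x - z) - f x\<bar> * \<psi> z) \<partial>lborel) \<le> ennreal (e * \<psi> z)"
    proof (cases "norm z \<le> d")
      case True
      have "integrable lborel (\<lambda>x. \<bar>f (x - z) - f x\<bar> * \<psi> z)"
        using integrable_translation[OF f, of "- z"] f by (auto intro!: integrable_mult_left)
      then have "(\<integral>\<^sup>+x. ennreal (\<bar>f (x - z) - f x\<bar> * \<psi> z) \<partial>lborel) = ennreal (LINT x|lborel. \<bar>f (x - z) - f x\<bar> * \<psi> z)"
        using \<psi>_bounds by (intro nn_integral_eq_integral) auto
      also have "(LINT x|lborel. \<bar>f (x - z) - f x\<bar> * \<psi> z) = (LINT x|lborel. \<bar>f (- z + x) - f x\<bar>) * \<psi> z"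
        by simp
      also have "\<dots> \<le> e * \<psi> z"
        by (intro mult_right_mono small \<psi>_bounds) (use True in simp)
      finally show ?thesis by (simp add: ennreal_leI)
    qed (simp add: supp)
  qed
  also have "\<dots> = ennreal (LINT z|lborel. e * \<psi> z)"
    using \<psi> \<psi>_bounds e by (intro nn_integral_eq_integral) auto
  also have "\<dots> = ennreal e" using \<psi> by simp
  finally have le: "(\<integral>\<^sup>+x. ennreal \<bar>mollify \<psi> f x - f x\<bar> \<partial>lborel) \<le> ennreal e" .
  then have int: "integrable lborel (\<lambda>x. mollify \<psi> f x - f x)"
    unfolding integrable_iff_bounded by (auto simp: le_less_trans[OF le])
  from Bochner_Integration.integrable_add[OF this f] show "integrable lborel (mollify \<psi> f)" by simp
  have "ennreal (LINT x|lborel. \<bar>mollify \<psi> f x - f x\<bar>) = (\<integral>\<^sup>+x. ennreal \<bar>mollify \<psi> f x - f x\<bar> \<partial>lborel)"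
    using int by (intro nn_integral_eq_integral[symmetric]) auto
  also note le
  finally show "(LINT x|lborel. \<bar>mollify \<psi> f x - f x\<bar>) \<le> e" by (simp add: ennreal_le_iff[OF e])
qed

lemma mollify_lipschitz:
  assumes f: "integrable lborel f" and \<psi>: "\<psi> \<in> borel_measurable borel" "\<And>x. \<bar>\<psi> x\<bar> \<le> B"
    and L: "\<And>x y. \<bar>\<psi> x - \<psi> y\<bar> \<le> L * norm (x - y)"
  shows "\<bar>mollify \<psi> f a - mollify \<psi> f b\<bar> \<le> ((LINT x|lborel. \<bar>f x\<bar>) * L) * norm (a - b)"
proof -
  have [measurable]: "f \<in> borel_measurable borel" using f by (auto dest: borel_measurable_integrable)
  note [measurable] = \<psi>(1)
  have intf: "integrable lborel (\<lambda>y. f y * \<psi> (x - y))" for x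
    by (rule integrable_mult_bounded[OF f, of _ B]) (use \<psi> in auto)
  have "mollify \<psi> f a - mollify \<psi> f b = (LINT y|lborel. f y * (\<psi> (a - y) - \<psi> (b - y)))"
    using intf by (simp add: mollify_def right_diff_distrib)
  also have "\<bar>\<dots>\<bar> \<le> (LINT y|lborel. \<bar>f y * (\<psi> (a - y) - \<psi> (b - y))\<bar>)"
    using integral_norm_bound[of lborel "\<lambda>y. f y * (\<psi> (a - y) - \<psi> (b - y))"] by simp
  also have "\<dots> \<le> (LINT y|lborel. \<bar>f y\<bar> * (L * norm (a - b)))"
  proof (intro integral_mono)
    show "integrable lborel (\<lambda>y. \<bar>f y * (\<psi> (a - y) - \<psi> (b - y))\<bar>)"
      using intf[of a] intf[of b] by (simp add: right_diff_distrib)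
    show "integrable lborel (\<lambda>y. \<bar>f y\<bar> * (L * norm (a - b)))" using f by simp
    show "\<bar>f y * (\<psi> (a - y) - \<psi> (b - y))\<bar> \<le> \<bar>f y\<bar> * (L * norm (a - b))" for y
      using L[of "a - y" "b - y"] by (simp add: abs_mult mult_left_mono)
  qed
  finally show ?thesis by (simp add: mult.assoc)
qed

text \<open>
  Dominated convergence for difference quotients. The bound is asked for small \<open>t\<close> only, because the
  translates of a compactly supported function have a common integrable bound only over bounded sets
  of translations.
\<close>

lemma derivative_under_integral:
  fixes G :: "real \<Rightarrow> 'b \<Rightarrow> real"
  assumes G: "\<And>t. integrable M (G t)" and w: "integrable M w"
    and le: "\<And>t y. \<bar>t\<bar> \<le> 1 \<Longrightarrow> \<bar>G t y - G 0 y\<bar> \<le> \<bar>t\<bar> * w y"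
    and deriv: "\<And>y. ((\<lambda>t. G t y) has_real_derivative G' y) (at 0)"
  shows "integrable M G'" "((\<lambda>t. LINT y|M. G t y) has_real_derivative (LINT y|M. G' y)) (at 0)"
proof -
  have [measurable]: "G t \<in> borel_measurable M" for t using G by auto
  have lim: "((\<lambda>t. (G t y - G 0 y) / t) \<longlongrightarrow> G' y) (at 0)" for y
    using deriv[of y] by (simp add: has_field_derivative_iff)
  have seq: "(\<lambda>n. (G (h n) y - G 0 y) / h n) \<longlonglongrightarrow> G' y" if "h \<longlonglongrightarrow> 0" "\<And>n. h n \<noteq> 0" for h y
    using lim[of y] that unfolding tendsto_at_iff_sequentially by (auto simp: o_def)
  have [measurable]: "G' \<in> borel_measurable M"
    by (rule borel_measurable_LIMSEQ_real[OF seq[of "\<lambda>n. inverse (real (Suc n))"]])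
       (rule LIMSEQ_inverse_real_of_nat, simp, measurable)
  have quot: "\<bar>(G t y - G 0 y) / t\<bar> \<le> w y" if "\<bar>t\<bar> \<le> 1" "t \<noteq> 0" for t y
    using le[OF that(1), of y] that by (simp add: abs_divide divide_le_eq mult.commute)
  have bound: "\<bar>G' y\<bar> \<le> w y" for y
  proof (rule tendsto_upperbound[OF tendsto_rabs[OF lim[of y]]])
    show "\<forall>\<^sub>F t in at 0. \<bar>(G t y - G 0 y) / t\<bar> \<le> w y"
      unfolding eventually_at using quot by (intro exI[of _ 1]) (auto simp: dist_norm)
  qed simp
  show "integrable M G'"
  proof (rule Bochner_Integration.integrable_bound[OF w])
    show "AE y in M. norm (G' y) \<le> norm (w y)" by (intro AE_I2) (metis bound abs_ge_self order_trans real_norm_def)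
  qed simp
  show "((\<lambda>t. LINT y|M. G t y) has_real_derivative (LINT y|M. G' y)) (at 0)"
    unfolding has_field_derivative_iff tendsto_at_iff_sequentially
  proof (intro allI impI)
    fix h :: "nat \<Rightarrow> real" assume h: "\<forall>i. h i \<in> UNIV - {0}" "h \<longlonglongrightarrow> 0"
    have "eventually (\<lambda>n. \<bar>h n\<bar> < 1) sequentially"
      using order_tendstoD(2)[OF tendsto_rabs_zero[OF h(2)]] by simp
    then obtain N where N: "\<And>n. n \<ge> N \<Longrightarrow> \<bar>h n\<bar> < 1" unfolding eventually_sequentially by blast
    have "(\<lambda>n. LINT y|M. (G (h (n + N)) y - G 0 y) / h (n + N)) \<longlonglongrightarrow> (LINT y|M. G' y)"
    proof (rule integral_dominated_convergence[OF _ _ w])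
      show "AE y in M. (\<lambda>n. (G (h (n + N)) y - G 0 y) / h (n + N)) \<longlonglongrightarrow> G' y"
        using seq[of h] h by (intro AE_I2 LIMSEQ_ignore_initial_segment) auto
      show "AE y in M. norm ((G (h (n + N)) y - G 0 y) / h (n + N)) \<le> w y" for n
        using quot[of "h (n + N)"] N[of "n + N"] h by (intro AE_I2) auto
    qed auto
    then have "(\<lambda>n. LINT y|M. (G (h n) y - G 0 y) / h n) \<longlonglongrightarrow> (LINT y|M. G' y)"
      by (rule LIMSEQ_offset)
    then show "((\<lambda>y. ((LINT ya|M. G y ya) - (LINT y|M. G 0 y)) / (y - 0)) \<circ> h) \<longlonglongrightarrow> (LINT y|M. G' y)"
      using G by (simp add: o_def)
  qed
qed

lemma GDERIV_directional:
  assumes "GDERIV f x :> D"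
  shows "((\<lambda>t. f (x + t *\<^sub>R e)) has_real_derivative (D \<bullet> e)) (at 0)"
proof -
  have "((\<lambda>t. x + t *\<^sub>R e) has_derivative (\<lambda>t. t *\<^sub>R e)) (at 0)" by (auto intro!: derivative_eq_intros)
  moreover have "(f has_derivative (\<lambda>h. h \<bullet> D)) (at (x + 0 *\<^sub>R e))" using assms by (simp add: gderiv_def)
  ultimately have "((\<lambda>t. f (x + t *\<^sub>R e)) has_derivative (\<lambda>t. (t *\<^sub>R e) \<bullet> D)) (at 0)"
    by (rule has_derivative_compose)
  then show ?thesis by (simp add: has_field_derivative_def inner_commute mult.commute[of _ "D \<bullet> e"])
qed

lemma mollify_directional_derivative:
  fixes f \<psi> :: "'a::euclidean_space \<Rightarrow> real"
  assumes f: "integrable lborel f" and \<psi>: "\<psi> \<in> borel_measurable borel" "\<And>x. \<bar>\<psi> x\<bar> \<le> B"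
    and L: "\<And>x y. \<bar>\<psi> x - \<psi> y\<bar> \<le> L * norm (x - y)" and \<Psi>: "\<And>x. GDERIV \<psi> x :> \<Psi> x"
  shows "((\<lambda>t. mollify \<psi> f (x + t *\<^sub>R e)) has_real_derivative (LINT y|lborel. f y * (\<Psi> (x - y) \<bullet> e))) (at 0)"
  unfolding mollify_def
proof (rule derivative_under_integral(2))
  have [measurable]: "f \<in> borel_measurable borel" using f by (auto dest: borel_measurable_integrable)
  note [measurable] = \<psi>(1)
  show "integrable lborel (\<lambda>y. f y * \<psi> (x + t *\<^sub>R e - y))" for t
    by (rule integrable_mult_bounded[OF f, of _ B]) (use \<psi> in auto)
  show "integrable lborel (\<lambda>y. \<bar>f y\<bar> * (L * norm e))" using f by simp
  show "\<bar>f y * \<psi> (x + t *\<^sub>R e - y) - f y * \<psi> (x + 0 *\<^sub>R e - y)\<bar> \<le> \<bar>t\<bar> * (\<bar>f y\<bar> * (L * norm e))" for t y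
  proof -
    have "\<bar>f y\<bar> * \<bar>\<psi> (x + t *\<^sub>R e - y) - \<psi> (x - y)\<bar> \<le> \<bar>f y\<bar> * (L * (\<bar>t\<bar> * norm e))"
      using L[of "x + t *\<^sub>R e - y" "x - y"] by (intro mult_left_mono) auto
    moreover have "f y * \<psi> (x + t *\<^sub>R e - y) - f y * \<psi> (x + 0 *\<^sub>R e - y) = f y * (\<psi> (x + t *\<^sub>R e - y) - \<psi> (x - y))"
      by (simp add: right_diff_distrib)
    ultimately show ?thesis by (simp only: abs_mult mult_ac)
  qed
  show "((\<lambda>t. f y * \<psi> (x + t *\<^sub>R e - y)) has_real_derivative f y * (\<Psi> (x - y) \<bullet> e)) (at 0)" for y
    using DERIV_cmult[OF GDERIV_directional[OF \<Psi>[of "x - y"], of e], of "f y"]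
    by (simp add: algebra_simps)
qed

text \<open>
  The integral of the translate \<open>x \<mapsto> g (x + t e)\<close> does not depend on \<open>t\<close>; differentiate it under the
  integral sign at \<open>t = 0\<close>.
\<close>

lemma integral_directional_derivative_eq_0:
  fixes g :: "'a::euclidean_space \<Rightarrow> real"
  assumes lip: "\<And>x y. \<bar>g x - g y\<bar> \<le> L * norm (x - y)" and B: "\<And>x. \<bar>g x\<bar> \<le> B"
    and K: "bounded K" "\<And>x. x \<notin> K \<Longrightarrow> g x = 0"
    and deriv: "\<And>x. ((\<lambda>t. g (x + t *\<^sub>R e)) has_real_derivative g' x) (at 0)"
  shows "integrable lborel g'" "(LINT x|lborel. g' x) = 0"
proof -
  obtain R where R: "\<And>x. x \<in> K \<Longrightarrow> norm x \<le> R" using K(1) unfolding bounded_iff by blast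
  have intball: "integrable lborel (indicat_real (cball (0::'a) r))" for r
    using emeasure_bounded_finite[of "cball (0::'a) r"] by auto
  have "continuous_on UNIV g"
    unfolding continuous_on_iff
  proof (intro ballI allI impI)
    fix x e :: real and y :: 'a assume "e > 0"
    then show "\<exists>d>0. \<forall>x'\<in>UNIV. dist x' y < d \<longrightarrow> dist (g x') (g y) < e"
    proof (intro exI[of _ "e / (\<bar>L\<bar> + 1)"] conjI ballI impI)
      fix x' assume "dist x' y < e / (\<bar>L\<bar> + 1)"
      then have "(\<bar>L\<bar> + 1) * norm (x' - y) < e" by (simp add: field_simps dist_norm)
      moreover have "L * norm (x' - y) \<le> (\<bar>L\<bar> + 1) * norm (x' - y)" by (intro mult_right_mono) auto
      ultimately show "dist (g x') (g y) < e" using lip[of x' y] by (simp add: dist_norm)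
    qed simp
  qed
  then have [measurable]: "g \<in> borel_measurable borel" by (rule borel_measurable_continuous_onI)
  have B0: "0 \<le> B" using B[of 0] by linarith
  have intg: "integrable lborel g"
  proof (rule Bochner_Integration.integrable_bound)
    show "integrable lborel (\<lambda>x. B * indicat_real (cball (0::'a) R) x)" using intball by simp
    show "AE x in lborel. norm (g x) \<le> norm (B * indicat_real (cball 0 R) x)"
      using B K R B0 by (intro AE_I2) (auto simp: indicator_def)
  qed simp
  define w where "w x = (\<bar>L\<bar> * norm e) * indicat_real (cball 0 (R + norm e)) x" for x :: 'a
  have d: "integrable lborel (\<lambda>x. g (x + t *\<^sub>R e))" for t
    using integrable_translation[OF intg, of "t *\<^sub>R e"] by (simp add: add.commute)
  have w: "integrable lborel w" unfolding w_def using intball by simp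
  have le: "\<bar>g (x + t *\<^sub>R e) - g (x + 0 *\<^sub>R e)\<bar> \<le> \<bar>t\<bar> * w x" if t: "\<bar>t\<bar> \<le> 1" for t x
  proof (cases "norm x \<le> R + norm e")
    case True
    have "\<bar>g (x + t *\<^sub>R e) - g x\<bar> \<le> L * (\<bar>t\<bar> * norm e)" using lip[of "x + t *\<^sub>R e" x] by simp
    also have "\<dots> \<le> \<bar>L\<bar> * (\<bar>t\<bar> * norm e)" by (intro mult_right_mono) auto
    finally show ?thesis using True by (simp add: w_def algebra_simps)
  next
    case False
    have "norm x \<le> norm (x + t *\<^sub>R e) + norm (t *\<^sub>R e)"
      using norm_triangle_ineq4[of "x + t *\<^sub>R e" "t *\<^sub>R e"] by simp
    moreover have "norm (t *\<^sub>R e) \<le> norm e" using t by (simp add: mult_left_le_one_le)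
    ultimately have "x + t *\<^sub>R e \<notin> K" "x \<notin> K"
      using False R[of x] R[of "x + t *\<^sub>R e"] norm_ge_zero[of e] by (auto simp del: norm_ge_zero)
    then show ?thesis using K(2) by (simp add: w_def)
  qed
  show "integrable lborel g'" by (rule derivative_under_integral(1)[OF d w le deriv])
  have "((\<lambda>t. LINT x|lborel. g (x + t *\<^sub>R e)) has_real_derivative (LINT x|lborel. g' x)) (at 0)"
    by (rule derivative_under_integral(2)[OF d w le deriv])
  moreover have "(\<lambda>t. LINT x|lborel. g (x + t *\<^sub>R e)) = (\<lambda>t. LINT x|lborel. g x)"
    using integral_translation[OF intg, of "_ *\<^sub>R e"] by (simp add: add.commute fun_eq_iff)
  ultimately show "(LINT x|lborel. g' x) = 0"
    using DERIV_unique DERIV_const by metis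
qed

section \<open>The chain rule for weak gradients\<close>

text \<open>
  For the mollified function the classical chain and product rules apply to \<open>T (f * \<psi>) \<phi>\<close>, a Lipschitz
  function of compact support, whose directional derivative has integral zero. At a point \<open>x\<close> of the
  support of \<open>\<phi>\<close> the function \<open>y \<mapsto> \<psi> (x - y)\<close> is an admissible test function, and this says that the
  gradient of the mollification is the mollification of the weak gradient.
\<close>

lemma chain_rule_mollified:
  fixes f :: "real^'n \<Rightarrow> real" and F :: "real^'n \<Rightarrow> real^'n"
  assumes f: "integrable lborel f" and F: "integrable lborel F"
    and weak: "\<And>\<phi> \<Phi>. test_function S \<phi> \<Longrightarrow> (\<And>x. GDERIV \<phi> x :> \<Phi> x) \<Longrightarrow>
      (LINT x|lborel. f x *\<^sub>R \<Phi> x) = - (LINT x|lborel. \<phi> x *\<^sub>R F x)"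
    and T: "\<And>r. (T has_real_derivative T' r) (at r)" "\<And>r. \<bar>T' r\<bar> \<le> M" "\<And>r. \<bar>T r\<bar> \<le> B" 
    and \<phi>: "test_function S \<phi>" "\<And>x. GDERIV \<phi> x :> \<Phi> x"
    and \<psi>: "smooth \<psi>" "\<And>x. norm x > d \<Longrightarrow> \<psi> x = 0"
    and d: "\<And>x. \<phi> x \<noteq> 0 \<Longrightarrow> cball x d \<subseteq> S"
  shows "(LINT x|lborel. T (mollify \<psi> f x) * (\<Phi> x \<bullet> e)) =
    - (LINT x|lborel. T' (mollify \<psi> f x) * mollify \<psi> (\<lambda>y. F y \<bullet> e) x * \<phi> x)" (is "?lhs = - ?rhs")
proof -
  define K where "K = closure {x. \<phi> x \<noteq> 0}"
  have K: "bounded K" "compact K" using \<phi>(1) by (auto simp: test_function_def K_def compact_imp_bounded)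
  obtain L where L: "continuous_on UNIV \<phi>" "continuous_on UNIV \<Phi>" "\<And>x. x \<notin> K \<Longrightarrow> \<phi> x = 0" "\<And>x. x \<notin> K \<Longrightarrow> \<Phi> x = 0"
    "\<And>x. \<bar>\<phi> x\<bar> \<le> L" "\<And>x. norm (\<Phi> x) \<le> L" "\<And>x y. \<bar>\<phi> x - \<phi> y\<bar> \<le> L * norm (x - y)" "0 \<le> L"
    using test_function_gradient[OF \<phi>] unfolding K_def by blast
  obtain \<Psi> where \<Psi>: "\<And>x. GDERIV \<psi> x :> \<Psi> x" "continuous_on UNIV \<Psi>" using smooth_gradient[OF \<psi>(1)] by blast
  have supp\<psi>: "closure {x. \<psi> (z - x) \<noteq> 0} \<subseteq> cball z d" for z
  proof (rule closure_minimal)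
    show "{x. \<psi> (z - x) \<noteq> 0} \<subseteq> cball z d" using \<psi>(2) by (force simp: dist_norm not_le[symmetric])
  qed simp
  have test\<psi>: "test_function S' (\<lambda>y. \<psi> (z - y))" if "cball z d \<subseteq> S'" for z S'
    unfolding test_function_def
  proof (intro conjI)
    show "smooth (\<lambda>y. \<psi> (z - y))" using smooth_affine[OF \<psi>(1), of 1 z "-1"] by simp
    have "bounded (closure {x. \<psi> (z - x) \<noteq> 0})" by (rule bounded_subset[OF bounded_cball supp\<psi>])
    then show "compact (closure {x. \<psi> (z - x) \<noteq> 0})" by (simp add: compact_eq_bounded_closed)
    show "closure {x. \<psi> (z - x) \<noteq> 0} \<subseteq> S'" using supp\<psi>[of z] that by blast
  qed
  have grad\<psi>: "GDERIV (\<lambda>y. \<psi> (z - y)) y :> - \<Psi> (z - y)" for z y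
  proof -
    have "((\<lambda>y. z - y) has_derivative (\<lambda>h. - h)) (at y)" by (auto intro!: derivative_eq_intros)
    moreover have "(\<psi> has_derivative (\<lambda>h. h \<bullet> \<Psi> (z - y))) (at (z - y))" using \<Psi>(1) by (simp add: gderiv_def)
    ultimately have "((\<lambda>y. \<psi> (z - y)) has_derivative (\<lambda>h. (- h) \<bullet> \<Psi> (z - y))) (at y)"
      by (rule has_derivative_compose)
    then show ?thesis by (simp add: gderiv_def)
  qed
  obtain L' where L': "\<And>x. \<bar>\<psi> (0 - x)\<bar> \<le> L'" "\<And>x. norm (- \<Psi> (0 - x)) \<le> L'"
    "\<And>x y. \<bar>\<psi> (0 - x) - \<psi> (0 - y)\<bar> \<le> L' * norm (x - y)" "0 \<le> L'"
  proof -
    have t: "test_function UNIV (\<lambda>y. \<psi> (0 - y))" by (rule test\<psi>) simp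
    show ?thesis by (rule test_function_gradient[OF t grad\<psi>]) (rule that, assumption+)
  qed
  have \<psi>B: "\<bar>\<psi> x\<bar> \<le> L'" "norm (\<Psi> x) \<le> L'" "\<bar>\<psi> x - \<psi> y\<bar> \<le> L' * norm (x - y)" for x y
    using L'(1)[of "- x"] L'(2)[of "- x"] L'(3)[of "- x" "- y"] by (simp_all add: norm_minus_commute)
  have cont\<psi>: "continuous_on UNIV \<psi>"
    using \<Psi>(1) unfolding gderiv_def
    by (intro continuous_at_imp_continuous_on ballI) (rule has_derivative_continuous)
  have [measurable]: "\<psi> \<in> borel_measurable borel" "\<Psi> \<in> borel_measurable borel" "\<Phi> \<in> borel_measurable borel" "\<phi> \<in> borel_measurable borel"
    using cont\<psi> \<Psi>(2) L by (auto intro: borel_measurable_continuous_onI)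
  have [measurable]: "f \<in> borel_measurable borel" "F \<in> borel_measurable borel"
    using f F by (auto dest: borel_measurable_integrable)
  define f1 where "f1 = mollify \<psi> f"
  define F1 where "F1 = mollify \<psi> (\<lambda>y. F y \<bullet> e)"
  define D1 where "D1 x = (LINT y|lborel. f y * (\<Psi> (x - y) \<bullet> e))" for x
  have D1: "D1 x = F1 x" if x: "\<phi> x \<noteq> 0" for x
  proof -
    have int1: "integrable lborel (\<lambda>y. f y *\<^sub>R (- \<Psi> (x - y)))"
    proof (rule Bochner_Integration.integrable_bound)
      show "integrable lborel (\<lambda>y. L' * f y)" using f by simp
      show "AE y in lborel. norm (f y *\<^sub>R - \<Psi> (x - y)) \<le> norm (L' * f y)"
        using \<psi>B(2) L'(4) by (intro AE_I2) (simp add: abs_mult mult.commute[of L'] mult_left_mono)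
    qed simp
    have int2: "integrable lborel (\<lambda>y. \<psi> (x - y) *\<^sub>R F y)"
    proof (rule Bochner_Integration.integrable_bound)
      show "integrable lborel (\<lambda>y. L' *\<^sub>R F y)" using F by simp
      show "AE y in lborel. norm (\<psi> (x - y) *\<^sub>R F y) \<le> norm (L' *\<^sub>R F y)"
        using \<psi>B(1) L'(4) by (intro AE_I2) (auto intro!: mult_right_mono)
    qed simp
    have "D1 x = - ((LINT y|lborel. f y *\<^sub>R (- \<Psi> (x - y))) \<bullet> e)"
      unfolding D1_def integral_inner_left[OF int1, symmetric] by simp
    also have "\<dots> = (LINT y|lborel. \<psi> (x - y) *\<^sub>R F y) \<bullet> e"
      by (subst weak[OF test\<psi>[OF d[OF x]] grad\<psi>]) simp
    also have "\<dots> = F1 x"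
      unfolding F1_def mollify_def integral_inner_left[OF int2, symmetric] by (simp add: mult.commute)
    finally show ?thesis .
  qed
  define L1 where "L1 = (LINT x|lborel. \<bar>f x\<bar>) * L'"
  have f1_lip: "\<bar>f1 a - f1 b\<bar> \<le> L1 * norm (a - b)" for a b
    unfolding f1_def L1_def by (rule mollify_lipschitz[OF f _ \<psi>B(1,3)]) simp
  have T_lip: "\<bar>T a - T b\<bar> \<le> M * \<bar>a - b\<bar>" for a b
    using field_differentiable_bound[of UNIV T T' M a b] T by (auto intro: DERIV_subset)
  have M0: "0 \<le> M" and B0: "0 \<le> B" using T(2,3)[of 0] by linarith+
  define g where "g x = T (f1 x) * \<phi> x" for x
  define g' where "g' x = T' (f1 x) * F1 x * \<phi> x + T (f1 x) * (\<Phi> x \<bullet> e)" for x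
  have g_lip: "\<bar>g x - g y\<bar> \<le> (M * L1 * L + B * L) * norm (x - y)" for x y
  proof -
    have "g x - g y = (T (f1 x) - T (f1 y)) * \<phi> x + T (f1 y) * (\<phi> x - \<phi> y)"
      by (simp add: g_def algebra_simps)
    then have "\<bar>g x - g y\<bar> \<le> \<bar>T (f1 x) - T (f1 y)\<bar> * \<bar>\<phi> x\<bar> + \<bar>T (f1 y)\<bar> * \<bar>\<phi> x - \<phi> y\<bar>"
      using abs_triangle_ineq[of "(T (f1 x) - T (f1 y)) * \<phi> x" "T (f1 y) * (\<phi> x - \<phi> y)"] by (simp add: abs_mult)
    also have "\<dots> \<le> (M * (L1 * norm (x - y))) * L + B * (L * norm (x - y))"
    proof (intro add_mono mult_mono)
      have "\<bar>T (f1 x) - T (f1 y)\<bar> \<le> M * \<bar>f1 x - f1 y\<bar>" by (rule T_lip)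
      also have "\<dots> \<le> M * (L1 * norm (x - y))" by (intro mult_left_mono f1_lip M0)
      finally show *: "\<bar>T (f1 x) - T (f1 y)\<bar> \<le> M * (L1 * norm (x - y))" .
      show "0 \<le> M * (L1 * norm (x - y))" using * by linarith
    qed (use L T B0 in auto)
    finally show ?thesis by (simp add: algebra_simps)
  qed
  have g_bound: "\<bar>g x\<bar> \<le> B * L" for x
    unfolding g_def abs_mult by (intro mult_mono T L B0) auto
  have g_deriv: "((\<lambda>t. g (x + t *\<^sub>R e)) has_real_derivative g' x) (at 0)" for x
  proof -
    have "((\<lambda>t. f1 (x + t *\<^sub>R e)) has_real_derivative D1 x) (at 0)"
      unfolding f1_def D1_def by (rule mollify_directional_derivative[OF f _ \<psi>B(1,3) \<Psi>(1)]) simp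
    moreover have "(T has_real_derivative T' (f1 x)) (at (f1 (x + 0 *\<^sub>R e)))" using T(1) by simp
    ultimately have "((\<lambda>t. T (f1 (x + t *\<^sub>R e))) has_real_derivative T' (f1 x) * D1 x) (at 0)"
      by (rule DERIV_chain2[rotated])
    from DERIV_mult[OF this GDERIV_directional[OF \<phi>(2), of x e]]
    have "((\<lambda>t. g (x + t *\<^sub>R e)) has_real_derivative T' (f1 x) * D1 x * \<phi> x + (\<Phi> x \<bullet> e) * T (f1 x)) (at 0)"
      by (simp add: g_def)
    moreover have "D1 x * \<phi> x = F1 x * \<phi> x" using D1 by (cases "\<phi> x = 0") auto
    ultimately show ?thesis by (cases "\<phi> x = 0") (auto simp: g'_def mult_ac)
  qed
  have g0: "x \<notin> K \<Longrightarrow> g x = 0" for x using L by (simp add: g_def)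
  note int = integral_directional_derivative_eq_0[OF g_lip g_bound K(1) g0 g_deriv]
  have "continuous_on UNIV f1"
    by (rule lipschitz_on_continuous_on[of "\<bar>L1\<bar>"], rule lipschitz_onI)
      (use f1_lip in \<open>auto simp: dist_norm intro!: order_trans[OF f1_lip] mult_right_mono\<close>)
  moreover have "continuous_on UNIV T"
    by (intro continuous_at_imp_continuous_on ballI DERIV_isCont) (rule T)
  ultimately have [measurable]: "f1 \<in> borel_measurable borel" "T \<in> borel_measurable borel"
    by (auto intro: borel_measurable_continuous_onI)
  have intT: "integrable lborel (\<lambda>x. T (f1 x) * (\<Phi> x \<bullet> e))"
  proof (rule Bochner_Integration.integrable_bound)
    have [measurable]: "K \<in> sets borel" using compact_imp_closed[OF K(2)] by (rule borel_closed)
    show "integrable lborel (\<lambda>x. (B * (L * norm e)) * indicat_real K x)"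
      using emeasure_bounded_finite[OF K(1)] by auto
    have "\<bar>T (f1 x) * (\<Phi> x \<bullet> e)\<bar> \<le> (B * (L * norm e)) * indicat_real K x" for x
    proof (cases "x \<in> K")
      case True
      have "\<bar>\<Phi> x \<bullet> e\<bar> \<le> L * norm e"
        using Cauchy_Schwarz_ineq2[of "\<Phi> x" e] mult_right_mono[OF L(6)[of x], of "norm e"] by simp
      then have "\<bar>T (f1 x)\<bar> * \<bar>\<Phi> x \<bullet> e\<bar> \<le> B * (L * norm e)" by (intro mult_mono T B0) auto
      then show ?thesis using True by (simp add: abs_mult)
    qed (simp add: L)
    then show "AE x in lborel. norm (T (f1 x) * (\<Phi> x \<bullet> e)) \<le> norm ((B * (L * norm e)) * indicat_real K x)"
      by (intro AE_I2) (metis abs_ge_self order_trans real_norm_def)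
  qed measurable
  have "(\<lambda>x. g' x - T (f1 x) * (\<Phi> x \<bullet> e)) = (\<lambda>x. T' (f1 x) * F1 x * \<phi> x)" by (simp add: g'_def)
  then have "?rhs = (LINT x|lborel. g' x - T (f1 x) * (\<Phi> x \<bullet> e))" by (simp add: f1_def F1_def)
  also have "\<dots> = - ?lhs" using int intT by (simp add: f1_def)
  finally show ?thesis by simp
qed

text \<open>
  The identity for mollifications passes to the limit. The weak gradients converge in \<open>L\<^sup>1\<close> and are
  multiplied by bounded factors; the functions converge almost everywhere along a subsequence, which
  suffices for \<open>T\<close> and \<open>T'\<close> because they are continuous and bounded.
\<close>

lemma chain_rule_weak:
  fixes f :: "real^'n \<Rightarrow> real" and F :: "real^'n \<Rightarrow> real^'n"
  assumes S: "open S" and f: "integrable lborel f" and F: "integrable lborel F"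
    and weak: "\<And>\<phi> \<Phi>. test_function S \<phi> \<Longrightarrow> (\<And>x. GDERIV \<phi> x :> \<Phi> x) \<Longrightarrow>
      (LINT x|lborel. f x *\<^sub>R \<Phi> x) = - (LINT x|lborel. \<phi> x *\<^sub>R F x)"
    and T: "\<And>r. (T has_real_derivative T' r) (at r)" "\<And>r. \<bar>T' r\<bar> \<le> M" "\<And>r. \<bar>T r\<bar> \<le> B" 
    and T': "continuous_on UNIV T'"
    and \<phi>: "test_function S \<phi>" "\<And>x. GDERIV \<phi> x :> \<Phi> x"
  shows "(LINT x|lborel. T (f x) *\<^sub>R \<Phi> x) = - (LINT x|lborel. \<phi> x *\<^sub>R (T' (f x) *\<^sub>R F x))"
proof -
  define K where "K = closure {x. \<phi> x \<noteq> 0}"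
  have K: "bounded K" "compact K" "K \<subseteq> S" using \<phi>(1) by (auto simp: test_function_def K_def compact_imp_bounded)
  have [measurable]: "K \<in> sets borel" using compact_imp_closed[OF K(2)] by (rule borel_closed)
  obtain L where L: "continuous_on UNIV \<phi>" "continuous_on UNIV \<Phi>" "\<And>x. x \<notin> K \<Longrightarrow> \<phi> x = 0" "\<And>x. x \<notin> K \<Longrightarrow> \<Phi> x = 0"
    "\<And>x. \<bar>\<phi> x\<bar> \<le> L" "\<And>x. norm (\<Phi> x) \<le> L" "\<And>x y. \<bar>\<phi> x - \<phi> y\<bar> \<le> L * norm (x - y)" "0 \<le> L"
    using test_function_gradient[OF \<phi>] unfolding K_def by blast
  have M0: "0 \<le> M" and B0: "0 \<le> B" using T(2,3)[of 0] by linarith+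
  have contT: "continuous_on UNIV T"
    by (intro continuous_at_imp_continuous_on ballI DERIV_isCont) (rule T)
  then have [measurable]: "T \<in> borel_measurable borel" "T' \<in> borel_measurable borel" "\<phi> \<in> borel_measurable borel" "\<Phi> \<in> borel_measurable borel"
    using T' L by (auto intro: borel_measurable_continuous_onI)
  have [measurable]: "f \<in> borel_measurable borel" "F \<in> borel_measurable borel"
    using f F by (auto dest: borel_measurable_integrable)
  have intK: "integrable lborel (\<lambda>x. c * indicat_real K x)" for c
    using emeasure_bounded_finite[OF K(1)] by auto
  have boundT: "norm (T r *\<^sub>R \<Phi> x) \<le> (B * L) * indicat_real K x" for r x
    using L T B0 by (cases "x \<in> K") (auto intro!: mult_mono)
  have intT: "integrable lborel (\<lambda>x. T (f x) *\<^sub>R \<Phi> x)"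
  proof (rule Bochner_Integration.integrable_bound[OF intK[of "B * L"]])
    show "AE x in lborel. norm (T (f x) *\<^sub>R \<Phi> x) \<le> norm ((B * L) * indicat_real K x)"
      using boundT by (intro AE_I2) (metis abs_ge_self order_trans real_norm_def)
  qed measurable
  have boundT': "\<bar>\<phi> x * T' r\<bar> \<le> L * M" for r x
    unfolding abs_mult using L T M0 by (intro mult_mono) auto
  have intT': "integrable lborel (\<lambda>x. \<phi> x *\<^sub>R (T' (f x) *\<^sub>R F x))"
  proof (rule Bochner_Integration.integrable_bound)
    show "integrable lborel (\<lambda>x. (L * M) *\<^sub>R F x)" using F by simp
    show "AE x in lborel. norm (\<phi> x *\<^sub>R (T' (f x) *\<^sub>R F x)) \<le> norm ((L * M) *\<^sub>R F x)"
    proof (rule AE_I2)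
      fix x
      have "\<bar>\<phi> x * T' (f x)\<bar> * norm (F x) \<le> (L * M) * norm (F x)" by (intro mult_right_mono boundT') simp
      then show "norm (\<phi> x *\<^sub>R (T' (f x) *\<^sub>R F x)) \<le> norm ((L * M) *\<^sub>R F x)" using L M0 by (simp add: abs_mult)
    qed
  qed measurable
  obtain d where d: "d > 0" "(\<Union>x\<in>K. cball x d) \<subseteq> S"
    using compact_subset_open_imp_cball_epsilon_subset[OF K(2) S K(3)] by blast
  have "(LINT x|lborel. T (f x) *\<^sub>R \<Phi> x) \<bullet> e = - (LINT x|lborel. \<phi> x *\<^sub>R (T' (f x) *\<^sub>R F x)) \<bullet> e" for e
  proof -
    have Fe: "integrable lborel (\<lambda>x. F x \<bullet> e)" using F by simp
    define good where "good k \<psi> \<longleftrightarrow> smooth \<psi> \<and> (\<forall>x. norm x > d \<longrightarrow> \<psi> x = 0)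
        \<and> integrable lborel (mollify \<psi> f) \<and> (LINT x|lborel. \<bar>mollify \<psi> f x - f x\<bar>) \<le> inverse (real (Suc k))
        \<and> integrable lborel (mollify \<psi> (\<lambda>x. F x \<bullet> e)) \<and> (LINT x|lborel. \<bar>mollify \<psi> (\<lambda>x. F x \<bullet> e) x - F x \<bullet> e\<bar>) \<le> inverse (real (Suc k))"
      for k and \<psi> :: "real^'n \<Rightarrow> real"
    have "\<exists>\<psi>. good k \<psi>" for k
    proof -
      define \<epsilon> where "\<epsilon> = inverse (real (Suc k))"
      have \<epsilon>: "\<epsilon> > 0" by (simp add: \<epsilon>_def)
      have "eventually (\<lambda>z. (LINT x|lborel. \<bar>f (z + x) - f x\<bar>) < \<epsilon> \<and> (LINT x|lborel. \<bar>F (z + x) \<bullet> e - F x \<bullet> e\<bar>) < \<epsilon>) (at 0)"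
        using order_tendstoD(2)[OF translation_continuous_L1[OF f] \<epsilon>] order_tendstoD(2)[OF translation_continuous_L1[OF Fe] \<epsilon>]
        by (rule eventually_conj)
      then obtain \<delta> where \<delta>: "\<delta> > 0" "\<And>z. z \<noteq> 0 \<Longrightarrow> norm z < \<delta> \<Longrightarrow>
         (LINT x|lborel. \<bar>f (z + x) - f x\<bar>) < \<epsilon> \<and> (LINT x|lborel. \<bar>F (z + x) \<bullet> e - F x \<bullet> e\<bar>) < \<epsilon>"
        unfolding eventually_at by (auto simp: dist_norm)
      define r where "r = min d (\<delta> / 2)"
      have r: "r > 0" "r \<le> d" "r < \<delta>" using d \<delta>(1) by (auto simp: r_def)
      have small: "(LINT x|lborel. \<bar>f (z + x) - f x\<bar>) \<le> \<epsilon>" "(LINT x|lborel. \<bar>F (z + x) \<bullet> e - F x \<bullet> e\<bar>) \<le> \<epsilon>" if "norm z \<le> r" for z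
        using \<delta>(2)[of z] that r \<epsilon> by (cases "z = 0"; force)+
      obtain \<psi> :: "real^'n \<Rightarrow> real" where \<psi>: "smooth \<psi>" "\<And>x. 0 \<le> \<psi> x" "\<And>x. norm x > r \<Longrightarrow> \<psi> x = 0"
        "integrable lborel \<psi>" "(LINT x|lborel. \<psi> x) = 1" using mollifier_exists[OF r(1)] by blast
      obtain C where C: "\<And>x. \<psi> x \<le> C"
      proof -
        have "test_function UNIV \<psi>" unfolding test_function_def
        proof (intro conjI \<psi>)
          have "closure {x. \<psi> x \<noteq> 0} \<subseteq> cball 0 r"
            by (rule closure_minimal) (use \<psi>(3) in \<open>force simp: not_le[symmetric]\<close>)+
          then show "compact (closure {x. \<psi> x \<noteq> 0})"
            using bounded_subset[OF bounded_cball] by (auto simp: compact_eq_bounded_closed)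
        qed simp
        moreover obtain \<Psi> where "\<And>x. GDERIV \<psi> x :> \<Psi> x" using smooth_gradient[OF \<psi>(1)] by blast
        ultimately show ?thesis using test_function_gradient that by (metis abs_le_iff)
      qed
      have m: "integrable lborel (mollify \<psi> h)" "(LINT x|lborel. \<bar>mollify \<psi> h x - h x\<bar>) \<le> \<epsilon>"
        if "integrable lborel h" "\<And>z. norm z \<le> r \<Longrightarrow> (LINT x|lborel. \<bar>h (z + x) - h x\<bar>) \<le> \<epsilon>" for h
        by (rule mollify_L1[where B=C and d=r and e=\<epsilon>]; use that \<psi> C \<epsilon> in auto)+
      show ?thesis unfolding good_def \<epsilon>_def[symmetric]
        using m[OF f small(1)] m[OF Fe small(2)] \<psi>(1,3) r(2) by (intro exI[of _ \<psi>]) auto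
    qed
    then obtain \<psi> where "\<And>k. good k (\<psi> k)" by metis
    then have \<psi>: "smooth (\<psi> k)" "norm x > d \<Longrightarrow> \<psi> k x = 0"
      "integrable lborel (mollify (\<psi> k) f)" "(LINT x|lborel. \<bar>mollify (\<psi> k) f x - f x\<bar>) \<le> inverse (real (Suc k))"
      "integrable lborel (mollify (\<psi> k) (\<lambda>x. F x \<bullet> e))"
      "(LINT x|lborel. \<bar>mollify (\<psi> k) (\<lambda>x. F x \<bullet> e) x - F x \<bullet> e\<bar>) \<le> inverse (real (Suc k))"
      for k x unfolding good_def by blast+
    define fk where "fk k = mollify (\<psi> k) f" for k
    define Fk where "Fk k = mollify (\<psi> k) (\<lambda>x. F x \<bullet> e)" for k
    have fk: "integrable lborel (fk k)" and Fk: "integrable lborel (Fk k)" for k using \<psi> by (auto simp: fk_def Fk_def)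
    then have [measurable]: "fk k \<in> borel_measurable borel" "Fk k \<in> borel_measurable borel" for k
      by (auto dest: borel_measurable_integrable)
    have fk_lim: "(\<lambda>k. LINT x|lborel. \<bar>fk k x - f x\<bar>) \<longlonglongrightarrow> 0"
      by (rule tendsto_sandwich[OF _ _ tendsto_const LIMSEQ_inverse_real_of_nat])
         (auto simp: fk_def intro!: always_eventually \<psi> Bochner_Integration.integral_nonneg simp del: of_nat_Suc)
    have Fk_lim: "(\<lambda>k. LINT x|lborel. \<bar>Fk k x - F x \<bullet> e\<bar>) \<longlonglongrightarrow> 0"
      by (rule tendsto_sandwich[OF _ _ tendsto_const LIMSEQ_inverse_real_of_nat])
         (auto simp: Fk_def intro!: always_eventually \<psi> Bochner_Integration.integral_nonneg simp del: of_nat_Suc)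
    have "\<exists>r::nat \<Rightarrow> nat. strict_mono r \<and> (AE x in lborel. (\<lambda>k. fk (r k) x - f x) \<longlonglongrightarrow> 0)"
      by (rule tendsto_L1_AE_subseq) (use fk f fk_lim in auto)
    then obtain r where r: "strict_mono r" "AE x in lborel. (\<lambda>k. fk (r k) x - f x) \<longlonglongrightarrow> 0" by blast
    have ae: "AE x in lborel. (\<lambda>k. fk (r k) x) \<longlonglongrightarrow> f x" using r(2) by eventually_elim (simp add: LIM_zero_iff)
    have id: "(LINT x|lborel. T (fk k x) * (\<Phi> x \<bullet> e)) = - (LINT x|lborel. T' (fk k x) * Fk k x * \<phi> x)" for k
      unfolding fk_def Fk_def
      by (rule chain_rule_mollified[OF f F weak T \<phi> \<psi>(1,2)]) (use d L(3) in auto)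
    have lim1: "(\<lambda>k. LINT x|lborel. T (fk (r k) x) * (\<Phi> x \<bullet> e)) \<longlonglongrightarrow> (LINT x|lborel. T (f x) * (\<Phi> x \<bullet> e))"
    proof (rule integral_dominated_convergence[OF _ _ intK[of "B * L * norm e"]])
      show "AE x in lborel. (\<lambda>k. T (fk (r k) x) * (\<Phi> x \<bullet> e)) \<longlonglongrightarrow> T (f x) * (\<Phi> x \<bullet> e)"
        using ae
      proof eventually_elim
        case (elim x)
        have "isCont T (f x)" by (rule DERIV_isCont[OF T(1)])
        from isCont_tendsto_compose[OF this elim] show ?case by (intro tendsto_intros)
      qed
      show "AE x in lborel. norm (T (fk (r k) x) * (\<Phi> x \<bullet> e)) \<le> B * L * norm e * indicat_real K x" for k
      proof (rule AE_I2)
        fix x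
        have "norm (T (fk (r k) x) * (\<Phi> x \<bullet> e)) \<le> norm (T (fk (r k) x) *\<^sub>R \<Phi> x) * norm e"
          using Cauchy_Schwarz_ineq2[of "T (fk (r k) x) *\<^sub>R \<Phi> x" e] by simp
        also have "\<dots> \<le> (B * L * indicat_real K x) * norm e" by (intro mult_right_mono boundT) simp
        finally show "norm (T (fk (r k) x) * (\<Phi> x \<bullet> e)) \<le> B * L * norm e * indicat_real K x" by (simp add: mult_ac)
      qed
    qed measurable
    have lim2: "(\<lambda>k. LINT x|lborel. (\<phi> x * T' (fk (r k) x)) * (F x \<bullet> e)) \<longlonglongrightarrow> (LINT x|lborel. (\<phi> x * T' (f x)) * (F x \<bullet> e))"
    proof (rule integral_dominated_convergence[where w="\<lambda>x. (L * M) * \<bar>F x \<bullet> e\<bar>"])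
      show "AE x in lborel. (\<lambda>k. \<phi> x * T' (fk (r k) x) * (F x \<bullet> e)) \<longlonglongrightarrow> \<phi> x * T' (f x) * (F x \<bullet> e)"
        using ae
      proof eventually_elim
        case (elim x)
        have "isCont T' (f x)" using T' by (simp add: continuous_on_eq_continuous_at)
        from isCont_tendsto_compose[OF this elim] show ?case by (intro tendsto_intros)
      qed
      show "AE x in lborel. norm (\<phi> x * T' (fk (r k) x) * (F x \<bullet> e)) \<le> (L * M) * \<bar>F x \<bullet> e\<bar>" for k
      proof (rule AE_I2)
        fix x
        have "\<bar>\<phi> x * T' (fk (r k) x)\<bar> * \<bar>F x \<bullet> e\<bar> \<le> (L * M) * \<bar>F x \<bullet> e\<bar>" by (intro mult_right_mono boundT') simp
        then show "norm (\<phi> x * T' (fk (r k) x) * (F x \<bullet> e)) \<le> (L * M) * \<bar>F x \<bullet> e\<bar>" by (simp add: abs_mult)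
      qed
      show "integrable lborel (\<lambda>x. (L * M) * \<bar>F x \<bullet> e\<bar>)" using Fe by simp
    qed measurable
    have lim3: "(\<lambda>k. LINT x|lborel. (Fk (r k) x - F x \<bullet> e) * (\<phi> x * T' (fk (r k) x))) \<longlonglongrightarrow> 0"
    proof (rule Lim_null_comparison)
      show "(\<lambda>k. (L * M) * (LINT x|lborel. \<bar>Fk (r k) x - F x \<bullet> e\<bar>)) \<longlonglongrightarrow> 0"
        using tendsto_mult_right_zero[OF LIMSEQ_subseq_LIMSEQ[OF Fk_lim r(1)]] by (simp add: o_def)
      show "eventually (\<lambda>k. norm (LINT x|lborel. (Fk (r k) x - F x \<bullet> e) * (\<phi> x * T' (fk (r k) x))) \<le> (L * M) * (LINT x|lborel. \<bar>Fk (r k) x - F x \<bullet> e\<bar>)) sequentially"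
      proof (intro always_eventually allI)
        fix k
        have i: "integrable lborel (\<lambda>x. (Fk (r k) x - F x \<bullet> e) * (\<phi> x * T' (fk (r k) x)))"
          by (rule integrable_mult_bounded[OF _ _ boundT']) (use Fk Fe in auto)
        have "norm (LINT x|lborel. (Fk (r k) x - F x \<bullet> e) * (\<phi> x * T' (fk (r k) x))) \<le> (LINT x|lborel. \<bar>(Fk (r k) x - F x \<bullet> e) * (\<phi> x * T' (fk (r k) x))\<bar>)"
          using integral_norm_bound[of lborel "\<lambda>x. (Fk (r k) x - F x \<bullet> e) * (\<phi> x * T' (fk (r k) x))"] by simp
        also have "\<dots> \<le> (LINT x|lborel. (L * M) * \<bar>Fk (r k) x - F x \<bullet> e\<bar>)"
        proof (intro integral_mono)
          show "\<bar>(Fk (r k) x - F x \<bullet> e) * (\<phi> x * T' (fk (r k) x))\<bar> \<le> (L * M) * \<bar>Fk (r k) x - F x \<bullet> e\<bar>" for x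
            using mult_right_mono[OF boundT'[of x "fk (r k) x"], of "\<bar>Fk (r k) x - F x \<bullet> e\<bar>"]
            by (simp only: abs_mult mult_ac abs_ge_zero)
          show "integrable lborel (\<lambda>x. \<bar>(Fk (r k) x - F x \<bullet> e) * (\<phi> x * T' (fk (r k) x))\<bar>)" using i by (rule integrable_abs)
          show "integrable lborel (\<lambda>x. (L * M) * \<bar>Fk (r k) x - F x \<bullet> e\<bar>)" using Fk Fe by simp
        qed
        finally show "norm (LINT x|lborel. (Fk (r k) x - F x \<bullet> e) * (\<phi> x * T' (fk (r k) x))) \<le> (L * M) * (LINT x|lborel. \<bar>Fk (r k) x - F x \<bullet> e\<bar>)"
          by simp
      qed
    qed
    have split: "(LINT x|lborel. T' (fk k x) * Fk k x * \<phi> x) =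
       (LINT x|lborel. (Fk k x - F x \<bullet> e) * (\<phi> x * T' (fk k x))) + (LINT x|lborel. (\<phi> x * T' (fk k x)) * (F x \<bullet> e))" for k
    proof -
      have i1: "integrable lborel (\<lambda>x. (Fk k x - F x \<bullet> e) * (\<phi> x * T' (fk k x)))"
        by (rule integrable_mult_bounded[OF _ _ boundT']) (use Fk Fe in auto)
      have i2: "integrable lborel (\<lambda>x. (F x \<bullet> e) * (\<phi> x * T' (fk k x)))"
        by (rule integrable_mult_bounded[OF Fe _ boundT']) measurable
      have "(LINT x|lborel. T' (fk k x) * Fk k x * \<phi> x) = (LINT x|lborel. (Fk k x - F x \<bullet> e) * (\<phi> x * T' (fk k x)) + (F x \<bullet> e) * (\<phi> x * T' (fk k x)))"
        by (intro Bochner_Integration.integral_cong) (auto simp: algebra_simps)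
      then show ?thesis using i1 i2 by (simp add: mult.commute)
    qed
    have "(\<lambda>k. LINT x|lborel. T' (fk (r k) x) * Fk (r k) x * \<phi> x) \<longlonglongrightarrow> 0 + (LINT x|lborel. (\<phi> x * T' (f x)) * (F x \<bullet> e))"
      unfolding split by (intro tendsto_add lim2 lim3)
    from tendsto_minus[OF this] have "(\<lambda>k. LINT x|lborel. T (fk (r k) x) * (\<Phi> x \<bullet> e)) \<longlonglongrightarrow> - (LINT x|lborel. (\<phi> x * T' (f x)) * (F x \<bullet> e))"
      by (simp add: id)
    with lim1 have "(LINT x|lborel. T (f x) * (\<Phi> x \<bullet> e)) = - (LINT x|lborel. (\<phi> x * T' (f x)) * (F x \<bullet> e))"
      by (rule LIMSEQ_unique)
    moreover have "(LINT x|lborel. T (f x) *\<^sub>R \<Phi> x) \<bullet> e = (LINT x|lborel. T (f x) * (\<Phi> x \<bullet> e))"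
      unfolding integral_inner_left[OF intT, symmetric] by simp
    moreover have "(LINT x|lborel. \<phi> x *\<^sub>R (T' (f x) *\<^sub>R F x)) \<bullet> e = (LINT x|lborel. (\<phi> x * T' (f x)) * (F x \<bullet> e))"
      unfolding integral_inner_left[OF intT', symmetric] by (simp add: mult.assoc)
    ultimately show ?thesis by simp
  qed
  then have "\<forall>e. (LINT x|lborel. T (f x) *\<^sub>R \<Phi> x) \<bullet> e = (- (LINT x|lborel. \<phi> x *\<^sub>R (T' (f x) *\<^sub>R F x))) \<bullet> e" ..
  then show ?thesis by (rule vector_eq_rdot[THEN iffD1])
qed

section \<open>Sobolev functions on bounded open sets\<close>

lemma set_integrable_Lp_on:
  fixes f :: "real^'n \<Rightarrow> 'b::euclidean_space"
  assumes S: "open S" "bounded S" and p: "1 \<le> p" and f: "Lp_on p S f"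
  shows "set_integrable lborel S f"
  unfolding set_integrable_def
proof (rule Bochner_Integration.integrable_bound)
  have [measurable]: "S \<in> sets borel" using S by simp
  have "integrable lborel (indicat_real S)" using emeasure_bounded_finite[OF S(2)] by auto
  then show "integrable lborel (\<lambda>x. indicat_real S x + indicat_real S x *\<^sub>R (norm (f x) powr p))"
    using f unfolding Lp_on_def set_integrable_def by auto
  have "r \<le> 1 + r powr p" if "0 \<le> r" for r :: real
  proof (cases "r \<le> 1")
    case False
    then have "r powr 1 \<le> r powr p" using p by (intro powr_mono) auto
    then show ?thesis using False by simp
  qed (use powr_ge_zero[of r p] in linarith)
  then have "norm (indicator S x *\<^sub>R f x) \<le> norm (indicat_real S x + indicat_real S x *\<^sub>R (norm (f x) powr p))" for x
    by (simp add: indicator_def)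
  then show "AE x in lborel. norm (indicator S x *\<^sub>R f x) \<le> norm (indicat_real S x + indicat_real S x *\<^sub>R (norm (f x) powr p))"
    by (intro AE_I2)
  show "(\<lambda>x. indicator S x *\<^sub>R f x) \<in> borel_measurable lborel"
    using f by (simp add: Lp_on_def set_borel_measurable_def)
qed

lemma Lp_on_bounded_by:
  fixes f :: "real^'n \<Rightarrow> 'b::euclidean_space"
  assumes p: "0 \<le> p" and f: "set_borel_measurable lborel S f" and w: "set_integrable lborel S w"
    and le: "\<And>x. x \<in> S \<Longrightarrow> norm (f x) powr p \<le> w x"
  shows "Lp_on p S f"
  unfolding Lp_on_def
proof (intro conjI f)
  have [measurable]: "(\<lambda>x. indicator S x *\<^sub>R f x) \<in> borel_measurable borel"
    using f by (simp add: set_borel_measurable_def)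
  show "set_integrable lborel S (\<lambda>x. norm (f x) powr p)"
    unfolding set_integrable_def
  proof (rule Bochner_Integration.integrable_bound[OF w[unfolded set_integrable_def]])
    show "AE x in lborel. norm (indicat_real S x *\<^sub>R (norm (f x) powr p)) \<le> norm (indicat_real S x *\<^sub>R w x)"
    proof (rule AE_I2)
      fix x show "norm (indicat_real S x *\<^sub>R (norm (f x) powr p)) \<le> norm (indicat_real S x *\<^sub>R w x)"
        using le[of x] by (auto simp: indicator_def)
    qed
    have "(\<lambda>x. indicat_real S x *\<^sub>R (norm (f x) powr p)) = (\<lambda>x. norm (indicat_real S x *\<^sub>R f x) powr p)"
      by (auto simp: indicator_def)
    also have "\<dots> \<in> borel_measurable lborel" by measurable
    finally show "(\<lambda>x. indicat_real S x *\<^sub>R (norm (f x) powr p)) \<in> borel_measurable lborel" .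
  qed
qed

lemma Lp_on_diff:
  fixes f h :: "real^'n \<Rightarrow> 'b::euclidean_space"
  assumes p: "0 \<le> p" and f: "Lp_on p S f" and h: "Lp_on p S h"
  shows "Lp_on p S (\<lambda>x. f x - h x)"
proof (rule Lp_on_bounded_by[OF p])
  show "set_borel_measurable lborel S (\<lambda>x. f x - h x)"
    using f h by (auto simp: Lp_on_def set_borel_measurable_def scaleR_diff_right intro!: borel_measurable_diff)
  show "set_integrable lborel S (\<lambda>x. 2 powr p * (norm (f x) powr p + norm (h x) powr p))"
    using f h unfolding Lp_on_def by (intro set_integrable_mult_right set_integral_add) auto
  show "norm (f x - h x) powr p \<le> 2 powr p * (norm (f x) powr p + norm (h x) powr p)" for x
  proof -
    define m where "m = max (norm (f x)) (norm (h x))"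
    have "norm (f x - h x) \<le> 2 * m" using norm_triangle_ineq4[of "f x" "h x"] by (simp add: m_def)
    then have "norm (f x - h x) powr p \<le> (2 * m) powr p" using p by (intro powr_mono2) auto
    also have "\<dots> = 2 powr p * m powr p" by (intro powr_mult)
    also have "m powr p \<le> norm (f x) powr p + norm (h x) powr p" by (simp add: m_def max_def)
    finally show ?thesis by simp
  qed
qed

lemma sobolev_gradient_diff:
  fixes f h :: "real^'n \<Rightarrow> real"
  assumes S: "open S" "bounded S" and p: "1 \<le> p"
    and f: "sobolev_gradient p S f F" and h: "sobolev_gradient p S h H"
  shows "sobolev_gradient p S (\<lambda>x. f x - h x) (\<lambda>x. F x - H x)"
  unfolding sobolev_gradient_def
proof (intro conjI allI impI)
  show "Lp_on p S (\<lambda>x. f x - h x)" "Lp_on p S (\<lambda>x. F x - H x)"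
    using f h p by (auto simp: sobolev_gradient_def intro!: Lp_on_diff)
  fix \<phi> \<Phi> assume "test_function S \<phi> \<and> (\<forall>x. GDERIV \<phi> x :> \<Phi> x)"
  then have \<phi>: "test_function S \<phi>" "\<And>x. GDERIV \<phi> x :> \<Phi> x" by auto
  obtain L where L: "continuous_on UNIV \<phi>" "continuous_on UNIV \<Phi>" "\<And>x. \<bar>\<phi> x\<bar> \<le> L" "\<And>x. norm (\<Phi> x) \<le> L" "0 \<le> L"
    by (rule test_function_gradient[OF \<phi>]) (rule that, assumption+)
  then have [measurable]: "\<phi> \<in> borel_measurable borel" "\<Phi> \<in> borel_measurable borel"
    by (auto intro: borel_measurable_continuous_onI)
  have int1: "set_integrable lborel S (\<lambda>x. k x *\<^sub>R \<Phi> x)" if "Lp_on p S k" for k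
    unfolding set_integrable_def
  proof (rule Bochner_Integration.integrable_bound)
    have k: "integrable lborel (\<lambda>x. indicator S x *\<^sub>R k x)"
      using set_integrable_Lp_on[OF S p that] by (simp add: set_integrable_def)
    then show "integrable lborel (\<lambda>x. L * (indicator S x *\<^sub>R k x))" by (rule integrable_mult_right)
    have "(\<lambda>x. indicat_real S x *\<^sub>R k x *\<^sub>R \<Phi> x) = (\<lambda>x. (indicat_real S x *\<^sub>R k x) *\<^sub>R \<Phi> x)" by simp
    also have "\<dots> \<in> borel_measurable lborel" using k by measurable
    finally show "(\<lambda>x. indicat_real S x *\<^sub>R k x *\<^sub>R \<Phi> x) \<in> borel_measurable lborel" .
    show "AE x in lborel. norm (indicat_real S x *\<^sub>R k x *\<^sub>R \<Phi> x) \<le> norm (L * (indicator S x *\<^sub>R k x))"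
    proof (rule AE_I2)
      fix x
      have "\<bar>k x\<bar> * norm (\<Phi> x) \<le> \<bar>k x\<bar> * L" by (intro mult_left_mono L) simp
      then show "norm (indicat_real S x *\<^sub>R k x *\<^sub>R \<Phi> x) \<le> norm (L * (indicator S x *\<^sub>R k x))"
        using L(5) by (simp add: indicator_def abs_mult mult.commute)
    qed
  qed
  have int2: "set_integrable lborel S (\<lambda>x. \<phi> x *\<^sub>R k x)" if "Lp_on p S k" for k :: "real^'n \<Rightarrow> real^'n"
    unfolding set_integrable_def
  proof (rule Bochner_Integration.integrable_bound)
    have k: "integrable lborel (\<lambda>x. indicator S x *\<^sub>R k x)"
      using set_integrable_Lp_on[OF S p that] by (simp add: set_integrable_def)
    then show "integrable lborel (\<lambda>x. L *\<^sub>R (indicator S x *\<^sub>R k x))" by (rule integrable_scaleR_right)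
    have "(\<lambda>x. indicat_real S x *\<^sub>R \<phi> x *\<^sub>R k x) = (\<lambda>x. \<phi> x *\<^sub>R (indicat_real S x *\<^sub>R k x))" by (simp add: mult.commute)
    also have "\<dots> \<in> borel_measurable lborel" using k by measurable
    finally show "(\<lambda>x. indicat_real S x *\<^sub>R \<phi> x *\<^sub>R k x) \<in> borel_measurable lborel" .
    show "AE x in lborel. norm (indicat_real S x *\<^sub>R \<phi> x *\<^sub>R k x) \<le> norm (L *\<^sub>R (indicator S x *\<^sub>R k x))"
    proof (rule AE_I2)
      fix x
      have "\<bar>\<phi> x\<bar> * norm (k x) \<le> L * norm (k x)" by (intro mult_right_mono L) simp
      then show "norm (indicat_real S x *\<^sub>R \<phi> x *\<^sub>R k x) \<le> norm (L *\<^sub>R (indicator S x *\<^sub>R k x))"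
        using L(5) by (simp add: indicator_def)
    qed
  qed
  have "(LINT x:S|lborel. (f x - h x) *\<^sub>R \<Phi> x) = (LINT x:S|lborel. f x *\<^sub>R \<Phi> x) - (LINT x:S|lborel. h x *\<^sub>R \<Phi> x)"
    unfolding scaleR_diff_left using f h by (intro set_integral_diff int1) (auto simp: sobolev_gradient_def)
  also have "\<dots> = - (LINT x:S|lborel. \<phi> x *\<^sub>R F x) + (LINT x:S|lborel. \<phi> x *\<^sub>R H x)"
  proof -
    have "(LINT x:S|lborel. k x *\<^sub>R \<Phi> x) = - (LINT x:S|lborel. \<phi> x *\<^sub>R K x)" if "sobolev_gradient p S k K" for k K
      using that \<phi> unfolding sobolev_gradient_def by blast
    from this[OF f] this[OF h] show ?thesis by simp
  qed
  also have "\<dots> = - (LINT x:S|lborel. \<phi> x *\<^sub>R (F x - H x))"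
    unfolding scaleR_diff_right using f h
    by (subst set_integral_diff(2)) (auto simp: sobolev_gradient_def intro!: int2)
  finally show "(LINT x:S|lborel. (f x - h x) *\<^sub>R \<Phi> x) = - (LINT x:S|lborel. \<phi> x *\<^sub>R (F x - H x))" .
qed

text \<open>
  The functions are extended by zero in order to apply the chain rule on the whole space: on a bounded
  set they are integrable, and test functions vanish outside \<open>S\<close>. Boundedness of \<open>T\<close> makes the
  composition an admissible test function for the weak \<open>p\<close>-Laplace equation.
\<close>

lemma sobolev_gradient_chain_rule:
  fixes f :: "real^'n \<Rightarrow> real"
  assumes S: "open S" "bounded S" and p: "1 \<le> p" and f: "sobolev_gradient p S f F"
    and T: "\<And>r. (T has_real_derivative T' r) (at r)" "\<And>r. \<bar>T' r\<bar> \<le> M" "\<And>r. \<bar>T r\<bar> \<le> B" 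
    and T': "continuous_on UNIV T'"
  shows "sobolev_gradient p S (\<lambda>x. T (f x)) (\<lambda>x. T' (f x) *\<^sub>R F x)" "(\<lambda>x. T (f x)) \<in> W1p_Linfty p S"
proof -
  have M0: "0 \<le> M" and B0: "0 \<le> B" using T(2,3)[of 0] by linarith+
  have [measurable]: "S \<in> sets borel" using S by simp
  have contT: "continuous_on UNIV T"
    by (intro continuous_at_imp_continuous_on ballI DERIV_isCont) (rule T)
  then have [measurable]: "T \<in> borel_measurable borel" "T' \<in> borel_measurable borel"
    using T' by (auto intro: borel_measurable_continuous_onI)
  define f0 where "f0 x = indicat_real S x *\<^sub>R f x" for x
  define F0 where "F0 x = indicat_real S x *\<^sub>R F x" for x
  have f0: "integrable lborel f0" and F0: "integrable lborel F0"
    using f set_integrable_Lp_on[OF S p, of f] set_integrable_Lp_on[OF S p, of F]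
    by (auto simp: sobolev_gradient_def set_integrable_def f0_def[abs_def] F0_def[abs_def])
  then have [measurable]: "f0 \<in> borel_measurable borel" "F0 \<in> borel_measurable borel"
    by (auto dest: borel_measurable_integrable)
  have mT: "set_borel_measurable lborel S (\<lambda>x. T (f x))"
  proof -
    have "(\<lambda>x. indicat_real S x *\<^sub>R T (f x)) = (\<lambda>x. indicat_real S x *\<^sub>R T (f0 x))"
      by (auto simp: indicator_def f0_def)
    then show ?thesis unfolding set_borel_measurable_def by simp
  qed
  have mT': "set_borel_measurable lborel S (\<lambda>x. T' (f x) *\<^sub>R F x)"
  proof -
    have "(\<lambda>x. indicat_real S x *\<^sub>R T' (f x) *\<^sub>R F x) = (\<lambda>x. T' (f0 x) *\<^sub>R F0 x)"
      by (auto simp: indicator_def f0_def F0_def)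
    then show ?thesis unfolding set_borel_measurable_def by simp
  qed
  show sg: "sobolev_gradient p S (\<lambda>x. T (f x)) (\<lambda>x. T' (f x) *\<^sub>R F x)"
    unfolding sobolev_gradient_def
  proof (intro conjI allI impI)
    show "Lp_on p S (\<lambda>x. T (f x))"
    proof (rule Lp_on_bounded_by[OF _ mT])
      show "set_integrable lborel S (\<lambda>x. B powr p)"
        using emeasure_bounded_finite[OF S(2)] by (simp add: set_integrable_def)
      show "norm (T (f x)) powr p \<le> B powr p" for x using T(3)[of "f x"] p by (intro powr_mono2) auto
    qed (use p in simp)
    show "Lp_on p S (\<lambda>x. T' (f x) *\<^sub>R F x)"
    proof (rule Lp_on_bounded_by[OF _ mT'])
      show "set_integrable lborel S (\<lambda>x. M powr p * norm (F x) powr p)"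
        using f unfolding sobolev_gradient_def Lp_on_def by (intro set_integrable_mult_right) auto
      show "norm (T' (f x) *\<^sub>R F x) powr p \<le> M powr p * norm (F x) powr p" for x
      proof -
        have "norm (T' (f x) *\<^sub>R F x) powr p \<le> (M * norm (F x)) powr p"
          using T(2)[of "f x"] p by (intro powr_mono2) (auto intro: mult_right_mono)
        also have "\<dots> = M powr p * norm (F x) powr p" using M0 by (intro powr_mult)
        finally show ?thesis .
      qed
    qed (use p in simp)
    fix \<phi> \<Phi> assume "test_function S \<phi> \<and> (\<forall>x. GDERIV \<phi> x :> \<Phi> x)"
    then have \<phi>: "test_function S \<phi>" "\<And>x. GDERIV \<phi> x :> \<Phi> x" by auto
    have zero: "\<psi> x = 0" "\<Psi> x = 0" if "test_function S \<psi>" "\<And>x. GDERIV \<psi> x :> \<Psi> x" "x \<notin> S" for \<psi> \<Psi> x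
    proof -
      have "x \<notin> closure {x. \<psi> x \<noteq> 0}" using that unfolding test_function_def by blast
      then show "\<psi> x = 0" "\<Psi> x = 0" using test_function_gradient[OF that(1,2)] by metis+
    qed
    have "(LINT x|lborel. T (f0 x) *\<^sub>R \<Phi> x) = - (LINT x|lborel. \<phi> x *\<^sub>R (T' (f0 x) *\<^sub>R F0 x))"
    proof (rule chain_rule_weak[OF S(1) f0 F0 _ T T' \<phi>])
      fix \<psi> \<Psi> assume \<psi>: "test_function S \<psi>" "\<And>x. GDERIV \<psi> x :> \<Psi> x"
      then have "(LINT x:S|lborel. f x *\<^sub>R \<Psi> x) = - (LINT x:S|lborel. \<psi> x *\<^sub>R F x)"
        using f unfolding sobolev_gradient_def by blast
      moreover have "(\<lambda>x. indicat_real S x *\<^sub>R f x *\<^sub>R \<Psi> x) = (\<lambda>x. f0 x *\<^sub>R \<Psi> x)"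
        "(\<lambda>x. indicat_real S x *\<^sub>R \<psi> x *\<^sub>R F x) = (\<lambda>x. \<psi> x *\<^sub>R F0 x)"
        by (auto simp: f0_def F0_def)
      ultimately show "(LINT x|lborel. f0 x *\<^sub>R \<Psi> x) = - (LINT x|lborel. \<psi> x *\<^sub>R F0 x)"
        by (simp add: set_lebesgue_integral_def)
    qed
    moreover have "(\<lambda>x. indicat_real S x *\<^sub>R T (f x) *\<^sub>R \<Phi> x) = (\<lambda>x. T (f0 x) *\<^sub>R \<Phi> x)"
    proof
      fix x show "indicat_real S x *\<^sub>R T (f x) *\<^sub>R \<Phi> x = T (f0 x) *\<^sub>R \<Phi> x"
        using zero(2)[OF \<phi>, of x] by (cases "x \<in> S") (auto simp: f0_def)
    qed
    moreover have "(\<lambda>x. indicat_real S x *\<^sub>R \<phi> x *\<^sub>R T' (f x) *\<^sub>R F x) = (\<lambda>x. \<phi> x *\<^sub>R (T' (f0 x) *\<^sub>R F0 x))"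
      by (auto simp: f0_def F0_def indicator_def)
    ultimately show "(LINT x:S|lborel. T (f x) *\<^sub>R \<Phi> x) = - (LINT x:S|lborel. \<phi> x *\<^sub>R (T' (f x) *\<^sub>R F x))"
      by (simp add: set_lebesgue_integral_def)
  qed
  show "(\<lambda>x. T (f x)) \<in> W1p_Linfty p S"
    unfolding W1p_Linfty_def Linfty_on_def using sg mT T(3) by blast
qed

section \<open>Accretivity of the weighted \<open>p\<close>-Laplace operator\<close>

text \<open>
  By the Cauchy-Schwarz inequality the inner product is at least
  \<open>(\<bar>a\<bar>\<^bsup>p-1\<^esup> - \<bar>b\<bar>\<^bsup>p-1\<^esup>) (\<bar>a\<bar> - \<bar>b\<bar>)\<close>, which is nonnegative because \<open>r\<^bsup>p-1\<^esup>\<close> increases.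
\<close>

lemma p_flux_monotone:
  fixes a b :: "'a::real_inner"
  assumes "1 < p"
  shows "0 \<le> (norm a powr (p - 2) *\<^sub>R a - norm b powr (p - 2) *\<^sub>R b) \<bullet> (a - b)"
proof -
  define \<alpha> \<beta> where "\<alpha> = norm a powr (p - 2)" and "\<beta> = norm b powr (p - 2)"
  have nn: "\<alpha> \<ge> 0" "\<beta> \<ge> 0" by (auto simp: \<alpha>_def \<beta>_def)
  have pow: "norm c powr (p - 2) * norm c = norm c powr (p - 1)" for c :: 'a
    using powr_mult_base[of "norm c" "p - 2"] by (cases "c = 0") (auto simp: mult.commute)
  have "(norm a powr (p - 1) - norm b powr (p - 1)) * (norm a - norm b) \<ge> 0"
  proof (cases "norm a \<le> norm b")
    case True
    then have "norm a powr (p - 1) \<le> norm b powr (p - 1)" using assms by (intro powr_mono2) auto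
    with True show ?thesis by (simp add: mult_nonpos_nonpos)
  next
    case False
    then have "norm b powr (p - 1) \<le> norm a powr (p - 1)" using assms by (intro powr_mono2) auto
    with False show ?thesis by simp
  qed
  also have "(norm a powr (p - 1) - norm b powr (p - 1)) * (norm a - norm b) =
      \<alpha> * (norm a)\<^sup>2 + \<beta> * (norm b)\<^sup>2 - (\<alpha> + \<beta>) * (norm a * norm b)"
    unfolding pow[symmetric] \<alpha>_def[symmetric] \<beta>_def[symmetric] by (simp add: power2_eq_square algebra_simps)
  also have "\<dots> \<le> \<alpha> * (norm a)\<^sup>2 + \<beta> * (norm b)\<^sup>2 - (\<alpha> + \<beta>) * (a \<bullet> b)"
    using nn norm_cauchy_schwarz[of a b] by (intro diff_left_mono mult_left_mono) auto
  also have "\<dots> = (\<alpha> *\<^sub>R a - \<beta> *\<^sub>R b) \<bullet> (a - b)"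
    by (simp add: power2_norm_eq_inner inner_diff inner_commute algebra_simps)
  finally show ?thesis by (simp add: \<alpha>_def \<beta>_def)
qed

text \<open>
  In place of Young's inequality, replace the smaller of the two norms by the
  larger one in \<open>\<bar>a\<bar>\<^bsup>p-1\<^esup> \<bar>b\<bar>\<close>.
\<close>

lemma p_flux_bound:
  fixes a b :: "'a::real_inner"
  assumes "1 < p"
  shows "\<bar>norm a powr (p - 2) * (a \<bullet> b)\<bar> \<le> norm a powr p + norm b powr p"
proof -
  have pow: "r powr (p - 1) * r = r powr p" if "0 \<le> r" for r :: real
    using powr_mult_base[of r "p - 1"] that by (cases "r = 0") (auto simp: mult.commute)
  have "\<bar>norm a powr (p - 2) * (a \<bullet> b)\<bar> \<le> norm a powr (p - 2) * (norm a * norm b)"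
    unfolding abs_mult by (intro mult_mono Cauchy_Schwarz_ineq2) auto
  also have "\<dots> = norm a powr (p - 1) * norm b"
    using powr_mult_base[of "norm a" "p - 2"] by (cases "a = 0") (auto simp: mult_ac)
  also have "\<dots> \<le> norm a powr p + norm b powr p"
  proof (cases "norm a \<le> norm b")
    case True
    then have "norm a powr (p - 1) * norm b \<le> norm b powr (p - 1) * norm b"
      using assms by (intro mult_right_mono powr_mono2) auto
    then show ?thesis using pow[of "norm b", OF norm_ge_zero] powr_ge_zero[of "norm a" p] by linarith
  next
    case False
    then have "norm a powr (p - 1) * norm b \<le> norm a powr (p - 1) * norm a"
      by (intro mult_left_mono) auto
    then show ?thesis using pow[of "norm a", OF norm_ge_zero] powr_ge_zero[of "norm b" p] by linarith
  qed
  finally show ?thesis .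
qed

lemma set_integrable_p_flux:
  fixes S :: "(real^'n) set"
  assumes p: "1 < p" and \<gamma>: "\<gamma> \<in> L1_between g1 g2 S" "0 < g1" and F: "Lp_on p S F" and \<Phi>: "Lp_on p S \<Phi>"
  shows "set_integrable lborel S (\<lambda>x. rep_L1 \<gamma> x * norm (F x) powr (p - 2) * (F x \<bullet> \<Phi> x))"
  unfolding set_integrable_def
proof (rule Bochner_Integration.integrable_bound)
  show "integrable lborel (\<lambda>x. g2 * (indicat_real S x *\<^sub>R norm (F x) powr p + indicat_real S x *\<^sub>R norm (\<Phi> x) powr p))"
    using F \<Phi> unfolding Lp_on_def set_integrable_def by auto
  have [measurable]: "(\<lambda>x. indicat_real S x *\<^sub>R F x) \<in> borel_measurable borel" "(\<lambda>x. indicat_real S x *\<^sub>R \<Phi> x) \<in> borel_measurable borel"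
    using F \<Phi> by (auto simp: Lp_on_def set_borel_measurable_def)
  have [measurable]: "rep_L1 \<gamma> \<in> borel_measurable borel"
    using borel_measurable_integrable[OF integrable_rep_L1] by simp
  have "(\<lambda>x. indicat_real S x *\<^sub>R (rep_L1 \<gamma> x * norm (F x) powr (p - 2) * (F x \<bullet> \<Phi> x))) =
     (\<lambda>x. rep_L1 \<gamma> x * norm (indicat_real S x *\<^sub>R F x) powr (p - 2) * ((indicat_real S x *\<^sub>R F x) \<bullet> (indicat_real S x *\<^sub>R \<Phi> x)))"
    by (auto simp: indicator_def)
  also have "\<dots> \<in> borel_measurable lborel" by measurable
  finally show "(\<lambda>x. indicat_real S x *\<^sub>R (rep_L1 \<gamma> x * norm (F x) powr (p - 2) * (F x \<bullet> \<Phi> x))) \<in> borel_measurable lborel" .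
  have "AE x in lborel. x \<in> S \<longrightarrow> g1 \<le> rep_L1 \<gamma> x \<and> rep_L1 \<gamma> x \<le> g2"
    using \<gamma> by (simp add: L1_between_def)
  then show "AE x in lborel. norm (indicat_real S x *\<^sub>R (rep_L1 \<gamma> x * norm (F x) powr (p - 2) * (F x \<bullet> \<Phi> x)))
     \<le> norm (g2 * (indicat_real S x *\<^sub>R norm (F x) powr p + indicat_real S x *\<^sub>R norm (\<Phi> x) powr p))"
  proof eventually_elim
    case (elim x)
    show ?case
    proof (cases "x \<in> S")
      case True
      have "\<bar>rep_L1 \<gamma> x\<bar> * \<bar>norm (F x) powr (p - 2) * (F x \<bullet> \<Phi> x)\<bar> \<le> g2 * (norm (F x) powr p + norm (\<Phi> x) powr p)"
        using elim True \<gamma>(2) by (intro mult_mono p_flux_bound[OF p]) auto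
      then show ?thesis using True elim \<gamma>(2) by (simp add: abs_mult mult.assoc)
    qed simp
  qed
qed

text \<open>
  Both equations are tested with \<open>T (f - h)\<close>, whose weak gradient is \<open>T' (f - h) (\<nabla>f - \<nabla>h)\<close>. The
  difference of the left hand sides is then the integral of \<open>\<gamma> T' (f - h)\<close> times the expression of
  \<open>p_flux_monotone\<close>.
\<close>

lemma weak_p_Laplace_monotone:
  fixes S :: "(real^'n) set"
  assumes S: "open S" "bounded S" and p: "1 < p" and \<gamma>: "\<gamma> \<in> L1_between g1 g2 S" "0 < g1"
    and f: "(f, fh) \<in> a_core p S \<gamma>" and h: "(h, hh) \<in> a_core p S \<gamma>"
    and T: "\<And>r. (T has_real_derivative T' r) (at r)" "\<And>r. \<bar>T' r\<bar> \<le> M" "\<And>r. \<bar>T r\<bar> \<le> B" 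
    and T': "continuous_on UNIV T'" "\<And>r. 0 \<le> T' r"
  shows "0 \<le> (LINT x|lborel. (rep_L1 fh x - rep_L1 hh x) * T (rep_L1 f x - rep_L1 h x))"
proof -
  obtain F where F: "sobolev_gradient p S (rep_L1 f) F" using f by (auto simp: a_core_def W1p_Linfty_def)
  obtain H where H: "sobolev_gradient p S (rep_L1 h) H" using h by (auto simp: a_core_def W1p_Linfty_def)
  define u where "u x = rep_L1 f x - rep_L1 h x" for x
  have p1: "1 \<le> p" using p by simp
  have u: "sobolev_gradient p S u (\<lambda>x. F x - H x)"
    unfolding u_def[abs_def] by (rule sobolev_gradient_diff[OF S p1 F H])
  define \<Phi> where "\<Phi> x = T' (u x) *\<^sub>R (F x - H x)" for x
  have \<phi>: "sobolev_gradient p S (\<lambda>x. T (u x)) \<Phi>" "(\<lambda>x. T (u x)) \<in> W1p_Linfty p S"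
    unfolding \<Phi>_def[abs_def] by (rule sobolev_gradient_chain_rule[OF S p1 u T T'(1)])+
  have eqf: "(LINT x:S|lborel. rep_L1 \<gamma> x * norm (F x) powr (p - 2) * (F x \<bullet> \<Phi> x)) = (LINT x:S|lborel. rep_L1 fh x * T (u x))"
    using f F \<phi> by (auto simp: a_core_def weak_p_Laplace_def)
  have eqh: "(LINT x:S|lborel. rep_L1 \<gamma> x * norm (H x) powr (p - 2) * (H x \<bullet> \<Phi> x)) = (LINT x:S|lborel. rep_L1 hh x * T (u x))"
    using h H \<phi> by (auto simp: a_core_def weak_p_Laplace_def)
  have [measurable]: "T \<in> borel_measurable borel"
    by (rule borel_measurable_continuous_onI) (intro continuous_at_imp_continuous_on ballI DERIV_isCont, rule T)
  have [measurable]: "rep_L1 k \<in> borel_measurable borel" for k :: "(real^'n) L1"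
    using borel_measurable_integrable[OF integrable_rep_L1] by simp
  have [measurable]: "u \<in> borel_measurable borel" unfolding u_def[abs_def] by measurable
  have int: "integrable lborel (\<lambda>x. rep_L1 k x * T (u x))" for k
    by (rule integrable_mult_bounded[OF integrable_rep_L1 _ T(3)]) measurable
  \<comment> \<open>Elements of \<open>L1_on S\<close> vanish almost everywhere off \<open>S\<close>, although \<open>u\<close> is defined everywhere.\<close>
  have on_S: "(LINT x:S|lborel. rep_L1 k x * T (u x)) = (LINT x|lborel. rep_L1 k x * T (u x))" if "k \<in> L1_on S" for k
    unfolding set_lebesgue_integral_def
  proof (rule integral_cong_AE)
    have [measurable]: "S \<in> sets borel" using S by simp
    show "(\<lambda>x. indicat_real S x *\<^sub>R (rep_L1 k x * T (u x))) \<in> borel_measurable lborel" by measurable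
    show "(\<lambda>x. rep_L1 k x * T (u x)) \<in> borel_measurable lborel" by measurable
    have "AE x in lborel. x \<notin> S \<longrightarrow> rep_L1 k x = 0" using that by (simp add: L1_on_def)
    then show "AE x in lborel. indicat_real S x *\<^sub>R (rep_L1 k x * T (u x)) = rep_L1 k x * T (u x)"
      by eventually_elim (auto simp: indicator_def)
  qed
  have L\<Phi>: "Lp_on p S F" "Lp_on p S H" "Lp_on p S \<Phi>" using F H \<phi> by (auto simp: sobolev_gradient_def)
  have "0 \<le> (LINT x:S|lborel. rep_L1 \<gamma> x * norm (F x) powr (p - 2) * (F x \<bullet> \<Phi> x) - rep_L1 \<gamma> x * norm (H x) powr (p - 2) * (H x \<bullet> \<Phi> x))"
    unfolding set_lebesgue_integral_def
  proof (rule integral_nonneg_AE)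
    have "AE x in lborel. x \<in> S \<longrightarrow> g1 \<le> rep_L1 \<gamma> x \<and> rep_L1 \<gamma> x \<le> g2"
      using \<gamma> by (simp add: L1_between_def)
    then show "AE x in lborel. 0 \<le> indicat_real S x *\<^sub>R (rep_L1 \<gamma> x * norm (F x) powr (p - 2) * (F x \<bullet> \<Phi> x) - rep_L1 \<gamma> x * norm (H x) powr (p - 2) * (H x \<bullet> \<Phi> x))"
    proof eventually_elim
      case (elim x)
      have "rep_L1 \<gamma> x * norm (F x) powr (p - 2) * (F x \<bullet> \<Phi> x) - rep_L1 \<gamma> x * norm (H x) powr (p - 2) * (H x \<bullet> \<Phi> x) =
        rep_L1 \<gamma> x * (T' (u x) * ((norm (F x) powr (p - 2) *\<^sub>R F x - norm (H x) powr (p - 2) *\<^sub>R H x) \<bullet> (F x - H x)))"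
        by (simp add: \<Phi>_def inner_diff_left algebra_simps)
      moreover have "0 \<le> \<dots>" if "x \<in> S"
        using elim that \<gamma>(2) by (intro mult_nonneg_nonneg T' p_flux_monotone[OF p]) auto
      ultimately show ?case by (cases "x \<in> S") auto
    qed
  qed
  also have "\<dots> = (LINT x:S|lborel. rep_L1 fh x * T (u x)) - (LINT x:S|lborel. rep_L1 hh x * T (u x))"
    unfolding eqf[symmetric] eqh[symmetric]
    by (intro set_integral_diff set_integrable_p_flux[OF p \<gamma>] L\<Phi>)
  also have "\<dots> = (LINT x|lborel. rep_L1 fh x * T (u x)) - (LINT x|lborel. rep_L1 hh x * T (u x))"
    using f h on_S by (simp add: a_core_def)
  also have "\<dots> = (LINT x|lborel. (rep_L1 fh x - rep_L1 hh x) * T (u x))"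
    using int by (simp add: left_diff_distrib)
  finally show ?thesis by (simp add: u_def)
qed

text \<open>
  If \<open>T\<close> were \<open>\<pi> / 2\<close> times the sign function in \<open>weak_p_Laplace_monotone\<close>, then pairing
  \<open>f - h + c (fh - hh)\<close> with \<open>T (f - h)\<close> would give the claim at once. The smooth functions
  \<open>arctan (n r)\<close> are bounded by \<open>\<pi> / 2\<close> and tend to that multiple of the sign of \<open>r\<close>, so the claim
  follows in the limit.
\<close>

lemma accretive_a_core:
  fixes S :: "(real^'n) set"
  assumes S: "open S" "bounded S" and p: "1 < p" and \<gamma>: "\<gamma> \<in> L1_between g1 g2 S" "0 < g1"
  shows "accretive (a_core p S \<gamma>)"
  unfolding accretive_def
proof safe
  fix f fh h hh :: "(real^'n) L1" and c :: real
  assume f: "(f, fh) \<in> a_core p S \<gamma>" and h: "(h, hh) \<in> a_core p S \<gamma>" and c: "c > 0"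
  define u where "u x = rep_L1 f x - rep_L1 h x" for x
  define w where "w x = rep_L1 fh x - rep_L1 hh x" for x
  have int: "integrable lborel u" "integrable lborel w"
    unfolding u_def[abs_def] w_def[abs_def] by (auto intro: integrable_rep_L1)
  then have [measurable]: "u \<in> borel_measurable borel" "w \<in> borel_measurable borel"
    by (auto dest: borel_measurable_integrable)
  have norm_u: "norm (f - h) = (LINT x|lborel. \<bar>u x\<bar>)"
  proof -
    have "f - h = abs_L1 u"
      using abs_L1_diff[OF integrable_rep_L1 integrable_rep_L1, of f h] by (simp add: u_def[abs_def] abs_rep_L1)
    then show ?thesis using norm_abs_L1[OF int(1)] by simp
  qed
  have norm_uw: "norm (f - h + c *\<^sub>R (fh - hh)) = (LINT x|lborel. \<bar>u x + c * w x\<bar>)"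
  proof -
    have "f - h = abs_L1 u"
      using abs_L1_diff[OF integrable_rep_L1 integrable_rep_L1, of f h] by (simp add: u_def[abs_def] abs_rep_L1)
    moreover have "fh - hh = abs_L1 w"
      using abs_L1_diff[OF integrable_rep_L1 integrable_rep_L1, of fh hh] by (simp add: w_def[abs_def] abs_rep_L1)
    moreover have "abs_L1 (\<lambda>x. u x + c * w x) = abs_L1 u + c *\<^sub>R abs_L1 w"
      using int abs_L1_add[OF int(1), of "\<lambda>x. c * w x"] abs_L1_scale[OF int(2), of c] by simp
    ultimately have "f - h + c *\<^sub>R (fh - hh) = abs_L1 (\<lambda>x. u x + c * w x)" by simp
    then show ?thesis using norm_abs_L1[of "\<lambda>x. u x + c * w x"] int by simp
  qed
  define T where "T n r = arctan (real (Suc n) * r)" for n r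
  have T_le: "\<bar>T n r\<bar> \<le> pi / 2" for n r
    using arctan_ubound[of "real (Suc n) * r"] arctan_lbound[of "real (Suc n) * r"] by (simp add: T_def abs_le_iff)
  have [measurable]: "T n \<in> borel_measurable borel" for n
    unfolding T_def[abs_def] by (intro borel_measurable_continuous_onI continuous_intros)
  have le: "(LINT x|lborel. u x * T n (u x)) \<le> (pi / 2) * norm (f - h + c *\<^sub>R (fh - hh))" for n
  proof -
    define T' where "T' r = real (Suc n) / (1 + (real (Suc n) * r)\<^sup>2)" for r
    have pos: "0 < 1 + (real (Suc n) * r)\<^sup>2" for r by (rule add_pos_nonneg) auto
    have "0 \<le> (LINT x|lborel. (rep_L1 fh x - rep_L1 hh x) * T n (rep_L1 f x - rep_L1 h x))"
    proof (rule weak_p_Laplace_monotone[OF S p \<gamma> f h, of _ T' "real (Suc n)"])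
      show "(T n has_real_derivative T' r) (at r)" for r
        unfolding T_def T'_def by (auto intro!: derivative_eq_intros simp: field_simps)
      show "0 \<le> T' r" for r unfolding T'_def using pos[of r] by (intro divide_nonneg_pos) auto
      show "\<bar>T' r\<bar> \<le> real (Suc n)" for r
        using pos[of r] unfolding T'_def abs_divide by (subst divide_le_eq) (auto simp: mult_left_le)
      show "continuous_on UNIV T'" unfolding T'_def using pos by (intro continuous_intros) (metis less_irrefl)
    qed (rule T_le)
    then have nn: "0 \<le> (LINT x|lborel. w x * T n (u x))" by (simp add: u_def w_def)
    have i1: "integrable lborel (\<lambda>x. u x * T n (u x))" and i2: "integrable lborel (\<lambda>x. w x * T n (u x))"
      by (rule integrable_mult_bounded[OF int(1) _ T_le], measurable) (rule integrable_mult_bounded[OF int(2) _ T_le], measurable)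
    have "(LINT x|lborel. u x * T n (u x)) \<le> (LINT x|lborel. u x * T n (u x)) + c * (LINT x|lborel. w x * T n (u x))"
      using nn c by simp
    also have "\<dots> = (LINT x|lborel. u x * T n (u x) + c * (w x * T n (u x)))"
      using i1 i2 by simp
    also have "\<dots> \<le> (LINT x|lborel. (pi / 2) * \<bar>u x + c * w x\<bar>)"
    proof (rule integral_mono)
      show "integrable lborel (\<lambda>x. u x * T n (u x) + c * (w x * T n (u x)))" using i1 i2 by simp
      show "integrable lborel (\<lambda>x. (pi / 2) * \<bar>u x + c * w x\<bar>)" using int by simp
      fix x
      have "u x * T n (u x) + c * (w x * T n (u x)) = (u x + c * w x) * T n (u x)" by (simp add: algebra_simps)
      also have "\<dots> \<le> \<bar>u x + c * w x\<bar> * \<bar>T n (u x)\<bar>" by (metis abs_ge_self abs_mult)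
      also have "\<dots> \<le> \<bar>u x + c * w x\<bar> * (pi / 2)" by (intro mult_left_mono T_le) auto
      finally show "u x * T n (u x) + c * (w x * T n (u x)) \<le> (pi / 2) * \<bar>u x + c * w x\<bar>" by (simp add: mult.commute)
    qed
    finally show ?thesis using norm_uw by simp
  qed
  have "(\<lambda>n. LINT x|lborel. u x * T n (u x)) \<longlonglongrightarrow> (LINT x|lborel. (pi / 2) * \<bar>u x\<bar>)"
  proof (rule integral_dominated_convergence[where w="\<lambda>x. \<bar>u x\<bar> * (pi / 2)"])
    show "integrable lborel (\<lambda>x. \<bar>u x\<bar> * (pi / 2))" using int by simp
    show "AE x in lborel. norm (u x * T n (u x)) \<le> \<bar>u x\<bar> * (pi / 2)" for n
      by (intro AE_I2) (simp only: real_norm_def abs_mult, intro mult_left_mono T_le, auto)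
    have lim: "(\<lambda>n. r * T n r) \<longlonglongrightarrow> (pi / 2) * \<bar>r\<bar>" for r
    proof -
      have top: "filterlim (\<lambda>n. real (Suc n) * s) at_top sequentially" if "s > 0" for s :: real
        using that by (intro filterlim_at_top_mult_tendsto_pos[OF tendsto_const] filterlim_compose[OF filterlim_real_sequentially filterlim_Suc])
      consider "r > 0" | "r < 0" | "r = 0" by linarith
      then show ?thesis
      proof cases
        case 1
        have "(\<lambda>n. T n r) \<longlonglongrightarrow> pi / 2" unfolding T_def
          by (rule filterlim_compose[OF tendsto_arctan_at_top top[OF 1]])
        from tendsto_mult[OF tendsto_const this, of r] show ?thesis using 1 by (simp add: mult.commute)
      next
        case 2
        have "(\<lambda>n. T n (- r)) \<longlonglongrightarrow> pi / 2" unfolding T_def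
          by (rule filterlim_compose[OF tendsto_arctan_at_top top]) (use 2 in simp)
        from tendsto_mult[OF tendsto_const this, of "- r"] show ?thesis using 2 by (simp add: mult.commute T_def arctan_minus)
      qed simp
    qed
    show "AE x in lborel. (\<lambda>n. u x * T n (u x)) \<longlonglongrightarrow> (pi / 2) * \<bar>u x\<bar>"
      by (intro AE_I2 lim)
  qed measurable
  then have "(LINT x|lborel. (pi / 2) * \<bar>u x\<bar>) \<le> (pi / 2) * norm (f - h + c *\<^sub>R (fh - hh))"
    by (rule tendsto_upperbound) (intro always_eventually allI le, simp)
  then show "norm (f - h) \<le> norm (f - h + c *\<^sub>R (fh - hh))"
    by (simp add: norm_u)
qed

section \<open>Mild solutions of the random problem\<close>

lemma L1_OmegaD:
  assumes "f \<in> L1_Omega P S"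
  shows "f \<in> borel_measurable P" "\<And>\<omega>. \<omega> \<in> space P \<Longrightarrow> f \<omega> \<in> L1_on S" "integrable P (\<lambda>\<omega>. norm (f \<omega>))"
  using assms unfolding L1_Omega_def integrable_iff_bounded by auto

lemma integrable_norm_diff_L1_Omega:
  assumes f: "f \<in> L1_Omega P S" and h: "h \<in> L1_Omega P S"
  shows "integrable P (\<lambda>\<omega>. norm (f \<omega> - h \<omega>))"
proof (rule Bochner_Integration.integrable_bound)
  show "integrable P (\<lambda>\<omega>. norm (f \<omega>) + norm (h \<omega>))" using L1_OmegaD(3)[OF f] L1_OmegaD(3)[OF h] by simp
  have [measurable]: "f \<in> borel_measurable P" "h \<in> borel_measurable P" using L1_OmegaD(1) f h by auto
  show "(\<lambda>\<omega>. norm (f \<omega> - h \<omega>)) \<in> borel_measurable P" by measurable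
  show "AE \<omega> in P. norm (norm (f \<omega> - h \<omega>)) \<le> norm (norm (f \<omega>) + norm (h \<omega>))"
    by (intro AE_I2) (simp add: norm_triangle_ineq4)
qed

lemma L1_Omega_norm_diff: "L1_Omega_norm P (f - h) = (LINT \<omega>|P. norm (f \<omega> - h \<omega>))"
  by (simp add: L1_Omega_norm_def)

lemma A_core_pointwise:
  assumes P: "prob_space P" and "(f, fh) \<in> A_core P p S g"
  shows "AE \<omega> in P. (f \<omega>, fh \<omega>) \<in> a_core p S (g \<omega>)"
proof -
  have f: "f \<in> L1_Omega P S" "fh \<in> L1_Omega P S" "measure P {\<omega>\<in>space P. rep_L1 (f \<omega>) \<in> W1p_Linfty p S} = 1"
    and w: "AE \<omega> in P. weak_p_Laplace p S (g \<omega>) (f \<omega>) (fh \<omega>)"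
    using assms(2) by (auto simp: A_core_def)
  have "AE \<omega> in P. \<omega> \<in> {\<omega>\<in>space P. rep_L1 (f \<omega>) \<in> W1p_Linfty p S}"
    by (rule prob_space.AE_prob_1[OF P f(3)])
  with w AE_space show ?thesis
    by eventually_elim (use f L1_OmegaD(2) in \<open>auto simp: a_core_def\<close>)
qed

text \<open>
  A sequence of graph points that converges in \<open>L\<^sup>1(\<Omega>; L\<^sup>1(S))\<close> has a subsequence that converges
  almost surely, so the closure of the random operator is taken pointwise.
\<close>

lemma A_closed_pointwise:
  assumes P: "prob_space P" and vw: "(v, w) \<in> A_closed P p S g"
  shows "AE \<omega> in P. (v \<omega>, w \<omega>) \<in> a_closed p S (g \<omega>)"
proof -
  have v: "v \<in> L1_Omega P S" "w \<in> L1_Omega P S" using vw by (auto simp: A_closed_def operator_closure_def)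
  have approx: "\<forall>\<epsilon>>0. \<exists>(h, hh)\<in>A_core P p S g. L1_Omega_norm P (v - h) < \<epsilon> \<and> L1_Omega_norm P (w - hh) < \<epsilon>"
    using vw by (simp add: A_closed_def operator_closure_def)
  have "\<exists>h hh. (h, hh) \<in> A_core P p S g \<and> L1_Omega_norm P (v - h) < inverse (real (Suc k))
      \<and> L1_Omega_norm P (w - hh) < inverse (real (Suc k))" for k
    using approx[rule_format, of "inverse (real (Suc k))"] by (auto simp del: of_nat_Suc)
  then obtain h hh where h: "\<And>k. (h k, hh k) \<in> A_core P p S g"
    "\<And>k. L1_Omega_norm P (v - h k) < inverse (real (Suc k))" "\<And>k. L1_Omega_norm P (w - hh k) < inverse (real (Suc k))"
    by metis
  have h': "h k \<in> L1_Omega P S" "hh k \<in> L1_Omega P S" for k using h(1)[of k] by (auto simp: A_core_def)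
  define X where "X k \<omega> = norm (v \<omega> - h k \<omega>) + norm (w \<omega> - hh k \<omega>)" for k \<omega>
  have int: "integrable P (X k)" for k
    unfolding X_def by (intro Bochner_Integration.integrable_add integrable_norm_diff_L1_Omega[where S=S] v h')
  have "(\<lambda>k. LINT \<omega>|P. norm (X k \<omega>)) \<longlonglongrightarrow> 0"
  proof (rule tendsto_sandwich[OF _ _ tendsto_const])
    show "(\<lambda>k. 2 * inverse (real (Suc k))) \<longlonglongrightarrow> 0"
      using tendsto_mult_right_zero[OF LIMSEQ_inverse_real_of_nat] .
    show "\<forall>\<^sub>F k in sequentially. 0 \<le> (LINT \<omega>|P. norm (X k \<omega>))"
      by (intro always_eventually allI Bochner_Integration.integral_nonneg norm_ge_zero)
    have eq: "(LINT \<omega>|P. norm (X k \<omega>)) = L1_Omega_norm P (v - h k) + L1_Omega_norm P (w - hh k)" for k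
      unfolding L1_Omega_norm_diff
      by (subst Bochner_Integration.integral_add[symmetric]) (auto simp: X_def intro: integrable_norm_diff_L1_Omega[where S=S] v h')
    show "\<forall>\<^sub>F k in sequentially. (LINT \<omega>|P. norm (X k \<omega>)) \<le> 2 * inverse (real (Suc k))"
    proof (intro always_eventually allI)
      show "(LINT \<omega>|P. norm (X k \<omega>)) \<le> 2 * inverse (real (Suc k))" for k
        using h(2)[of k] h(3)[of k] eq[of k] by linarith
    qed
  qed
  from tendsto_L1_AE_subseq[OF int this] obtain r :: "nat \<Rightarrow> nat" where
    r: "AE \<omega> in P. (\<lambda>k. X (r k) \<omega>) \<longlonglongrightarrow> 0" by blast
  have "AE \<omega> in P. \<forall>k. (h k \<omega>, hh k \<omega>) \<in> a_core p S (g \<omega>)"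
    unfolding AE_all_countable using A_core_pointwise[OF P h(1)] by blast
  with r AE_space show ?thesis
  proof eventually_elim
    case (elim \<omega>)
    have "\<exists>(a, b)\<in>a_core p S (g \<omega>). norm (v \<omega> - a) < \<epsilon> \<and> norm (w \<omega> - b) < \<epsilon>" if "\<epsilon> > 0" for \<epsilon>
    proof -
      have "eventually (\<lambda>k. X (r k) \<omega> < \<epsilon>) sequentially" by (rule order_tendstoD(2)[OF elim(1) that])
      then obtain k where k: "X (r k) \<omega> < \<epsilon>" by (auto simp: eventually_sequentially)
      have "norm (v \<omega> - h (r k) \<omega>) \<le> X (r k) \<omega>" "norm (w \<omega> - hh (r k) \<omega>) \<le> X (r k) \<omega>" by (auto simp: X_def)
      with k elim(3) show ?thesis by (intro bexI[of _ "(h (r k) \<omega>, hh (r k) \<omega>)"]) auto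
    qed
    then show ?case
      using L1_OmegaD(2)[OF v(1) elim(2)] L1_OmegaD(2)[OF v(2) elim(2)]
      by (simp add: a_closed_def operator_closure_def)
  qed
qed

text \<open>
  All three errors of a scheme for the random problem, those of the initial value, of the right hand
  sides and of the value at time \<open>t\<close>, are small in expectation; the Euler inclusions hold almost surely.
\<close>

lemma random_mild_solution_scheme:
  assumes P: "prob_space P" and u: "u \<in> L1_Omega P S"
    and U: "mild_solution (L1_Omega P S) (L1_Omega_norm P) (A_closed P p S g) u U" and t: "t > 0" and e: "e > 0"
  defines "X n s y v i \<omega> \<equiv> norm (v 0 \<omega> - u \<omega>) + scheme_error s (\<lambda>l. y l \<omega>) n + norm (U t \<omega> - v (Suc i) \<omega>)"
  shows "\<exists>n s y v i. 0 \<le> s 0 \<and> s 0 \<le> e \<and> (\<forall>l<n. s (Suc l) - s l \<le> e) \<and> i < n \<and> s i < t \<and> t \<le> s (Suc i)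
     \<and> (AE \<omega> in P. euler_scheme (a_closed p S (g \<omega>)) n s (\<lambda>l. y l \<omega>) (\<lambda>l. v l \<omega>))
     \<and> integrable P (X n s y v i) \<and> (LINT \<omega>|P. X n s y v i \<omega>) \<le> e"
proof -
  let ?N = "L1_Omega_norm P"
  have UX: "U r \<in> L1_Omega P S" if "0 \<le> r" for r using U that by (auto simp: mild_solution_def)
  have "((\<lambda>r. ?N (U r - U 0)) \<longlongrightarrow> 0) (at 0 within {0..})" and U0: "?N (U 0 - u) = 0"
    using U unfolding mild_solution_def by auto
  then have "eventually (\<lambda>r. ?N (U r - U 0) < e / 4) (at 0 within {0..})"
    using e by (intro order_tendstoD(2)[of _ 0]) auto
  then obtain d where d: "d > 0" "\<And>r. 0 < r \<Longrightarrow> r < d \<Longrightarrow> ?N (U r - U 0) < e / 4"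
    unfolding eventually_at by auto
  have d': "?N (U r - U 0) \<le> e / 4" if "0 \<le> r" "r < d" for r
    using d(2)[of r] that e by (cases "r = 0") (auto simp: L1_Omega_norm_def)
  define \<eta> where "\<eta> = min (min (e / 4) (t / 2)) (d / 2)"
  have \<eta>: "\<eta> > 0" "\<eta> \<le> e / 4" "\<eta> \<le> t / 2" "\<eta> < d" using e t \<open>d > 0\<close> by (auto simp: \<eta>_def)
  \<comment> \<open>The horizon \<open>2 * t\<close> ensures that \<open>t\<close> lies in an interval of the partition.\<close>
  from U t \<eta>(1) obtain n s y v where
    1: "eps_approx_solution (L1_Omega P S) ?N (A_closed P p S g) (2 * t) \<eta> n s y v" "?N (U (s 0) - v 0) \<le> \<eta>"
       "\<And>i t. i < n \<Longrightarrow> s i < t \<Longrightarrow> t \<le> s (Suc i) \<Longrightarrow> ?N (U t - v (Suc i)) \<le> \<eta>"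
    unfolding mild_solution_def by (metis mult_pos_pos zero_less_numeral)
  then have 2: "0 \<le> s 0" "s 0 \<le> \<eta>" "2 * t - s n \<le> \<eta>" "\<forall>i<n. s i < s (Suc i) \<and> s (Suc i) - s i \<le> \<eta>"
     "(\<Sum>i<n. (s (Suc i) - s i) * ?N (y (Suc i))) \<le> \<eta>"
     "\<And>i. i < n \<Longrightarrow> (v (Suc i), y (Suc i) - (1 / (s (Suc i) - s i)) *\<^sub>R (v (Suc i) - v i)) \<in> A_closed P p S g"
     "v 0 \<in> L1_Omega P S" "\<And>i. i < n \<Longrightarrow> v (Suc i) \<in> L1_Omega P S" "\<And>i. i < n \<Longrightarrow> y (Suc i) \<in> L1_Omega P S"
    unfolding eps_approx_solution_def by auto
  have "s 0 < t" "t \<le> s n" using 2(1-3) \<eta> t by linarith+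
  from partition_interval_exists[of s, OF this] obtain i where i: "i < n" "s i < t" "t \<le> s (Suc i)" by blast
  have AE: "AE \<omega> in P. euler_scheme (a_closed p S (g \<omega>)) n s (\<lambda>l. y l \<omega>) (\<lambda>l. v l \<omega>)"
  proof -
    have "AE \<omega> in P. \<forall>i. i < n \<longrightarrow> (v (Suc i) \<omega>, y (Suc i) \<omega> - (1 / (s (Suc i) - s i)) *\<^sub>R (v (Suc i) \<omega> - v i \<omega>)) \<in> a_closed p S (g \<omega>)"
      unfolding AE_all_countable
    proof
      fix i
      show "AE \<omega> in P. i < n \<longrightarrow> (v (Suc i) \<omega>, y (Suc i) \<omega> - (1 / (s (Suc i) - s i)) *\<^sub>R (v (Suc i) \<omega> - v i \<omega>)) \<in> a_closed p S (g \<omega>)"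
        using A_closed_pointwise[OF P 2(6), of i] by (cases "i < n") (auto simp: scaleR_fun_def)
    qed
    then show ?thesis by eventually_elim (use 2(4) in \<open>auto simp: euler_scheme_def\<close>)
  qed
  have int0: "integrable P (\<lambda>\<omega>. norm (v 0 \<omega> - u \<omega>))" by (rule integrable_norm_diff_L1_Omega[OF 2(7) u])
  have int1: "integrable P (\<lambda>\<omega>. scheme_error s (\<lambda>l. y l \<omega>) n)"
    unfolding scheme_error_def using L1_OmegaD(3)[OF 2(9)]
    by (intro Bochner_Integration.integrable_sum integrable_mult_right) auto
  have int2: "integrable P (\<lambda>\<omega>. norm (U t \<omega> - v (Suc i) \<omega>))"
    using t i by (intro integrable_norm_diff_L1_Omega[where S=S] 2(8) UX) auto
  have "integrable P (X n s y v i)"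
    unfolding X_def by (intro Bochner_Integration.integrable_add int0 int1 int2)
  moreover have "(LINT \<omega>|P. X n s y v i \<omega>) \<le> e"
  proof -
    have "(LINT \<omega>|P. norm (v 0 \<omega> - u \<omega>)) \<le> e / 2"
    proof -
      have a: "integrable P (\<lambda>\<omega>. norm (U (s 0) \<omega> - v 0 \<omega>))" "integrable P (\<lambda>\<omega>. norm (U (s 0) \<omega> - U 0 \<omega>))"
         "integrable P (\<lambda>\<omega>. norm (U 0 \<omega> - u \<omega>))"
        using 2(1,7) u by (auto intro!: integrable_norm_diff_L1_Omega[where S=S] UX)
      have "(LINT \<omega>|P. norm (v 0 \<omega> - u \<omega>)) \<le> (LINT \<omega>|P. norm (U (s 0) \<omega> - v 0 \<omega>) + (norm (U (s 0) \<omega> - U 0 \<omega>) + norm (U 0 \<omega> - u \<omega>)))"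
      proof (rule integral_mono[OF int0])
        show "integrable P (\<lambda>\<omega>. norm (U (s 0) \<omega> - v 0 \<omega>) + (norm (U (s 0) \<omega> - U 0 \<omega>) + norm (U 0 \<omega> - u \<omega>)))"
          using a by auto
        fix \<omega>
        show "norm (v 0 \<omega> - u \<omega>) \<le> norm (U (s 0) \<omega> - v 0 \<omega>) + (norm (U (s 0) \<omega> - U 0 \<omega>) + norm (U 0 \<omega> - u \<omega>))"
          using norm_triangle_ineq4[of "U (s 0) \<omega> - u \<omega>" "U (s 0) \<omega> - v 0 \<omega>"]
            norm_triangle_ineq[of "U (s 0) \<omega> - U 0 \<omega>" "U 0 \<omega> - u \<omega>"] by simp
      qed
      also have "\<dots> = ?N (U (s 0) - v 0) + (?N (U (s 0) - U 0) + ?N (U 0 - u))"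
        unfolding L1_Omega_norm_diff using a by simp
      also have "\<dots> \<le> e / 2" using 1(2) d'[of "s 0"] 2(1,2) \<eta> U0 by linarith
      finally show ?thesis .
    qed
    moreover have "(LINT \<omega>|P. scheme_error s (\<lambda>l. y l \<omega>) n) \<le> \<eta>"
    proof -
      have "(LINT \<omega>|P. scheme_error s (\<lambda>l. y l \<omega>) n) = (\<Sum>i<n. (s (Suc i) - s i) * ?N (y (Suc i)))"
        unfolding scheme_error_def L1_Omega_norm_def using L1_OmegaD(3)[OF 2(9)]
        by (subst Bochner_Integration.integral_sum) (auto intro!: sum.cong integrable_mult_right)
      then show ?thesis using 2(5) by simp
    qed
    moreover have "(LINT \<omega>|P. norm (U t \<omega> - v (Suc i) \<omega>)) \<le> \<eta>"
      using 1(3)[OF i] by (simp add: L1_Omega_norm_diff)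
    moreover have "(LINT \<omega>|P. X n s y v i \<omega>) = (LINT \<omega>|P. norm (v 0 \<omega> - u \<omega>))
       + (LINT \<omega>|P. scheme_error s (\<lambda>l. y l \<omega>) n) + (LINT \<omega>|P. norm (U t \<omega> - v (Suc i) \<omega>))"
      unfolding X_def using int0 int1 int2 by simp
    ultimately show ?thesis using \<eta>(2) by linarith
  qed
  moreover have "\<forall>l<n. s (Suc l) - s l \<le> e" using 2(4) \<eta> e by fastforce
  moreover have "s 0 \<le> e" using 2(2) \<eta> e by linarith
  ultimately show ?thesis using 2(1) i AE by blast
qed

text \<open>
  A sequence of schemes whose total errors tend to zero in expectation has a subsequence whose errors
  tend to zero almost surely.
\<close>

lemma random_mild_solution_pointwise:
  assumes P: "prob_space P" and u: "u \<in> L1_Omega P S"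
    and U: "mild_solution (L1_Omega P S) (L1_Omega_norm P) (A_closed P p S g) u U" and t: "t > 0"
  shows "AE \<omega> in P. euler_limit (a_closed p S (g \<omega>)) t (u \<omega>) (U t \<omega>)"
proof -
  define X where "X n s y v i \<omega> = norm (v 0 \<omega> - u \<omega>) + scheme_error s (\<lambda>l. y l \<omega>) n + norm (U t \<omega> - v (Suc i) \<omega>)"
    for n s and y v :: "nat \<Rightarrow> 'a \<Rightarrow> (real^'b) L1" and i \<omega>
  define good where "good e n s y v i \<longleftrightarrow> 0 \<le> s 0 \<and> s 0 \<le> e \<and> (\<forall>l<n. s (Suc l) - s l \<le> e) \<and> i < n \<and> s i < t \<and> t \<le> s (Suc i)
     \<and> (AE \<omega> in P. euler_scheme (a_closed p S (g \<omega>)) n s (\<lambda>l. y l \<omega>) (\<lambda>l. v l \<omega>))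
     \<and> integrable P (X n s y v i) \<and> (LINT \<omega>|P. X n s y v i \<omega>) \<le> e" for e n s y v i
  have "\<exists>n s y v i. good (inverse (real (Suc k))) n s y v i" for k
    unfolding good_def X_def[abs_def] using random_mild_solution_scheme[OF P u U t, of "inverse (real (Suc k))"] by simp
  then obtain n s y v i where good: "\<And>k. good (inverse (real (Suc k))) (n k) (s k) (y k) (v k) (i k)"
    by metis
  define Y where "Y k = X (n k) (s k) (y k) (v k) (i k)" for k
  have int: "integrable P (Y k)" for k using good[of k] by (simp add: good_def Y_def)
  have ae: "AE \<omega> in P. \<forall>k. euler_scheme (a_closed p S (g \<omega>)) (n k) (s k) (\<lambda>l. y k l \<omega>) (\<lambda>l. v k l \<omega>)"
    unfolding AE_all_countable using good by (simp add: good_def)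
  have serr: "0 \<le> scheme_error (s k) (\<lambda>l. y k l \<omega>) (n k)" for k \<omega>
  proof -
    have "AE \<omega> in P. euler_scheme (a_closed p S (g \<omega>)) (n k) (s k) (\<lambda>l. y k l \<omega>) (\<lambda>l. v k l \<omega>)"
      using good[of k] by (simp add: good_def)
    \<comment> \<open>One \<open>\<omega>\<close> at which the scheme is valid shows that its time steps are positive.\<close>
    then have "\<exists>\<omega>0. euler_scheme (a_closed p S (g \<omega>0)) (n k) (s k) (\<lambda>l. y k l \<omega>0) (\<lambda>l. v k l \<omega>0)"
      using eventually_ex prob_space.AE_False[OF P] by (metis (mono_tags, lifting) eventually_mono)
    then show ?thesis unfolding scheme_error_def
      by (intro sum_nonneg mult_nonneg_nonneg) (auto simp: euler_scheme_def less_imp_le)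
  qed
  then have Y_nonneg: "0 \<le> Y k \<omega>" for k \<omega> by (simp add: Y_def X_def)
  have "(\<lambda>k. LINT \<omega>|P. norm (Y k \<omega>)) \<longlonglongrightarrow> 0"
  proof (rule tendsto_sandwich[OF _ _ tendsto_const LIMSEQ_inverse_real_of_nat])
    show "\<forall>\<^sub>F k in sequentially. 0 \<le> (LINT \<omega>|P. norm (Y k \<omega>))"
      by (intro always_eventually allI Bochner_Integration.integral_nonneg norm_ge_zero)
    show "\<forall>\<^sub>F k in sequentially. (LINT \<omega>|P. norm (Y k \<omega>)) \<le> inverse (real (Suc k))"
      using good Y_nonneg by (intro always_eventually allI) (simp add: good_def Y_def)
  qed
  from tendsto_L1_AE_subseq[OF int this] obtain r :: "nat \<Rightarrow> nat" where
    r: "strict_mono r" "AE \<omega> in P. (\<lambda>k. Y (r k) \<omega>) \<longlonglongrightarrow> 0" by blast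
  from r(2) ae show ?thesis
  proof eventually_elim
    case (elim \<omega>)
    show ?case unfolding euler_limit_def
    proof (intro allI impI)
      fix \<epsilon> :: real assume e: "\<epsilon> > 0"
      have "eventually (\<lambda>k. Y (r k) \<omega> < \<epsilon>) sequentially" by (rule order_tendstoD(2)[OF elim(1) e])
      moreover have "eventually (\<lambda>k. inverse (real (Suc (r k))) < \<epsilon>) sequentially"
        using order_tendstoD(2)[OF LIMSEQ_subseq_LIMSEQ[OF LIMSEQ_inverse_real_of_nat r(1)] e] by (simp add: o_def)
      ultimately have "eventually (\<lambda>k. Y (r k) \<omega> < \<epsilon> \<and> inverse (real (Suc (r k))) < \<epsilon>) sequentially"
        by (rule eventually_conj)
      then obtain k where "Y (r k) \<omega> < \<epsilon>" "inverse (real (Suc (r k))) < \<epsilon>"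
        by (auto simp: eventually_sequentially simp del: of_nat_Suc)
      then obtain m where m: "Y m \<omega> < \<epsilon>" "inverse (real (Suc m)) < \<epsilon>" by blast
      have "norm (v m 0 \<omega> - u \<omega>) \<le> \<epsilon>" "scheme_error (s m) (\<lambda>l. y m l \<omega>) (n m) \<le> \<epsilon>"
        "norm (U t \<omega> - v m (Suc (i m)) \<omega>) \<le> \<epsilon>"
        using m(1) serr[of m \<omega>] norm_ge_zero[of "v m 0 \<omega> - u \<omega>"] norm_ge_zero[of "U t \<omega> - v m (Suc (i m)) \<omega>"]
        unfolding Y_def X_def by linarith+
      moreover have "0 \<le> s m 0" "s m 0 \<le> \<epsilon>" "\<forall>l<n m. s m (Suc l) - s m l \<le> \<epsilon>" "i m < n m" "s m (i m) < t" "t \<le> s m (Suc (i m))"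
        using good[of m] m(2) unfolding good_def by force+
      ultimately show "\<exists>n s y w i. euler_scheme (a_closed p S (g \<omega>)) n s y w \<and>
         0 \<le> s 0 \<and> s 0 \<le> \<epsilon> \<and> (\<forall>l<n. s (Suc l) - s l \<le> \<epsilon>) \<and> i < n \<and> s i < t \<and> t \<le> s (Suc i) \<and>
         norm (w 0 - u \<omega>) \<le> \<epsilon> \<and> scheme_error s y n \<le> \<epsilon> \<and> norm (U t \<omega> - w (Suc i)) \<le> \<epsilon>"
        using elim(2) by (intro exI[of _ "n m"] exI[of _ "s m"] exI[of _ "\<lambda>l. y m l \<omega>"] exI[of _ "\<lambda>l. v m l \<omega>"] exI[of _ "i m"]) auto
    qed
  qed
qed

theorem theorem5p3:
  fixes P :: "'w measure" and S :: "(real^'n) set" and p g1 g2 :: real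
    and g :: "'w \<Rightarrow> (real^'n) L1"
    and T :: "real \<Rightarrow> ('w \<Rightarrow> (real^'n) L1) \<Rightarrow> 'w \<Rightarrow> (real^'n) L1"
    and T\<gamma> :: "real \<Rightarrow> (real^'n) L1 \<Rightarrow> (real^'n) L1 \<Rightarrow> (real^'n) L1"
    and u :: "'w \<Rightarrow> (real^'n) L1" and t :: real
  assumes "prob_space P" and "complete_measure P"
    and "CARD('n) \<ge> 2"
    and "1 < p" and "p \<noteq> 2"
    and "S \<noteq> {}" and "open S" and "bounded S" and "connected S" and "C1_domain S"
    and "0 < g1" and "g1 \<le> g2"
    and "g \<in> L1_Omega P S" and "measure P {\<omega>\<in>space P. g \<omega> \<in> L1_between g1 g2 S} = 1"
    and T: "\<And>w. w \<in> L1_Omega P S \<Longrightarrow>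
      mild_solution (L1_Omega P S) (L1_Omega_norm P) (A_closed P p S g) w (\<lambda>s. T s w)"
    and T\<gamma>: "\<And>\<gamma> v. \<gamma> \<in> L1_between g1 g2 S \<Longrightarrow> v \<in> L1_on S \<Longrightarrow>
      mild_solution (L1_on S) norm (a_closed p S \<gamma>) v (\<lambda>s. T\<gamma> s \<gamma> v)"
    and "u \<in> L1_Omega P S" and "0 \<le> t"
  shows "measure P {\<omega>\<in>space P. T t u \<omega> = T\<gamma> t (g \<omega>) (u \<omega>)} = 1"
proof -
  note P = \<open>prob_space P\<close> and u = \<open>u \<in> L1_Omega P S\<close>
  interpret prob_space P by (rule P)
  interpret complete_measure P by (rule \<open>complete_measure P\<close>)
  have \<gamma>: "AE \<omega> in P. g \<omega> \<in> L1_between g1 g2 S"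
    using AE_prob_1[OF assms(14)] by eventually_elim simp
  have "AE \<omega> in P. T t u \<omega> = T\<gamma> t (g \<omega>) (u \<omega>)"
  \<comment> \<open>Euler schemes describe positive times only; at time zero both sides are the initial value.\<close>
  proof (cases "t = 0")
    case True
    have "L1_Omega_norm P (T 0 u - u) = 0" "T 0 u \<in> L1_Omega P S"
      using T[OF u] by (auto simp: mild_solution_def)
    then have "AE \<omega> in P. norm (T 0 u \<omega> - u \<omega>) = 0"
      using integral_nonneg_eq_0_iff_AE[OF integrable_norm_diff_L1_Omega[OF _ u, of "T 0 u"]]
      by (simp add: L1_Omega_norm_diff)
    with \<gamma> AE_space show ?thesis
    proof eventually_elim
      case (elim \<omega>)
      have "norm (T\<gamma> 0 (g \<omega>) (u \<omega>) - u \<omega>) = 0"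
        using T\<gamma>[OF elim(1) L1_OmegaD(2)[OF u elim(2)]] by (simp add: mild_solution_def)
      with elim True show ?case by simp
    qed
  next
    case False
    with \<open>0 \<le> t\<close> have t: "t > 0" by simp
    from random_mild_solution_pointwise[OF P u T[OF u] t] \<gamma> AE_space show ?thesis
    proof eventually_elim
      case (elim \<omega>)
      note mild = T\<gamma>[OF elim(2) L1_OmegaD(2)[OF u elim(3)]]
      have "accretive (a_closed p S (g \<omega>))"
        unfolding a_closed_def
        by (intro accretive_operator_closure accretive_a_core[OF \<open>open S\<close> \<open>bounded S\<close> \<open>1 < p\<close> elim(2) \<open>0 < g1\<close>])
      from euler_limit_unique[OF this mild_solution_initial_in_closure[OF mild] t elim(1) mild_solution_euler_limit[OF mild t]]
      show ?case .
    qed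
  qed
  then have null: "{\<omega>\<in>space P. T t u \<omega> \<noteq> T\<gamma> t (g \<omega>) (u \<omega>)} \<in> null_sets P"
    by (simp add: AE_iff_null_sets)
  have "{\<omega>\<in>space P. T t u \<omega> = T\<gamma> t (g \<omega>) (u \<omega>)} = space P - {\<omega>\<in>space P. T t u \<omega> \<noteq> T\<gamma> t (g \<omega>) (u \<omega>)}"
    by auto
  then show ?thesis using null by (simp add: prob_compl measure_eq_0_null_sets null_setsD2)
qed

end
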